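(* Let $L\colon\mathbb R^n\times\mathbb R^n\to\mathbb R_+$ and $\varphi\colon\mathbb R^n\to\mathbb R_+\cup\{+\infty\}$ satisfy the standing assumptions listed in the context, let $V$ be the value function and $H$ the Hamiltonian, and assume that $L$ is continuous. Then: (i) $V$ is (finite and) locally Lipschitz on $\mathbb R_+^\star\times\mathbb R^n$ and satisfies $$\forall (t,x)\in\mathbb R_+^\star\times\mathbb R^n,\ \forall (p_t,p_x)\in\partial_-V(t,x):\quad p_t+H(x,-p_x)=0. \tag{a}$$ (ii) Let $W\colon\mathbb R_+^\star\times\mathbb R^n\to\mathbb R_+$ be a locally Lipschitz function which satisfies the initial condition $$\forall x\in\mathbb R^n:\quad \liminf_{h\to0+,\ y\to x}W(h,y)=\varphi(x). \tag{b}$$ If $p_t+H(x,-p_x)\ge0$ for all $(t,x)\in\mathbb R_+^\star\times\mathbb R^n$ and all $(p_t,p_x)\in\partial_-W(t,x)$, then $W\ge V$ on $\mathbb R_+^\star\times\mathbb R^n$. If $p_t+H(x,-p_x)\le0$ for all $(t,x)\in\mathbb R_+^\star\times\mathbb R^n$ and all $(p_t,p_x)\in\partial_-W(t,x)$, then $W\le V$ on $\mathbb R_+^\star\times\mathbb R^n$. (iii) Therefore the restriction of $V$ to $\mathbb R_+^\star\times\mathbb R^n$ is the unique non-negative locally Lipschitz function on $\mathbb R_+^\star\times\mathbb R^n$ which satisfies the initial condition (b) and condition (a).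
   Context: Notation: $\mathbb R_+=[0,+\infty)$, $\mathbb R_+^\star=(0,+\infty)$. Standing assumptions: $L\colon\mathbb R^n\times\mathbb R^n\to\mathbb R_+$ is lower semicontinuous and $L(x,\cdot)$ is convex for every $x$; there is a convex function $\Theta\colon\mathbb R^n\to\mathbb R_+$ with $\lim_{|u|\to\infty}\Theta(u)/|u|=+\infty$ and $L(x,u)\ge\Theta(u)$ for all $(x,u)$; $\varphi\colon\mathbb R^n\to\mathbb R_+\cup\{+\infty\}$ is lower semicontinuous and not identically $+\infty$. Value function: for $(t,x)\in\mathbb R_+\times\mathbb R^n$, $$V(t,x)=\inf\Big\{\int_0^t L(y(s),y'(s))\,ds+\varphi(y(t)) : y\in W^{1,1}(0,t;\mathbb R^n),\ y(0)=x\Big\}.$$ Hamiltonian: $H(x,p)=\sup_{u\in\mathbb R^n}\big(\langle p,u\rangle-L(x,u)\big)$. Subdifferential: for a real-valued function $W$ on $\mathbb R_+^\star\times\mathbb R^n$ and a point $z=(t,x)$, $$\partial_-W(z)=\Big\{p\in\mathbb R\times\mathbb R^n : \liminf_{z'\to z}\frac{W(z')-W(z)-\langle p,z'-z\rangle}{|z'-z|}\ge0\Big\}.$$ *)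

theory Defs
  imports "HOL-Analysis.Analysis"
begin

definition lower_semicont :: "('a::topological_space \<Rightarrow> 'b::complete_linorder) \<Rightarrow> bool"
  where "lower_semicont f \<longleftrightarrow> (\<forall>x. f x \<le> Liminf (at x) f)"

text \<open>
  The space $W^{1,1}(0,t;\mathbf{R}^n)$ is defined through weak derivatives, with test functions
  in $C^1_c(0,t)$.  A class in this space has a unique continuous representative on $[0,t]$; boundary
  values always refer to that representative, so \<open>y\<close> below is taken continuous on $[0,t]$
  (hence in $L^1$), while \<open>v\<close> is any representative of the weak derivative \<open>y'\<close>.
\<close>

definition test_function :: "real \<Rightarrow> (real \<Rightarrow> real) \<Rightarrow> bool"
  where "test_function t \<psi> \<longleftrightarrow>
    (\<forall>s. \<psi> differentiable at s) \<and> continuous_on UNIV (deriv \<psi>) \<and>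
    compact (closure (support_on UNIV \<psi>)) \<and> closure (support_on UNIV \<psi>) \<subseteq> {0<..<t}"

definition W11_with_deriv ::
  "real \<Rightarrow> (real \<Rightarrow> 'a::euclidean_space) \<Rightarrow> (real \<Rightarrow> 'a) \<Rightarrow> bool"
  where "W11_with_deriv t y v \<longleftrightarrow>
    continuous_on {0..t} y \<and> v absolutely_integrable_on {0..t} \<and>
    (\<forall>\<psi>. test_function t \<psi> \<longrightarrow>
      integral {0..t} (\<lambda>s. deriv \<psi> s *\<^sub>R y s) = - integral {0..t} (\<lambda>s. \<psi> s *\<^sub>R v s))"

definition value_fun ::
  "('a::euclidean_space \<Rightarrow> 'a \<Rightarrow> real) \<Rightarrow> ('a \<Rightarrow> ennreal) \<Rightarrow> real \<Rightarrow> 'a \<Rightarrow> ennreal"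
  where "value_fun L \<phi> t x =
    (INF (y, v) \<in> {(y, v). W11_with_deriv t y v \<and> y 0 = x}.
      (\<integral>\<^sup>+ s\<in>{0..t}. ennreal (L (y s) (v s)) \<partial>lebesgue) + \<phi> (y t))"

text \<open>
  The real-valued version of the value function; it carries the same information only at points
  where \<^const>\<open>value_fun\<close> is finite (\<^const>\<open>enn2real\<close> sends infinity to 0).
\<close>

definition value_real ::
  "('a::euclidean_space \<Rightarrow> 'a \<Rightarrow> real) \<Rightarrow> ('a \<Rightarrow> ennreal) \<Rightarrow> real \<times> 'a \<Rightarrow> real"
  where "value_real L \<phi> = (\<lambda>(t, x). enn2real (value_fun L \<phi> t x))"

definition Hamiltonian :: "('a::euclidean_space \<Rightarrow> 'a \<Rightarrow> real) \<Rightarrow> 'a \<Rightarrow> 'a \<Rightarrow> ereal"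
  where "Hamiltonian L x p = (SUP u. ereal (p \<bullet> u - L x u))"

text \<open>
  Functions on $(0,\infty)\times\mathbf{R}^n$ are total functions whose values outside
  \<open>pos_times\<close> are irrelevant.  As \<open>pos_times\<close> is open, the filter \<open>at z\<close> in
  \<open>subdiff\<close> only sees the values of \<open>W\<close> in this set when \<open>z\<close> belongs to it.
\<close>

abbreviation pos_times :: "(real \<times> 'a::euclidean_space) set"
  where "pos_times \<equiv> {0<..} \<times> UNIV"

definition subdiff :: "('z::euclidean_space \<Rightarrow> real) \<Rightarrow> 'z \<Rightarrow> 'z set"
  where "subdiff W z =
    {p. 0 \<le> Liminf (at z) (\<lambda>z'. ereal ((W z' - W z - p \<bullet> (z' - z)) / norm (z' - z)))}"

definition locally_lipschitz_on ::
  "'y::metric_space set \<Rightarrow> ('y \<Rightarrow> 'z::metric_space) \<Rightarrow> bool"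
  where "locally_lipschitz_on S f \<longleftrightarrow>
    (\<forall>z\<in>S. \<exists>e>0. \<exists>C. C-lipschitz_on (ball z e \<inter> S) f)"

definition initial_condition :: "('a::euclidean_space \<Rightarrow> ennreal) \<Rightarrow> (real \<times> 'a \<Rightarrow> real) \<Rightarrow> bool"
  where "initial_condition \<phi> W \<longleftrightarrow>
    (\<forall>x. Liminf (at_right 0 \<times>\<^sub>F nhds x) (\<lambda>(h, y). ennreal (W (h, y))) = \<phi> x)"

definition HJ_subdiff_equation ::
  "('a::euclidean_space \<Rightarrow> 'a \<Rightarrow> real) \<Rightarrow> (real \<times> 'a \<Rightarrow> real) \<Rightarrow> bool"
  where "HJ_subdiff_equation L W \<longleftrightarrow>
    (\<forall>(t, x)\<in>pos_times. \<forall>(p\<^sub>t, p\<^sub>x)\<in>subdiff W (t, x). ereal p\<^sub>t + Hamiltonian L x (- p\<^sub>x) = 0)"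

end

theory Submission
  imports Defs
begin

text \<open>
  Everything reduces to a comparison principle for locally Lipschitz functions: a supersolution \<open>W1\<close>
  dominates a subsolution \<open>W2\<close> (both in the sense of lower subdifferentials) with the same initial
  condition. From \<open>W1\<close> one builds polygonal curves by proximal aiming: a quadratic inf-convolution of
  \<open>W1\<close> provides a subgradient of \<open>W1\<close> near the current point, and the velocity almost attains the
  Hamiltonian there, so that \<open>W1\<close> decreases at least by the running cost. Along each segment of such
  a curve \<open>W2\<close> decreases at most by the running cost, again by an inf-convolution argument. Only
  bounded velocities occur, so continuity of \<open>L\<close> suffices.

  The value function is itself a subsolution and a supersolution by dynamic programming, the latter
  because \<open>L (y s) (v s) \<ge> q \<bullet> v s - H(x, q) - \<epsilon>\<close> as long as \<open>y s\<close> is close to \<open>x\<close>. The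
  comparison principle applied to it and to \<open>W\<close> gives both inequalities.
\<close>

section \<open>The du Bois-Reymond lemma and absolutely continuous curves\<close>

text \<open>A locally Lipschitz function may have no lower subgradient at the point under
  consideration. The inf-convolution supplies one at a point within \<open>\<eta>\<close>, and
  uniform continuity of \<open>L\<close> on compact sets pays for the displacement. This dictates
  the order of choices: the Lipschitz constant on a compact set bounds the subgradients
  independently of \<open>\<eta>\<close>; superlinearity turns that bound into a bound on the
  velocities; only then is a modulus of continuity of \<open>L\<close> available, from which
  \<open>\<eta>\<close> is chosen; the curvature \<open>k\<close> of the inf-convolution,
  uncontrolled as \<open>\<eta>\<close> shrinks, comes next, and the number of steps last. Weak
  derivatives matter only for the value function itself. Its curves have unbounded velocities, so
  they are never tested against \<open>W\<close> directly: coercivity with a large enough slope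
  confines them, and otherwise they are only cut, joined and partly replaced by segments.\<close>

lemma absolutely_integrable_continuous_scaleR:
  fixes v :: "real \<Rightarrow> 'a::euclidean_space"
  assumes v: "v absolutely_integrable_on {a..b}" and c: "continuous_on {a..b} c"
  shows "(\<lambda>s. c s *\<^sub>R v s) absolutely_integrable_on {a..b}"
proof (rule absolutely_integrable_bounded_measurable_product[where h = "\<lambda>x y. x *\<^sub>R y"])
  show "bilinear (\<lambda>x y::'a. x *\<^sub>R y)"
    by (simp add: bilinear_conv_bounded_bilinear bounded_bilinear_scaleR)
  show "c \<in> borel_measurable (lebesgue_on {a..b})"
    by (rule continuous_imp_measurable_on_sets_lebesgue[OF c]) auto
  show "bounded (c ` {a..b})"
    by (intro compact_imp_bounded compact_continuous_image c) auto
qed (use v in auto)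

text \<open>No pointwise derivative of \<open>y\<close> is used. The defect \<open>g\<close> between
  the product and the integral of its formal derivative has increments bounded by
  \<open>b - a\<close> times the increment of \<open>A\<close>, the integral of the norm of
  \<open>v\<close>. As \<open>A\<close> is continuous, this is o(b - a), so \<open>g\<close> has
  derivative zero everywhere and is constant.\<close>

lemma integration_by_parts_indefinite_integral:
  fixes v :: "real \<Rightarrow> 'a::euclidean_space" and \<psi> :: "real \<Rightarrow> real"
  assumes t: "0 \<le> t" and v: "v absolutely_integrable_on {0..t}"
    and y: "\<And>s. s \<in> {0..t} \<Longrightarrow> y s = y 0 + integral {0..s} v"
    and diff: "\<And>s. (\<psi> has_real_derivative \<psi>' s) (at s)" and cont: "continuous_on UNIV \<psi>'"
  shows "integral {0..t} (\<lambda>s. \<psi>' s *\<^sub>R y s) =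
    \<psi> t *\<^sub>R y t - \<psi> 0 *\<^sub>R y 0 - integral {0..t} (\<lambda>s. \<psi> s *\<^sub>R v s)"
proof -
  have vi: "v integrable_on {0..t}" and nvi: "(\<lambda>s. norm (v s)) integrable_on {0..t}"
    using v by (auto simp: absolutely_integrable_on_def)
  have cont': "continuous_on S \<psi>'" for S
    using cont continuous_on_subset by blast
  have cpsi: "continuous_on S \<psi>" for S
    using diff by (meson DERIV_isCont continuous_at_imp_continuous_on)
  have ycont: "continuous_on {0..t} y"
  proof -
    have "continuous_on {0..t} (\<lambda>s. y 0 + integral {0..s} v)"
      by (intro continuous_intros indefinite_integral_continuous_1 vi)
    then show ?thesis using y by (metis (no_types, lifting) continuous_on_cong)
  qed
  have "compact (\<psi>' ` {0..t})"
    by (intro compact_continuous_image cont') auto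
  then obtain C where C: "\<And>s. s \<in> {0..t} \<Longrightarrow> \<bar>\<psi>' s\<bar> \<le> C"
    by (metis compact_imp_bounded bounded_iff image_eqI real_norm_def)
  have "0 \<le> C" using C[of 0] t by force
  define f where "f = (\<lambda>s. \<psi>' s *\<^sub>R y s + \<psi> s *\<^sub>R v s)"
  have i1: "(\<lambda>s. \<psi>' s *\<^sub>R y s) integrable_on {0..t}"
    by (intro integrable_continuous_real continuous_intros cont' ycont)
  have i2: "(\<lambda>s. \<psi> s *\<^sub>R v s) integrable_on {0..t}"
    using absolutely_integrable_continuous_scaleR[OF v cpsi] by (simp add: absolutely_integrable_on_def)
  have fi: "f integrable_on {0..t}"
    unfolding f_def by (intro integrable_add i1 i2)
  define g where "g = (\<lambda>s. \<psi> s *\<^sub>R y s - integral {0..s} f)"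
  define A where "A = (\<lambda>s. integral {0..s} (\<lambda>s. norm (v s)))"
  have sub: "h integrable_on {a..b}" if "h integrable_on {0..t}" "0 \<le> a" "b \<le> t" for h :: "real \<Rightarrow> 'z::banach" and a b
    using that by (auto intro: integrable_subinterval_real)
  have comb: "integral {0..b} h - integral {0..a} h = integral {a..b} h"
    if "h integrable_on {0..t}" "0 \<le> a" "a \<le> b" "b \<le> t" for h :: "real \<Rightarrow> 'z::banach" and a b
    using Henstock_Kurzweil_Integration.integral_combine[of 0 a b h] sub[of h 0 b] that
    by (simp add: algebra_simps)
  \<comment> \<open>Freeze \<open>y\<close> at \<open>b\<close> in the first term of
    \<open>f\<close> and \<open>\<psi>\<close> at \<open>a\<close> in the second: the two frozen
    integrals add up exactly to the increment of the product, and what remains are products of two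
    small increments.\<close>
  have est: "norm (g b - g a) \<le> 2 * C * (b - a) * (A b - A a)"
    if ab: "0 \<le> a" "a \<le> b" "b \<le> t" for a b
  proof -
    have yd: "y d - y c = integral {c..d} v" if "a \<le> c" "c \<le> d" "d \<le> b" for c d
      using y[of d] y[of c] comb[OF vi, of c d] that ab by simp
    have psid: "(\<psi>' has_integral (\<psi> b - \<psi> a)) {a..b}"
      by (rule fundamental_theorem_of_calculus)
         (use ab diff in \<open>auto simp: has_real_derivative_iff_has_vector_derivative intro: has_vector_derivative_at_within\<close>)
    have h1: "((\<lambda>s. \<psi>' s *\<^sub>R y b) has_integral (\<psi> b - \<psi> a) *\<^sub>R y b) {a..b}"
      using has_integral_scaleR_left[OF psid] .
    have h2: "((\<lambda>s. \<psi> a *\<^sub>R v s) has_integral \<psi> a *\<^sub>R (y b - y a)) {a..b}"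
      using yd[of a b] ab sub[OF vi, of a b] by (auto intro!: has_integral_cmul integrable_integral)
    have hf: "(f has_integral (integral {0..b} f - integral {0..a} f)) {a..b}"
      using comb[OF fi, of a b] sub[OF fi, of a b] ab by (simp add: integrable_integral)
    have "((\<lambda>s. \<psi>' s *\<^sub>R y b + \<psi> a *\<^sub>R v s - f s) has_integral
        (\<psi> b - \<psi> a) *\<^sub>R y b + \<psi> a *\<^sub>R (y b - y a) - (integral {0..b} f - integral {0..a} f)) {a..b}"
      by (intro has_integral_add has_integral_diff h1 h2 hf)
    then have hi: "((\<lambda>s. \<psi>' s *\<^sub>R (y b - y s) + (\<psi> a - \<psi> s) *\<^sub>R v s) has_integral (g b - g a)) {a..b}"
      by (simp add: f_def g_def algebra_simps)
    define N where "N = A b - A a"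
    have N: "N = integral {a..b} (\<lambda>s. norm (v s))"
      unfolding N_def A_def using comb[OF nvi, of a b] ab by simp
    have nab: "(\<lambda>s. norm (v s)) integrable_on {a..b}" using sub[OF nvi] ab by simp
    have pt: "norm (\<psi>' s *\<^sub>R (y b - y s) + (\<psi> a - \<psi> s) *\<^sub>R v s) \<le> C * N + C * (b - a) * norm (v s)"
      if s: "s \<in> {a..b}" for s
    proof -
      have "norm (y b - y s) = norm (integral {s..b} v)" using yd[of s b] s by simp
      also have "\<dots> \<le> integral {s..b} (\<lambda>s. norm (v s))"
        by (rule integral_norm_bound_integral) (use sub[OF vi] sub[OF nvi] s ab in auto)
      also have "\<dots> \<le> N" unfolding N
        by (rule integral_subset_le) (use sub[OF nvi] s ab in auto)
      finally have 1: "norm (y b - y s) \<le> N" .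
      have "norm (\<psi> a - \<psi> s) \<le> C * norm (a - s)"
        by (rule field_differentiable_bound[where f' = \<psi>' and S = "{a..b}"])
           (use s ab C diff in \<open>auto intro: DERIV_subset\<close>)
      then have 2: "\<bar>\<psi> a - \<psi> s\<bar> \<le> C * (b - a)"
        using s \<open>0 \<le> C\<close> by (smt (verit, best) atLeastAtMost_iff mult_left_mono real_norm_def)
      have "norm (\<psi>' s *\<^sub>R (y b - y s)) \<le> C * N"
        using C[of s] 1 s ab \<open>0 \<le> C\<close> by (auto intro!: mult_mono)
      moreover have "norm ((\<psi> a - \<psi> s) *\<^sub>R v s) \<le> C * (b - a) * norm (v s)"
        using 2 by (auto intro!: mult_right_mono)
      ultimately show ?thesis by (meson add_mono norm_triangle_le)
    qed
    have ii: "(\<lambda>s. C * N + C * (b - a) * norm (v s)) integrable_on {a..b}"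
      by (intro integrable_add integrable_on_mult_right nab integrable_const_ivl)
    have "norm (g b - g a) \<le> integral {a..b} (\<lambda>s. C * N + C * (b - a) * norm (v s))"
      using integral_norm_bound_integral[of "\<lambda>s. \<psi>' s *\<^sub>R (y b - y s) + (\<psi> a - \<psi> s) *\<^sub>R v s" "{a..b}"
          "\<lambda>s. C * N + C * (b - a) * norm (v s)"] hi pt ii
      by (simp add: has_integral_iff)
    also have "\<dots> = C * N * (b - a) + C * (b - a) * N"
      using ab nab by (subst integral_add) (auto simp: N intro!: integrable_on_mult_right)
    finally show ?thesis by (simp add: N_def algebra_simps)
  qed
  have Acont: "continuous_on {0..t} A"
    unfolding A_def by (intro indefinite_integral_continuous_1 nvi)
  have est2: "norm (g b - g a) \<le> 2 * C * \<bar>A b - A a\<bar> * \<bar>b - a\<bar>" if "a \<in> {0..t}" "b \<in> {0..t}" for a b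
  proof (cases "a \<le> b")
    case True
    have "2 * C * (b - a) * (A b - A a) \<le> 2 * C * (b - a) * \<bar>A b - A a\<bar>"
      using True \<open>0 \<le> C\<close> by (intro mult_left_mono) auto
    moreover have "2 * C * (b - a) * \<bar>A b - A a\<bar> = 2 * C * \<bar>A b - A a\<bar> * \<bar>b - a\<bar>"
      using True by simp
    ultimately show ?thesis using est[of a b] that True by force
  next
    case False
    have "2 * C * (a - b) * (A a - A b) \<le> 2 * C * (a - b) * \<bar>A b - A a\<bar>"
      using False \<open>0 \<le> C\<close> by (intro mult_left_mono) auto
    moreover have "2 * C * (a - b) * \<bar>A b - A a\<bar> = 2 * C * \<bar>A b - A a\<bar> * \<bar>b - a\<bar>"
      using False by simp
    ultimately show ?thesis using est[of b a] that False by (force simp: norm_minus_commute)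
  qed
  have "(g has_derivative (\<lambda>h. 0)) (at a within {0..t})" if a: "a \<in> {0..t}" for a
    unfolding has_derivative_within_alt
  proof safe
    fix e :: real assume "0 < e"
    define e' where "e' = e / (2 * C + 1)"
    have "e' > 0" using \<open>0 < e\<close> \<open>0 \<le> C\<close> by (simp add: e'_def)
    then obtain d where d: "d > 0" "\<And>b. b \<in> {0..t} \<Longrightarrow> dist b a < d \<Longrightarrow> dist (A b) (A a) < e'"
      using Acont a unfolding continuous_on_iff by metis
    have "norm (g b - g a - 0) \<le> e * norm (b - a)" if "b \<in> {0..t}" "norm (b - a) < d" for b
    proof -
      have "\<bar>A b - A a\<bar> < e'" using d(2)[of b] that by (simp add: dist_norm)
      then have "2 * C * \<bar>A b - A a\<bar> \<le> 2 * C * e'" using \<open>0 \<le> C\<close> by (simp add: mult_left_mono)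
      also have "\<dots> \<le> e"
        using \<open>0 \<le> C\<close> \<open>0 < e\<close> by (simp add: e'_def field_simps)
      finally have "2 * C * \<bar>A b - A a\<bar> * \<bar>b - a\<bar> \<le> e * \<bar>b - a\<bar>"
        by (rule mult_right_mono) simp
      then show ?thesis using est2[OF a that(1)] by simp
    qed
    then show "\<exists>d>0. \<forall>b\<in>{0..t}. norm (b - a) < d \<longrightarrow> norm (g b - g a - 0) \<le> e * norm (b - a)"
      using d(1) by blast
  qed simp
  then obtain c where c: "\<And>a. a \<in> {0..t} \<Longrightarrow> g a = c"
    using has_derivative_zero_constant[of "{0..t}" g] by auto
  have "g t = g 0" using c t by simp
  moreover have "integral {0..t} f = integral {0..t} (\<lambda>s. \<psi>' s *\<^sub>R y s) + integral {0..t} (\<lambda>s. \<psi> s *\<^sub>R v s)"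
    unfolding f_def by (intro Henstock_Kurzweil_Integration.integral_add i1 i2)
  ultimately show ?thesis by (simp add: g_def algebra_simps)
qed

text \<open>The truncated square is the primitive from which test functions with piecewise linear,
  continuous derivative are assembled.\<close>

lemma has_real_derivative_max_0_power2:
  "((\<lambda>s::real. (max 0 s)\<^sup>2) has_real_derivative 2 * max 0 x) (at x)"
proof -
  consider "x < 0" | "x = 0" | "x > 0" by linarith
  then show ?thesis
  proof cases
    case 1
    have "((\<lambda>s::real. (max 0 s)\<^sup>2) has_real_derivative 0) (at x)"
      by (rule has_field_derivative_transform_within_open[where S = "{..<0}" and f = "\<lambda>_. 0"])
         (use 1 in auto)
    then show ?thesis using 1 by simp
  next
    case 2
    have "((\<lambda>h. (max 0 h)\<^sup>2 / h) \<longlongrightarrow> 0) (at (0::real))"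
    proof (rule Lim_null_comparison)
      show "\<forall>\<^sub>F h in at (0::real). norm ((max 0 h)\<^sup>2 / h) \<le> \<bar>h\<bar>"
        by (rule always_eventually) (auto simp: max_def power2_eq_square)
      show "((\<lambda>h::real. \<bar>h\<bar>) \<longlongrightarrow> 0) (at 0)"
        by (intro tendsto_eq_intros) auto
    qed
    then show ?thesis using 2 by (simp add: DERIV_def)
  next
    case 3
    have "((\<lambda>s::real. (max 0 s)\<^sup>2) has_real_derivative 2 * x) (at x)"
    proof (rule has_field_derivative_transform_within_open[where S = "{0<..}" and f = "\<lambda>s. s\<^sup>2"])
      show "((\<lambda>s. s\<^sup>2) has_real_derivative 2 * x) (at x)"
        by (auto intro!: derivative_eq_intros)
    qed (use 3 in auto)
    then show ?thesis using 3 by simp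
  qed
qed

text \<open>If \<open>z c \<noteq> z d\<close>, test against a \<open>\<psi>\<close> whose derivative is a tent
  around \<open>c\<close> minus the same tent around \<open>d\<close>.\<close>

lemma du_Bois_Reymond:
  fixes z :: "real \<Rightarrow> 'a::euclidean_space"
  assumes cont: "continuous_on {0..t} z"
    and test: "\<And>\<psi>. test_function t \<psi> \<Longrightarrow> integral {0..t} (\<lambda>s. deriv \<psi> s *\<^sub>R z s) = 0"
    and s: "s \<in> {0..t}"
  shows "z s = z 0"
proof (cases "t = 0")
  case True
  then show ?thesis using s by simp
next
  case False
  with s have t: "0 < t" by simp
  have eq: "z c = z d" if cd: "0 < c" "c < d" "d < t" for c d
  proof (rule ccontr)
    assume ne: "z c \<noteq> z d"
    define e where "e = z d - z c"
    have e: "e \<bullet> e > 0" using ne by (simp add: e_def)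
    \<comment> \<open>Subtracting the midpoint of \<open>z c\<close> and \<open>z d\<close> is free,
      because the derivative of a test function has integral zero; it gives the component along
      \<open>e\<close> opposite signs near \<open>c\<close> and near \<open>d\<close>.\<close>
    define w where "w = (\<lambda>s. (z s - (1/2) *\<^sub>R (z c + z d)) \<bullet> e)"
    have wc: "w c = - (e \<bullet> e) / 2" and wd: "w d = (e \<bullet> e) / 2"
      by (auto simp: w_def e_def inner_diff inner_add algebra_simps)
    have wcont: "continuous_on {0..t} w"
      unfolding w_def by (intro continuous_intros cont)
    obtain d1 where d1: "d1 > 0" "\<And>s. s \<in> {0..t} \<Longrightarrow> dist s c < d1 \<Longrightarrow> dist (w s) (w c) < (e \<bullet> e) / 2"
      using continuous_on_iff[THEN iffD1, OF wcont, rule_format, of c "(e \<bullet> e) / 2"] cd e by auto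
    obtain d2 where d2: "d2 > 0" "\<And>s. s \<in> {0..t} \<Longrightarrow> dist s d < d2 \<Longrightarrow> dist (w s) (w d) < (e \<bullet> e) / 2"
      using continuous_on_iff[THEN iffD1, OF wcont, rule_format, of d "(e \<bullet> e) / 2"] cd e by auto
    define \<delta> where "\<delta> = min (min d1 d2) (min (c / 2) ((t - d) / 2))"
    have \<delta>: "0 < \<delta>" "\<delta> \<le> d1" "\<delta> \<le> d2" "\<delta> < c" "\<delta> < t - d"
      using d1(1) d2(1) cd by (auto simp: \<delta>_def min_less_iff_disj min_le_iff_disj)
    \<comment> \<open>\<open>T\<close> is a tent of height \<open>\<delta>\<close> on
      \<open>{-\<delta>..\<delta>}\<close> and \<open>B\<close> its primitive, rising from 0 to the
      square of \<open>\<delta>\<close>. Two translates of \<open>B\<close> therefore cancel to the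
      right of both tents, which makes the support of \<open>\<psi>\<close> compact.\<close>
    define T where "T = (\<lambda>s. max 0 (s + \<delta>) - 2 * max 0 s + max 0 (s - \<delta>))"
    define B where "B = (\<lambda>s. ((max 0 (s + \<delta>))\<^sup>2 - 2 * (max 0 s)\<^sup>2 + (max 0 (s - \<delta>))\<^sup>2) / 2)"
    define \<psi> where "\<psi> = (\<lambda>s. B (s - c) - B (s - d))"
    have T0: "0 \<le> T s" "\<bar>s\<bar> \<ge> \<delta> \<Longrightarrow> T s = 0" for s
      using \<delta>(1) unfolding T_def by linarith+
    have dmax: "((\<lambda>s. (max 0 (s + a))\<^sup>2) has_real_derivative 2 * max 0 (s + a)) (at s)" for a s :: real
    proof -
      have "((\<lambda>s. s + a) has_real_derivative 1) (at s)"
        by (auto intro!: derivative_eq_intros)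
      from DERIV_chain2[OF has_real_derivative_max_0_power2 this] show ?thesis by simp
    qed
    have dB: "(B has_real_derivative T s) (at s)" for s
    proof -
      have "(B has_real_derivative
          (2 * max 0 (s + \<delta>) - 2 * (2 * max 0 (s + 0)) + 2 * max 0 (s + - \<delta>)) / 2) (at s)"
        unfolding B_def
        using DERIV_cdivide[OF DERIV_add[OF DERIV_diff[OF dmax[of \<delta> s] DERIV_cmult[OF dmax[of 0 s], of 2]]
            dmax[of "- \<delta>" s]], of 2] by simp
      moreover have "T s = (2 * max 0 (s + \<delta>) - 2 * (2 * max 0 (s + 0)) + 2 * max 0 (s + - \<delta>)) / 2"
        by (simp add: T_def)
      ultimately show ?thesis by metis
    qed
    have dpsi: "(\<psi> has_real_derivative (T (s - c) - T (s - d))) (at s)" for s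
    proof -
      have "((\<lambda>s. B (s - a)) has_real_derivative T (s - a)) (at s)" for a
      proof -
        have "((\<lambda>s. s - a) has_real_derivative 1) (at s)"
          by (auto intro!: derivative_eq_intros)
        from DERIV_chain2[OF dB this] show ?thesis by simp
      qed
      from DERIV_diff[OF this[of c] this[of d]] show ?thesis unfolding \<psi>_def .
    qed
    have deriv: "deriv \<psi> = (\<lambda>s. T (s - c) - T (s - d))"
      by (rule ext) (rule DERIV_imp_deriv[OF dpsi])
    have Tcont: "continuous_on S T" for S
      unfolding T_def by (intro continuous_intros)
    have pcont: "continuous_on S (deriv \<psi>)" for S
      unfolding deriv T_def by (intro continuous_intros)
    have Bs: "B s = 0" if "s \<le> - \<delta>" for s using that \<delta>(1) by (simp add: B_def)
    have Bs': "B s = \<delta>\<^sup>2" if "s \<ge> \<delta>" for s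
      using that \<delta>(1) by (simp add: B_def power2_eq_square algebra_simps)
    have supp: "support_on UNIV \<psi> \<subseteq> {c - \<delta>..d + \<delta>}"
    proof -
      have "\<psi> s = 0" if "s < c - \<delta> \<or> d + \<delta> < s" for s
        using that Bs[of "s - c"] Bs[of "s - d"] Bs'[of "s - c"] Bs'[of "s - d"] cd by (auto simp: \<psi>_def)
      then show ?thesis by (force simp: support_on_def)
    qed
    then have csupp: "closure (support_on UNIV \<psi>) \<subseteq> {c - \<delta>..d + \<delta>}"
      by (intro closure_minimal) auto
    have "test_function t \<psi>"
      unfolding test_function_def
    proof (intro conjI allI)
      show "\<psi> differentiable at s" for s using dpsi real_differentiable_def by blast
      show "compact (closure (support_on UNIV \<psi>))"
        using supp by (meson bounded_closed_interval bounded_subset compact_closure)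
      show "closure (support_on UNIV \<psi>) \<subseteq> {0<..<t}" using csupp \<delta> by force
    qed (rule pcont)
    from test[OF this] have "integral {0..t} (\<lambda>s. deriv \<psi> s *\<^sub>R z s) = 0" .
    moreover have "(\<lambda>s. deriv \<psi> s *\<^sub>R z s) integrable_on {0..t}"
      by (intro integrable_continuous_real continuous_intros pcont cont)
    ultimately have 1: "((\<lambda>s. deriv \<psi> s *\<^sub>R z s) has_integral 0) {0..t}"
      by (metis integrable_integral)
    have 2: "(deriv \<psi> has_integral (\<psi> t - \<psi> 0)) {0..t}"
      by (rule fundamental_theorem_of_calculus)
         (use t dpsi in \<open>auto simp: deriv has_real_derivative_iff_has_vector_derivative intro: has_vector_derivative_at_within\<close>)
    have "\<psi> t = 0" "\<psi> 0 = 0"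
      using Bs[of "0 - c"] Bs[of "0 - d"] Bs'[of "t - c"] Bs'[of "t - d"] cd \<delta> by (auto simp: \<psi>_def)
    with 2 have 2: "(deriv \<psi> has_integral 0) {0..t}" by simp
    define m where "m = ((1/2) *\<^sub>R (z c + z d)) \<bullet> e"
    have "((\<lambda>s. deriv \<psi> s * m - (deriv \<psi> s *\<^sub>R z s) \<bullet> e) has_integral (0 * m - 0 \<bullet> e)) {0..t}"
      using has_integral_diff[OF has_integral_mult_left[OF 2, of m]
          has_integral_linear[OF 1 bounded_linear_inner_left[of e]]] by (simp add: o_def)
    moreover have "(\<lambda>s. deriv \<psi> s * m - (deriv \<psi> s *\<^sub>R z s) \<bullet> e) = (\<lambda>s. - (deriv \<psi> s * w s))"
      by (simp add: fun_eq_iff w_def m_def inner_diff_left algebra_simps)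
    ultimately have "((\<lambda>s. - (deriv \<psi> s * w s)) has_integral 0) {0..t}" by simp
    then have int0: "integral {0..t} (\<lambda>s. - (deriv \<psi> s * w s)) = 0"
      by (rule integral_unique)
    have wneg: "w s < 0" if "\<bar>s - c\<bar> < \<delta>" for s
    proof -
      have "s \<in> {0..t}" "dist s c < d1" using that \<delta> cd by (auto simp: dist_real_def)
      from d1(2)[OF this] show ?thesis using wc unfolding dist_real_def by linarith
    qed
    have wpos: "w s > 0" if "\<bar>s - d\<bar> < \<delta>" for s
    proof -
      have "s \<in> {0..t}" "dist s d < d2" using that \<delta> cd by (auto simp: dist_real_def)
      from d2(2)[OF this] show ?thesis using wd unfolding dist_real_def by linarith
    qed
    have "0 \<le> - (deriv \<psi> s * w s)" for s
    proof -
      have "T (s - c) * w s \<le> 0"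
        using T0[of "s - c"] wneg[of s]
        by (cases "\<bar>s - c\<bar> < \<delta>") (auto simp: mult_nonneg_nonpos)
      moreover have "T (s - d) * w s \<ge> 0"
        using T0[of "s - d"] wpos[of s] by (cases "\<bar>s - d\<bar> < \<delta>") auto
      ultimately show ?thesis by (simp add: deriv algebra_simps)
    qed
    moreover have "continuous_on {0..t} (\<lambda>s. - (deriv \<psi> s * w s))"
      by (intro continuous_intros pcont wcont)
    ultimately have "\<forall>s\<in>{0..t}. - (deriv \<psi> s * w s) = 0"
      using integral_eq_0_iff[of 0 t] t int0 by blast
    then have "deriv \<psi> c * w c = 0" using cd by auto
    \<comment> \<open>If \<open>c\<close> lay under the tent around \<open>d\<close>, then
      \<open>w c\<close> would be both negative and positive.\<close>
    moreover have "T (c - d) = 0" using T0(2)[of "c - d"] wneg[of c] wpos[of c] \<delta>(1) by fastforce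
    moreover have "T 0 = \<delta>" using \<delta>(1) by (simp add: T_def)
    ultimately show False using wneg[of c] \<delta>(1) by (simp add: deriv)
  qed
  have "z s = z (t/2)" if "s \<in> {0..t}" for s
  proof (rule continuous_constant_on_closure[where S = "{0<..<t}"])
    show "continuous_on (closure {0<..<t}) z" using cont t by simp
    show "s \<in> closure {0<..<t}" using that t by simp
    show "z x = z (t/2)" if "x \<in> {0<..<t}" for x
    proof (cases x "t/2" rule: linorder_cases)
      case less
      show ?thesis by (rule eq) (use less that t in auto)
    next
      case greater
      show ?thesis by (rule eq[symmetric]) (use greater that t in auto)
    next
      case equal
      then show ?thesis by (rule arg_cong)
    qed
  qed
  from this[of s] this[of 0] show ?thesis using s t by simp
qed

text \<open>An indefinite integral has its integrand as weak derivative by integration by parts, the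
  boundary terms vanishing for test functions. Conversely, \<open>y\<close> minus the indefinite
  integral \<open>Y\<close> of \<open>v\<close> has weak derivative zero and is constant.
  \<open>weak\<close> is proved for arbitrary \<open>y\<close> because it is applied to
  \<open>Y\<close> as well.\<close>

lemma W11_with_deriv_iff:
  fixes y v :: "real \<Rightarrow> 'a::euclidean_space"
  assumes t: "0 \<le> t"
  shows "W11_with_deriv t y v \<longleftrightarrow> v absolutely_integrable_on {0..t} \<and>
    (\<forall>s\<in>{0..t}. y s = y 0 + integral {0..s} v)" (is "?l \<longleftrightarrow> ?r")
proof -
  have weak: "integral {0..t} (\<lambda>s. deriv \<psi> s *\<^sub>R y s) = - integral {0..t} (\<lambda>s. \<psi> s *\<^sub>R v s)"
    if v: "v absolutely_integrable_on {0..t}" and y: "\<forall>s\<in>{0..t}. y s = y 0 + integral {0..s} v"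
      and psi: "test_function t \<psi>" for y and \<psi>
  proof -
    have d: "(\<psi> has_real_derivative deriv \<psi> s) (at s)" for s
      using psi by (auto simp: test_function_def DERIV_deriv_iff_real_differentiable)
    have "support_on UNIV \<psi> \<subseteq> {0<..<t}"
      using psi closure_subset by (fastforce simp: test_function_def)
    then have "\<psi> t = 0" "\<psi> 0 = 0" by (force simp: support_on_def)+
    moreover have c: "continuous_on UNIV (deriv \<psi>)" using psi by (simp add: test_function_def)
    ultimately show ?thesis
      using integration_by_parts_indefinite_integral[OF t v bspec[OF y] d c] by simp
  qed
  show ?thesis
  proof
    assume ?r
    then have v: "v absolutely_integrable_on {0..t}" and y: "\<forall>s\<in>{0..t}. y s = y 0 + integral {0..s} v"
      by blast+
    then have "v integrable_on {0..t}" by (simp add: absolutely_integrable_on_def)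
    then have "continuous_on {0..t} (\<lambda>s. y 0 + integral {0..s} v)"
      by (intro continuous_intros indefinite_integral_continuous_1)
    then have "continuous_on {0..t} y"
      by (rule continuous_on_eq) (rule bspec[OF y, symmetric])
    then show ?l using weak[OF v y] v unfolding W11_with_deriv_def by blast
  next
    assume l: ?l
    then have v: "v absolutely_integrable_on {0..t}" and y: "continuous_on {0..t} y"
      by (auto simp: W11_with_deriv_def)
    define Y where "Y = (\<lambda>s. integral {0..s} v)"
    have "v integrable_on {0..t}" using v by (simp add: absolutely_integrable_on_def)
    then have Y: "continuous_on {0..t} Y"
      unfolding Y_def by (rule indefinite_integral_continuous_1)
    have "y s - Y s = y 0 - Y 0" if "s \<in> {0..t}" for s
    proof (rule du_Bois_Reymond[where z = "\<lambda>s. y s - Y s", OF _ _ that])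
      show "continuous_on {0..t} (\<lambda>s. y s - Y s)" by (intro continuous_intros y Y)
      fix \<psi> assume psi: "test_function t \<psi>"
      then have pc: "continuous_on {0..t} (deriv \<psi>)"
        using continuous_on_subset by (auto simp: test_function_def)
      have "integral {0..t} (\<lambda>s. deriv \<psi> s *\<^sub>R (y s - Y s)) =
        integral {0..t} (\<lambda>s. deriv \<psi> s *\<^sub>R y s) - integral {0..t} (\<lambda>s. deriv \<psi> s *\<^sub>R Y s)"
        unfolding scaleR_diff_right
        by (intro Henstock_Kurzweil_Integration.integral_diff integrable_continuous_real continuous_intros pc y Y)
      also have "\<dots> = 0"
      proof -
        have "\<forall>s\<in>{0..t}. Y s = Y 0 + integral {0..s} v" by (simp add: Y_def)
        from weak[OF v this psi] show ?thesis using l psi by (simp add: W11_with_deriv_def)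
      qed
      finally show "integral {0..t} (\<lambda>s. deriv \<psi> s *\<^sub>R (y s - Y s)) = 0" .
    qed
    moreover have "Y 0 = 0" by (simp add: Y_def)
    ultimately have "\<forall>s\<in>{0..t}. y s = y 0 + integral {0..s} v"
      unfolding Y_def by (metis add.commute diff_eq_eq diff_zero)
    then show ?r using v by blast
  qed
qed

section \<open>Cost integrals; cutting and joining curves\<close>

lemma nn_integral_Icc_split:
  fixes F :: "real \<Rightarrow> ennreal"
  assumes F: "(\<lambda>s. F s * indicator {a..c} s) \<in> borel_measurable lebesgue" and ab: "a \<le> b" "b \<le> c"
  shows "(\<integral>\<^sup>+s\<in>{a..c}. F s \<partial>lebesgue) = (\<integral>\<^sup>+s\<in>{a..b}. F s \<partial>lebesgue) + (\<integral>\<^sup>+s\<in>{b..c}. F s \<partial>lebesgue)"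
proof -
  define G where "G = (\<lambda>s. F s * indicator {a..c} s)"
  have G: "(\<lambda>s. G s * indicator {p..q} s) \<in> borel_measurable lebesgue" for p q
    unfolding G_def by (intro borel_measurable_times_ennreal[OF F] borel_measurable_indicator) auto
  \<comment> \<open>The point \<open>b\<close> is counted in both pieces on the right, so the
    integrands agree only off a null set.\<close>
  have "AE s in lebesgue. s \<noteq> b"
    using AE_lborel_singleton[of b] by (rule AE_completion)
  then have "(\<integral>\<^sup>+s\<in>{a..c}. F s \<partial>lebesgue) = (\<integral>\<^sup>+s. G s * indicator {a..b} s + G s * indicator {b..c} s \<partial>lebesgue)"
    by (intro nn_integral_cong_AE) (auto simp: G_def indicator_def ab)
  also have "\<dots> = (\<integral>\<^sup>+s. G s * indicator {a..b} s \<partial>lebesgue) + (\<integral>\<^sup>+s. G s * indicator {b..c} s \<partial>lebesgue)"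
    by (intro nn_integral_add G)
  also have "\<dots> = (\<integral>\<^sup>+s\<in>{a..b}. F s \<partial>lebesgue) + (\<integral>\<^sup>+s\<in>{b..c}. F s \<partial>lebesgue)"
    using ab by (intro arg_cong2[where f = "(+)"] nn_integral_cong) (auto simp: G_def indicator_def)
  finally show ?thesis .
qed

lemma nn_integral_Icc_shift:
  fixes F :: "real \<Rightarrow> ennreal"
  assumes F: "(\<lambda>s. F s * indicator {a..b} s) \<in> borel_measurable lebesgue"
  shows "(\<integral>\<^sup>+s\<in>{a..b}. F s \<partial>lebesgue) = (\<integral>\<^sup>+s\<in>{0..b-a}. F (s + a) \<partial>lebesgue)"
  using nn_integral_real_affine_lebesgue[OF F, of 1 a]
  by (simp add: indicator_def algebra_simps cong: if_cong)

text \<open>This passes from real integrals of lower bounds, which may be negative, to the cost as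
  an extended nonnegative integral. Replacing \<open>h\<close> by its positive part only increases
  its integral and stays below \<open>F\<close> after the coercion to
  \<open>ennreal\<close>.\<close>

lemma integral_le_nn_integral:
  fixes h :: "real \<Rightarrow> real"
  assumes h: "h absolutely_integrable_on {a..b}" and le: "\<And>s. s \<in> {a..b} \<Longrightarrow> h s \<le> F s"
  shows "ennreal (integral {a..b} h) \<le> (\<integral>\<^sup>+s\<in>{a..b}. ennreal (F s) \<partial>lebesgue)"
proof -
  define g where "g = (\<lambda>s. max (h s) 0)"
  have g: "g absolutely_integrable_on {a..b}"
    unfolding g_def by (intro absolutely_integrable_max_1 h) simp
  have "integral {a..b} h \<le> integral {a..b} g"
    by (rule integral_le) (use h g in \<open>auto simp: absolutely_integrable_on_def g_def\<close>)
  also have "\<dots> = (LINT s|lebesgue. indicator {a..b} s *\<^sub>R g s)"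
    using set_lebesgue_integral_eq_integral(2)[OF g] by (simp add: set_lebesgue_integral_def)
  finally have "ennreal (integral {a..b} h) \<le> ennreal (LINT s|lebesgue. indicator {a..b} s *\<^sub>R g s)"
    by (rule ennreal_leI)
  also have "\<dots> = (\<integral>\<^sup>+s. ennreal (indicator {a..b} s *\<^sub>R g s) \<partial>lebesgue)"
    using g by (intro nn_integral_eq_integral[symmetric]) (auto simp: set_integrable_def g_def)
  also have "\<dots> \<le> (\<integral>\<^sup>+s\<in>{a..b}. ennreal (F s) \<partial>lebesgue)"
    using le by (intro nn_integral_mono) (auto simp: g_def indicator_def ennreal_leI max_def ennreal_neg)
  finally show ?thesis .
qed

lemma W11_with_derivD:
  assumes "W11_with_deriv T y v" "0 \<le> T"
  shows "v absolutely_integrable_on {0..T}" "s \<in> {0..T} \<Longrightarrow> y s = y 0 + integral {0..s} v"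
  using W11_with_deriv_iff[OF assms(2), THEN iffD1, OF assms(1)] by blast+

lemma W11_with_derivI:
  assumes "0 \<le> T" "v absolutely_integrable_on {0..T}"
    and "\<And>s. s \<in> {0..T} \<Longrightarrow> y s = y 0 + integral {0..s} v"
  shows "W11_with_deriv T y v"
  unfolding W11_with_deriv_iff[OF assms(1)] using assms(2,3) by blast

lemma W11_with_deriv_restrict:
  fixes y v :: "real \<Rightarrow> 'a::euclidean_space"
  assumes "W11_with_deriv (a + b) y v" "0 \<le> a" "0 \<le> b"
  shows "W11_with_deriv a y v" "W11_with_deriv b (\<lambda>s. y (s + a)) (\<lambda>s. v (s + a))"
proof -
  have ab: "0 \<le> a + b" using assms by simp
  note v = W11_with_derivD(1)[OF assms(1) ab] and y = W11_with_derivD(2)[OF assms(1) ab]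
  have vi: "v integrable_on {0..a + b}" using v assms by (simp add: absolutely_integrable_on_def)
  have va: "v absolutely_integrable_on {0..a}"
    using v assms by (auto intro: absolutely_integrable_on_subinterval)
  show "W11_with_deriv a y v"
    by (rule W11_with_derivI[OF assms(2) va], rule y) (use assms in auto)
  have "v absolutely_integrable_on {a..a + b}"
    using v assms by (auto intro: absolutely_integrable_on_subinterval)
  then have "v integrable_on {a..a+b}" "(\<lambda>s. norm (v s)) integrable_on {a..a+b}"
    by (auto simp: absolutely_integrable_on_def)
  then have "(\<lambda>s. v (s + a)) absolutely_integrable_on {0..b}"
    using integrable_shift_real_ivl[of v a "a + b" a] integrable_shift_real_ivl[of "\<lambda>s. norm (v s)" a "a + b" a]
    by (auto simp: absolutely_integrable_on_def)
  moreover have "y (s + a) = y (0 + a) + integral {0..s} (\<lambda>s. v (s + a))" if "s \<in> {0..b}" for s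
  proof -
    have "integral {0..s} (\<lambda>s. v (s + a)) = integral {a..s + a} v"
      using integral_shift_real_ivl[of a a "s + a" v] by simp
    moreover have "integral {0..a} v + integral {a..s + a} v = integral {0..s + a} v"
      by (rule Henstock_Kurzweil_Integration.integral_combine)
         (use that assms vi in \<open>auto intro: integrable_subinterval_real\<close>)
    moreover have "y (s + a) = y 0 + integral {0..s + a} v"
      by (rule y) (use that assms in auto)
    moreover have "y a = y 0 + integral {0..a} v"
      by (rule y) (use assms in auto)
    ultimately show ?thesis by simp
  qed
  ultimately show "W11_with_deriv b (\<lambda>s. y (s + a)) (\<lambda>s. v (s + a))"
    by (rule W11_with_derivI[OF assms(3)])
qed

lemma W11_with_deriv_concat:
  fixes y1 y2 :: "real \<Rightarrow> 'a::euclidean_space"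
  assumes W: "W11_with_deriv a y1 v1" "W11_with_deriv b y2 v2" and eq: "y1 a = y2 0" and ab: "0 \<le> a" "0 \<le> b"
  shows "W11_with_deriv (a + b) (\<lambda>s. if s \<le> a then y1 s else y2 (s - a)) (\<lambda>s. if s \<le> a then v1 s else v2 (s - a))"
    (is "W11_with_deriv _ ?y ?v")
proof -
  note v1 = W11_with_derivD(1)[OF W(1) ab(1)] and y1 = W11_with_derivD(2)[OF W(1) ab(1)]
  note v2 = W11_with_derivD(1)[OF W(2) ab(2)] and y2 = W11_with_derivD(2)[OF W(2) ab(2)]
  have vi1: "?v absolutely_integrable_on {0..a}"
    using v1 by (rule absolutely_integrable_spike[where S = "{}"]) auto
  have "v2 integrable_on {0..b}" "(\<lambda>s. norm (v2 s)) integrable_on {0..b}"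
    using v2 by (auto simp: absolutely_integrable_on_def)
  then have "(\<lambda>s. v2 (s - a)) absolutely_integrable_on {a..a + b}"
    using integrable_shift_real_ivl[of v2 0 b "-a"] integrable_shift_real_ivl[of "\<lambda>s. norm (v2 s)" 0 b "-a"]
    by (auto simp: absolutely_integrable_on_def add.commute)
  then have vi2: "?v absolutely_integrable_on {a..a + b}"
    by (rule absolutely_integrable_spike[where S = "{a}"]) auto
  have vi: "?v absolutely_integrable_on {0..a + b}"
    using absolutely_integrable_on_combine[OF vi1 vi2] ab by simp
  have "?y s = ?y 0 + integral {0..s} ?v" if s: "s \<in> {0..a + b}" for s
  proof (cases "s \<le> a")
    case True
    have "integral {0..s} ?v = integral {0..s} v1"
      by (rule integral_cong) (use True in auto)
    moreover have "y1 s = y1 0 + integral {0..s} v1"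
      by (rule y1) (use True s in auto)
    ultimately show ?thesis using True ab by simp
  next
    case False
    have vi': "?v integrable_on {0..s}"
      using absolutely_integrable_on_subinterval[OF vi, of 0 s] s by (simp add: absolutely_integrable_on_def)
    have "integral {a..s} ?v = integral {a..s} (\<lambda>s. v2 (s - a))"
      by (rule integral_spike[where S = "{a}"]) auto
    also have "\<dots> = integral {0..s - a} v2"
      using integral_shift_real_ivl[of 0 "-a" "s - a" v2] by simp
    finally have 1: "integral {a..s} ?v = integral {0..s - a} v2" .
    have 2: "integral {0..a} ?v = integral {0..a} v1"
      by (rule integral_cong) auto
    have "integral {0..s} ?v = integral {0..a} v1 + integral {0..s - a} v2"
      using Henstock_Kurzweil_Integration.integral_combine[OF _ _ vi', of a] False ab by (simp add: 1 2)
    moreover have "y2 (s - a) = y2 0 + integral {0..s - a} v2"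
      by (rule y2) (use False s in auto)
    moreover have "y1 a = y1 0 + integral {0..a} v1"
      by (rule y1) (use ab in auto)
    ultimately show ?thesis using False eq ab by simp
  qed
  then show ?thesis
    by (intro W11_with_derivI vi) (use ab in simp_all)
qed

lemma W11_with_deriv_line:
  fixes x u :: "'a::euclidean_space"
  assumes "0 \<le> d"
  shows "W11_with_deriv d (\<lambda>s. x + s *\<^sub>R u) (\<lambda>_. u)"
  by (rule W11_with_derivI[OF assms]) (auto simp: absolutely_integrable_on_def)

section \<open>The running cost and its coercivity\<close>

text \<open>Superlinear growth appears as a family of bounds, one constant for every slope
  \<open>K\<close>, since each use needs a slope chosen to beat a quantity already fixed.\<close>

locale lagrangian =
  fixes L :: "'a::euclidean_space \<Rightarrow> 'a \<Rightarrow> real"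
  assumes nonneg: "0 \<le> L x u"
    and cont: "continuous_on UNIV (\<lambda>(x, u). L x u)"
    and superlinear: "\<exists>C\<ge>0. \<forall>x u. K * norm u - C \<le> L x u"
begin

text \<open>The curve is hidden: only duration, cost and end points remain, so that dynamic
  programming becomes arithmetic with costs in \<open>ennreal\<close>, infinite costs
  included.\<close>

definition traj :: "real \<Rightarrow> ennreal \<Rightarrow> 'a \<Rightarrow> 'a \<Rightarrow> bool"
  where "traj T c x z \<longleftrightarrow> (\<exists>y v. W11_with_deriv T y v \<and> y 0 = x \<and> y T = z \<and>
    c = (\<integral>\<^sup>+s\<in>{0..T}. ennreal (L (y s) (v s)) \<partial>lebesgue))"

text \<open>Outside the time interval \<open>y\<close> and \<open>v\<close> are arbitrary, so both
  are cut off before \<open>L\<close> is applied; the outer indicator then removes the value of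
  \<open>L\<close> at the origin that the cut-off introduces.\<close>

lemma measurable_cost:
  assumes "W11_with_deriv T y v" "0 \<le> T"
  shows "(\<lambda>s. ennreal (L (y s) (v s)) * indicator {0..T} s) \<in> borel_measurable lebesgue"
proof -
  have "continuous_on {0..T} y" "v absolutely_integrable_on {0..T}"
    using assms by (auto simp: W11_with_deriv_def)
  then have "y absolutely_integrable_on {0..T}" "v absolutely_integrable_on {0..T}"
    by (auto intro: absolutely_integrable_continuous_real)
  then have "(\<lambda>s. indicator {0..T} s *\<^sub>R y s) \<in> borel_measurable lebesgue"
    "(\<lambda>s. indicator {0..T} s *\<^sub>R v s) \<in> borel_measurable lebesgue"
    by (auto simp: set_integrable_def)
  from borel_measurable_continuous_Pair[OF this, of L] cont
  have "(\<lambda>s. L (indicator {0..T} s *\<^sub>R y s) (indicator {0..T} s *\<^sub>R v s)) \<in> borel_measurable lebesgue"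
    by (simp add: case_prod_beta')
  then have "(\<lambda>s. ennreal (L (indicator {0..T} s *\<^sub>R y s) (indicator {0..T} s *\<^sub>R v s)) * indicator {0..T} s)
    \<in> borel_measurable lebesgue"
    by (intro borel_measurable_times_ennreal borel_measurable_indicator measurable_compose[OF _ measurable_ennreal]) auto
  moreover have "ennreal (L (indicator {0..T} s *\<^sub>R y s) (indicator {0..T} s *\<^sub>R v s)) * indicator {0..T} s =
    ennreal (L (y s) (v s)) * indicator {0..T} s" for s
    by (simp add: indicator_def)
  ultimately show ?thesis by simp
qed

text \<open>\<open>L\<close> does not depend on time, so the second piece, shifted to start at time
  0, keeps its cost.\<close>

lemma traj_split:
  assumes "traj (a + b) c x z" "0 \<le> a" "0 \<le> b"
  obtains y c1 c2 where "traj a c1 x y" "traj b c2 y z" "c = c1 + c2"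
proof -
  obtain y v where W: "W11_with_deriv (a + b) y v" and yx: "y 0 = x" and yz: "y (a + b) = z"
    and c: "c = (\<integral>\<^sup>+s\<in>{0..a + b}. ennreal (L (y s) (v s)) \<partial>lebesgue)"
    using assms(1) by (auto simp: traj_def)
  have m: "(\<lambda>s. ennreal (L (y s) (v s)) * indicator {0..a + b} s) \<in> borel_measurable lebesgue"
    using W assms by (intro measurable_cost) auto
  have m': "(\<lambda>s. ennreal (L (y s) (v s)) * indicator {a..a + b} s) \<in> borel_measurable lebesgue"
  proof -
    have "(\<lambda>s. (ennreal (L (y s) (v s)) * indicator {0..a + b} s) * indicator {a..a + b} s) \<in> borel_measurable lebesgue"
      by (intro borel_measurable_times_ennreal[OF m] borel_measurable_indicator) auto
    moreover have "(\<lambda>s. (ennreal (L (y s) (v s)) * indicator {0..a + b} s) * indicator {a..a + b} s) =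
      (\<lambda>s. ennreal (L (y s) (v s)) * indicator {a..a + b} s)"
      using assms by (auto simp: indicator_def fun_eq_iff)
    ultimately show ?thesis by simp
  qed
  have "c = (\<integral>\<^sup>+s\<in>{0..a}. ennreal (L (y s) (v s)) \<partial>lebesgue) + (\<integral>\<^sup>+s\<in>{a..a + b}. ennreal (L (y s) (v s)) \<partial>lebesgue)"
    unfolding c using assms by (intro nn_integral_Icc_split m) auto
  also have "(\<integral>\<^sup>+s\<in>{a..a + b}. ennreal (L (y s) (v s)) \<partial>lebesgue) =
    (\<integral>\<^sup>+s\<in>{0..b}. ennreal (L (y (s + a)) (v (s + a))) \<partial>lebesgue)"
    using nn_integral_Icc_shift[OF m'] by simp
  finally have "c = (\<integral>\<^sup>+s\<in>{0..a}. ennreal (L (y s) (v s)) \<partial>lebesgue) +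
    (\<integral>\<^sup>+s\<in>{0..b}. ennreal (L (y (s + a)) (v (s + a))) \<partial>lebesgue)" .
  moreover have "traj a (\<integral>\<^sup>+s\<in>{0..a}. ennreal (L (y s) (v s)) \<partial>lebesgue) x (y a)"
    unfolding traj_def using W11_with_deriv_restrict(1)[OF W assms(2,3)] yx by blast
  moreover have "traj b (\<integral>\<^sup>+s\<in>{0..b}. ennreal (L (y (s + a)) (v (s + a))) \<partial>lebesgue) (y a) z"
    unfolding traj_def using W11_with_deriv_restrict(2)[OF W assms(2,3)] yz
    by (intro exI[of _ "\<lambda>s. y (s + a)"] exI[of _ "\<lambda>s. v (s + a)"]) (simp add: add.commute)
  ultimately show ?thesis using that by blast
qed

lemma traj_concat:
  assumes "traj a c1 x y" "traj b c2 y z" "0 \<le> a" "0 \<le> b"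
  shows "traj (a + b) (c1 + c2) x z"
proof -
  obtain y1 v1 where W1: "W11_with_deriv a y1 v1" "y1 0 = x" "y1 a = y"
    and c1: "c1 = (\<integral>\<^sup>+s\<in>{0..a}. ennreal (L (y1 s) (v1 s)) \<partial>lebesgue)"
    using assms by (auto simp: traj_def)
  obtain y2 v2 where W2: "W11_with_deriv b y2 v2" "y2 0 = y" "y2 b = z"
    and c2: "c2 = (\<integral>\<^sup>+s\<in>{0..b}. ennreal (L (y2 s) (v2 s)) \<partial>lebesgue)"
    using assms by (auto simp: traj_def)
  define Y where "Y = (\<lambda>s. if s \<le> a then y1 s else y2 (s - a))"
  define V where "V = (\<lambda>s. if s \<le> a then v1 s else v2 (s - a))"
  have W: "W11_with_deriv (a + b) Y V"
    unfolding Y_def V_def by (rule W11_with_deriv_concat) (use W1 W2 assms in auto)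
  have m: "(\<lambda>s. ennreal (L (Y s) (V s)) * indicator {0..a + b} s) \<in> borel_measurable lebesgue"
    using W assms by (intro measurable_cost) auto
  have m': "(\<lambda>s. ennreal (L (Y s) (V s)) * indicator {a..a + b} s) \<in> borel_measurable lebesgue"
  proof -
    have "(\<lambda>s. (ennreal (L (Y s) (V s)) * indicator {0..a + b} s) * indicator {a..a + b} s) \<in> borel_measurable lebesgue"
      by (intro borel_measurable_times_ennreal[OF m] borel_measurable_indicator) auto
    moreover have "(\<lambda>s. (ennreal (L (Y s) (V s)) * indicator {0..a + b} s) * indicator {a..a + b} s) =
      (\<lambda>s. ennreal (L (Y s) (V s)) * indicator {a..a + b} s)"
      using assms by (auto simp: indicator_def fun_eq_iff)
    ultimately show ?thesis by simp
  qed
  \<comment> \<open>After the shift, time 0 is the junction, where the joined velocity still comes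
    from the first curve.\<close>
  have ae: "AE s::real in lebesgue. s \<noteq> 0"
    using AE_lborel_singleton[of "0::real"] by (rule AE_completion)
  have "(\<integral>\<^sup>+s\<in>{0..a + b}. ennreal (L (Y s) (V s)) \<partial>lebesgue) =
    (\<integral>\<^sup>+s\<in>{0..a}. ennreal (L (Y s) (V s)) \<partial>lebesgue) + (\<integral>\<^sup>+s\<in>{a..a + b}. ennreal (L (Y s) (V s)) \<partial>lebesgue)"
    using assms by (intro nn_integral_Icc_split m) auto
  also have "(\<integral>\<^sup>+s\<in>{0..a}. ennreal (L (Y s) (V s)) \<partial>lebesgue) = c1"
    unfolding c1 by (intro nn_integral_cong) (auto simp: Y_def V_def indicator_def)
  also have "(\<integral>\<^sup>+s\<in>{a..a + b}. ennreal (L (Y s) (V s)) \<partial>lebesgue) =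
    (\<integral>\<^sup>+s\<in>{0..b}. ennreal (L (Y (s + a)) (V (s + a))) \<partial>lebesgue)"
    using nn_integral_Icc_shift[OF m'] by simp
  also have "\<dots> = c2"
    unfolding c2 by (intro nn_integral_cong_AE eventually_mono[OF ae]) (auto simp: Y_def V_def indicator_def)
  finally have "c1 + c2 = (\<integral>\<^sup>+s\<in>{0..a + b}. ennreal (L (Y s) (V s)) \<partial>lebesgue)" ..
  moreover have "Y 0 = x" "Y (a + b) = z"
    using W1 W2 assms by (auto simp: Y_def)
  ultimately show ?thesis unfolding traj_def using W by blast
qed

lemma traj_line:
  assumes "0 \<le> d" "\<And>s. s \<in> {0..d} \<Longrightarrow> L (x + s *\<^sub>R u) u \<le> m"
  obtains c where "traj d c x (x + d *\<^sub>R u)" "c \<le> ennreal (d * m)"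
proof
  show "traj d (\<integral>\<^sup>+s\<in>{0..d}. ennreal (L (x + s *\<^sub>R u) u) \<partial>lebesgue) x (x + d *\<^sub>R u)"
    unfolding traj_def using W11_with_deriv_line[OF assms(1), of x u] by force
  have "(\<integral>\<^sup>+s\<in>{0..d}. ennreal (L (x + s *\<^sub>R u) u) \<partial>lebesgue) \<le> (\<integral>\<^sup>+s\<in>{0..d}. ennreal m \<partial>lebesgue)"
    using assms(2) by (intro nn_integral_mono) (auto simp: indicator_def ennreal_leI)
  also have "\<dots> = ennreal m * ennreal d"
    using assms(1) by (subst nn_integral_cmult_indicator) auto
  also have "\<dots> = ennreal (d * m)"
    using assms(1) by (simp add: ennreal_mult' mult.commute)
  finally show "(\<integral>\<^sup>+s\<in>{0..d}. ennreal (L (x + s *\<^sub>R u) u) \<partial>lebesgue) \<le> ennreal (d * m)" .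
qed

text \<open>The displacement is at most the integral of the norm of \<open>v\<close>, and coercivity
  is integrated over the whole interval. The bound holds at every intermediate time \<open>s\<close>
  with the total cost, and so confines the entire curve.\<close>

lemma cost_ge_norm:
  assumes W: "W11_with_deriv T y v" and T: "0 \<le> T" and s: "s \<in> {0..T}" and K: "0 \<le> K"
    and C: "\<And>x u. K * norm u - C \<le> L x u"
  shows "ennreal (K * norm (y s - y 0) - C * T) \<le> (\<integral>\<^sup>+s\<in>{0..T}. ennreal (L (y s) (v s)) \<partial>lebesgue)"
proof -
  note v = W11_with_derivD(1)[OF W T] and y = W11_with_derivD(2)[OF W T s]
  have vi: "v integrable_on {0..T}" "(\<lambda>s. norm (v s)) integrable_on {0..T}"
    using v by (auto simp: absolutely_integrable_on_def)
  have "norm (y s - y 0) = norm (integral {0..s} v)"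
    using y by simp
  also have "\<dots> \<le> integral {0..s} (\<lambda>s. norm (v s))"
    using s vi by (auto intro!: integral_norm_bound_integral intro: integrable_subinterval_real)
  also have "\<dots> \<le> integral {0..T} (\<lambda>s. norm (v s))"
    using s vi by (intro integral_subset_le) (auto intro: integrable_subinterval_real)
  finally have "K * norm (y s - y 0) - C * T \<le> K * integral {0..T} (\<lambda>s. norm (v s)) - C * T"
    using K by (simp add: mult_left_mono)
  also have "\<dots> = integral {0..T} (\<lambda>s. K * norm (v s) - C)"
    using vi T by (subst Henstock_Kurzweil_Integration.integral_diff) (auto intro!: integrable_on_mult_right)
  finally have "ennreal (K * norm (y s - y 0) - C * T) \<le> ennreal (integral {0..T} (\<lambda>s. K * norm (v s) - C))"
    by (rule ennreal_leI)
  also have "\<dots> \<le> (\<integral>\<^sup>+s\<in>{0..T}. ennreal (L (y s) (v s)) \<partial>lebesgue)"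
  proof (rule integral_le_nn_integral)
    have "(\<lambda>s. norm (v s)) absolutely_integrable_on {0..T}"
      using absolutely_integrable_norm[OF v] by (simp add: o_def)
    then show "(\<lambda>s. K * norm (v s) - C) absolutely_integrable_on {0..T}"
      by (intro set_integral_diff(1) set_integrable_mult_right
          absolutely_integrable_continuous_real[OF continuous_on_const])
  qed (rule C)
  finally show ?thesis .
qed

lemma traj_ge_norm:
  assumes "traj T c x z" "0 \<le> T" "0 \<le> K" "\<And>x u. K * norm u - C \<le> L x u"
  shows "ennreal (K * norm (z - x) - C * T) \<le> c"
  using assms cost_ge_norm[of T _ _ T K C] unfolding traj_def by auto

text \<open>The bound \<open>M\<close> on the cost confines the whole curve to a ball on which the affine minorant of
  \<open>L\<close> is valid.\<close>

lemma traj_ge_linear: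
  assumes tr: "traj T c x z" and T: "0 \<le> T" and c: "c \<le> ennreal M" and K: "0 \<le> K"
    and C: "\<And>x u. K * norm u - C \<le> L x u"
    and r: "M + C * T < K * r" "0 \<le> M"
    and lin: "\<And>x' w. norm (x' - x) < r \<Longrightarrow> q \<bullet> w - m \<le> L x' w"
  shows "ennreal (q \<bullet> (z - x) - m * T) \<le> c"
proof -
  obtain y v where W: "W11_with_deriv T y v" and yx: "y 0 = x" and yz: "y T = z"
    and ceq: "c = (\<integral>\<^sup>+s\<in>{0..T}. ennreal (L (y s) (v s)) \<partial>lebesgue)"
    using tr by (auto simp: traj_def)
  note v = W11_with_derivD(1)[OF W T]
  have y: "y T = y 0 + integral {0..T} v"
    by (rule W11_with_derivD(2)[OF W T]) (use T in simp)
  have vi: "v integrable_on {0..T}" using v by (simp add: absolutely_integrable_on_def)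
  have close: "norm (y s - x) < r" if "s \<in> {0..T}" for s
  proof -
    have "ennreal (K * norm (y s - x) - C * T) \<le> ennreal M"
      using cost_ge_norm[OF W T that K C] c ceq yx by simp
    then have "K * norm (y s - x) - C * T \<le> M"
      using r(2) by (simp add: ennreal_le_iff)
    then have "K * norm (y s - x) < K * r" using r(1) by simp
    then show ?thesis using K by (simp add: mult_less_cancel_left)
  qed
  have "(\<lambda>s. q \<bullet> v s) absolutely_integrable_on {0..T}"
    using absolutely_integrable_linear[OF v bounded_linear_inner_right[of q]] by (simp add: o_def)
  then have i: "(\<lambda>s. q \<bullet> v s - m) absolutely_integrable_on {0..T}"
    by (intro set_integral_diff(1) absolutely_integrable_continuous_real[OF continuous_on_const])
  have "integral {0..T} (\<lambda>s. q \<bullet> v s) = q \<bullet> integral {0..T} v"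
    using integral_linear[OF vi bounded_linear_inner_right[of q]] by (simp add: o_def)
  then have "q \<bullet> (z - x) - m * T = integral {0..T} (\<lambda>s. q \<bullet> v s - m)"
    using \<open>(\<lambda>s. q \<bullet> v s) absolutely_integrable_on {0..T}\<close> T y
    by (subst Henstock_Kurzweil_Integration.integral_diff)
       (auto simp: absolutely_integrable_on_def yx[symmetric] yz[symmetric])
  also have "ennreal \<dots> \<le> c"
    unfolding ceq using close by (intro integral_le_nn_integral i lin) auto
  finally show ?thesis .
qed

lemma value_fun_eq_traj:
  "value_fun L \<phi> t x = (INF (c, z)\<in>{(c, z). traj t c x z}. c + \<phi> z)"
proof -
  have "(\<lambda>(y, v). (\<integral>\<^sup>+s\<in>{0..t}. ennreal (L (y s) (v s)) \<partial>lebesgue) + \<phi> (y t)) ` {(y, v). W11_with_deriv t y v \<and> y 0 = x}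
    = (\<lambda>(c, z). c + \<phi> z) ` {(c, z). traj t c x z}"
    unfolding traj_def by (auto simp: image_iff) blast+
  then show ?thesis unfolding value_fun_def by simp
qed

end

section \<open>Inf-convolution\<close>

lemma subdiff_iff:
  "p \<in> subdiff W z \<longleftrightarrow>
    (\<forall>\<epsilon>>0. \<exists>\<delta>>0. \<forall>z'. dist z' z < \<delta> \<longrightarrow> W z + p \<bullet> (z' - z) - \<epsilon> * norm (z' - z) \<le> W z')"
proof
  assume p: "p \<in> subdiff W z"
  show "\<forall>\<epsilon>>0. \<exists>\<delta>>0. \<forall>z'. dist z' z < \<delta> \<longrightarrow> W z + p \<bullet> (z' - z) - \<epsilon> * norm (z' - z) \<le> W z'"
  proof safe
    fix \<epsilon> :: real assume "\<epsilon> > 0"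
    then have "ereal (- \<epsilon>) < 0" by simp
    with p have "\<forall>\<^sub>F z' in at z. ereal (- \<epsilon>) < ereal ((W z' - W z - p \<bullet> (z' - z)) / norm (z' - z))"
      unfolding subdiff_def le_Liminf_iff by blast
    then obtain \<delta> where \<delta>: "\<delta> > 0" "\<And>z'. z' \<noteq> z \<Longrightarrow> dist z' z < \<delta> \<Longrightarrow>
        - \<epsilon> < (W z' - W z - p \<bullet> (z' - z)) / norm (z' - z)"
      unfolding eventually_at by auto
    have "W z + p \<bullet> (z' - z) - \<epsilon> * norm (z' - z) \<le> W z'" if d: "dist z' z < \<delta>" for z'
    proof (cases "z' = z")
      case False
      then have "norm (z' - z) > 0" by simp
      with \<delta>(2)[OF False d] show ?thesis by (simp add: field_simps)
    qed simp
    with \<delta>(1) show "\<exists>\<delta>>0. \<forall>z'. dist z' z < \<delta> \<longrightarrow> W z + p \<bullet> (z' - z) - \<epsilon> * norm (z' - z) \<le> W z'"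
      by blast
  qed
next
  assume *: "\<forall>\<epsilon>>0. \<exists>\<delta>>0. \<forall>z'. dist z' z < \<delta> \<longrightarrow> W z + p \<bullet> (z' - z) - \<epsilon> * norm (z' - z) \<le> W z'"
  show "p \<in> subdiff W z"
    unfolding subdiff_def le_Liminf_iff mem_Collect_eq
  proof safe
    fix y :: ereal assume "y < 0"
    then obtain r where r: "y < ereal r" "ereal r < 0" using ereal_dense2 by blast
    then have "- r > 0" by simp
    then obtain \<delta> where \<delta>: "\<delta> > 0" "\<And>z'. dist z' z < \<delta> \<Longrightarrow> W z + p \<bullet> (z' - z) - - r * norm (z' - z) \<le> W z'"
      using * by meson
    have "y < ereal ((W z' - W z - p \<bullet> (z' - z)) / norm (z' - z))" if "z' \<noteq> z" "dist z' z < \<delta>" for z'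
    proof -
      have "norm (z' - z) > 0" using that by simp
      then have "r \<le> (W z' - W z - p \<bullet> (z' - z)) / norm (z' - z)"
        using \<delta>(2)[OF that(2)] by (simp add: field_simps)
      then show ?thesis using r(1) by (meson ereal_less_eq(3) less_le_trans)
    qed
    with \<delta>(1) show "\<forall>\<^sub>F z' in at z. y < ereal ((W z' - W z - p \<bullet> (z' - z)) / norm (z' - z))"
      unfolding eventually_at by blast
  qed
qed

text \<open>\<open>\<rho>\<close> is a Lebesgue number of a finite subcover, so two points at
  distance below \<open>\<rho>\<close> share a ball. The second point ranges over all of
  \<open>U\<close>, so that a singleton \<open>S\<close> already yields continuity at its
  point.\<close>

lemma locally_lipschitz_on_compact:
  fixes W :: "'z::metric_space \<Rightarrow> real"
  assumes lip: "locally_lipschitz_on U W" and S: "compact S" "S \<subseteq> U"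
  obtains C \<rho> where "0 \<le> C" "0 < \<rho>" "\<And>z z'. z \<in> S \<Longrightarrow> z' \<in> U \<Longrightarrow> dist z z' < \<rho> \<Longrightarrow> \<bar>W z - W z'\<bar> \<le> C * dist z z'"
proof -
  obtain e B where e: "\<And>z. z \<in> U \<Longrightarrow> e z > 0" "\<And>z. z \<in> U \<Longrightarrow> (B z)-lipschitz_on (ball z (e z) \<inter> U) W"
    using lip unfolding locally_lipschitz_on_def by metis
  have "S \<subseteq> (\<Union>z\<in>S. ball z (e z))" using e S by force
  then obtain D where D: "D \<subseteq> S" "finite D" "S \<subseteq> (\<Union>z\<in>D. ball z (e z))"
    using compactE_image[OF S(1), of S "\<lambda>z. ball z (e z)"] by (metis open_ball)
  obtain \<rho> where \<rho>: "0 < \<rho>" "\<And>x. x \<in> S \<Longrightarrow> \<exists>G\<in>(\<lambda>z. ball z (e z)) ` D. ball x \<rho> \<subseteq> G"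
    using Heine_Borel_lemma[OF S(1) D(3)] by blast
  define C where "C = (\<Sum>z\<in>D. \<bar>B z\<bar>)"
  have "\<bar>W z - W z'\<bar> \<le> C * dist z z'" if z: "z \<in> S" "z' \<in> U" "dist z z' < \<rho>" for z z'
  proof -
    obtain w where w: "w \<in> D" "ball z \<rho> \<subseteq> ball w (e w)" using \<rho>(2)[OF z(1)] by blast
    have "z \<in> ball z \<rho>" "z' \<in> ball z \<rho>" using z \<rho>(1) by auto
    then have "z \<in> ball w (e w) \<inter> U" "z' \<in> ball w (e w) \<inter> U"
      using subsetD[OF w(2)] subsetD[OF S(2)] z by blast+
    then have "dist (W z) (W z') \<le> B w * dist z z'"
      using e(2)[of w] w(1) D(1) S(2) by (intro lipschitz_onD) auto
    also have "\<dots> \<le> \<bar>B w\<bar> * dist z z'" by (intro mult_right_mono) auto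
    also have "\<dots> \<le> C * dist z z'"
      unfolding C_def using D w by (intro mult_right_mono member_le_sum) auto
    finally show ?thesis by (simp add: dist_real_def)
  qed
  moreover have "0 \<le> C" by (simp add: C_def sum_nonneg)
  ultimately show ?thesis using that \<rho>(1) by blast
qed

lemma locally_lipschitz_on_continuous:
  fixes W :: "'z::metric_space \<Rightarrow> real"
  assumes "locally_lipschitz_on U W"
  shows "continuous_on U W"
  unfolding continuous_on_iff
proof safe
  fix z and \<epsilon> :: real assume z: "z \<in> U" and "\<epsilon> > 0"
  obtain C \<rho> where C: "0 \<le> C" "0 < \<rho>"
    "\<And>w z'. w \<in> {z} \<Longrightarrow> z' \<in> U \<Longrightarrow> dist w z' < \<rho> \<Longrightarrow> \<bar>W w - W z'\<bar> \<le> C * dist w z'"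
    by (rule locally_lipschitz_on_compact[OF assms, of "{z}"]) (use z in auto)
  have "dist (W z') (W z) < \<epsilon>" if "z' \<in> U" "dist z' z < min \<rho> (\<epsilon> / (C + 1))" for z'
  proof -
    have "dist z z' < \<epsilon> / (C + 1)" using that by (simp add: dist_commute)
    then have "(C + 1) * dist z z' < \<epsilon>" using C(1) by (simp add: field_simps)
    moreover have "\<bar>W z - W z'\<bar> \<le> C * dist z z'" using C(3)[of z z'] that by (simp add: dist_commute)
    moreover have "C * dist z z' \<le> (C + 1) * dist z z'" by (simp add: algebra_simps)
    ultimately show ?thesis by (simp add: dist_real_def abs_minus_commute)
  qed
  moreover have "min \<rho> (\<epsilon> / (C + 1)) > 0" using C \<open>\<epsilon> > 0\<close> by simp
  ultimately show "\<exists>d>0. \<forall>z'\<in>U. dist z' z < d \<longrightarrow> dist (W z') (W z) < \<epsilon>" by blast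
qed

text \<open>The inf-convolution \<open>f\<close> of \<open>W\<close> with a large multiple of the squared norm is semiconcave, with
  the subgradient of \<open>W\<close> at the minimizer \<open>z'\<close> as a supergradient.\<close>

lemma inf_convolution:
  fixes W :: "'z::euclidean_space \<Rightarrow> real"
  assumes U: "open U" and K: "compact K" "K \<subseteq> U" and lip: "locally_lipschitz_on U W"
    and nonneg: "\<And>z. z \<in> U \<Longrightarrow> 0 \<le> W z"
  obtains C where "0 \<le> C"
    "\<And>\<eta>. 0 < \<eta> \<Longrightarrow> \<exists>k f. 0 \<le> k \<and> (\<forall>y. 0 \<le> f y) \<and>
      (\<forall>z\<in>K. f z \<le> W z \<and> W z - \<eta> \<le> f z \<and>
        (\<exists>z'\<in>U. dist z' z \<le> \<eta> \<and> (\<exists>p\<in>subdiff W z'. norm p \<le> C \<and>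
          (\<forall>y. f y \<le> f z + p \<bullet> (y - z) + k * (norm (y - z))\<^sup>2))))"
proof (cases "K = {}")
  case True
  have "\<exists>k f. 0 \<le> (k::real) \<and> (\<forall>y::'z. 0 \<le> (f y::real))"
    by (intro exI[of _ "0::real"] exI[of _ "\<lambda>_. 0::real"]) auto
  then show ?thesis using that[of 0] True by simp
next
  case False
  obtain r where r: "r > 0" "(\<Union>x\<in>K. cball x r) \<subseteq> U"
    using compact_subset_open_imp_cball_epsilon_subset[OF K(1) U K(2)] by blast
  \<comment> \<open>The infimum is taken over a closed neighbourhood of \<open>K\<close> inside
    \<open>U\<close>: it is compact, so minimizers exist, and for points of \<open>K\<close> they
    will be found away from its boundary.\<close>
  define K' where "K' = {x + y | x y. x \<in> K \<and> y \<in> cball 0 r}"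
  have K'c: "compact K'" unfolding K'_def by (intro compact_sums K compact_cball)
  have K'mem: "w \<in> K'" if "z \<in> K" "dist w z \<le> r" for w z
  proof -
    have "w = z + (w - z)" "w - z \<in> cball 0 r" using that by (auto simp: dist_norm norm_minus_commute)
    then show ?thesis unfolding K'_def using that(1) by blast
  qed
  have K'U: "K' \<subseteq> U"
  proof
    fix w assume "w \<in> K'"
    then obtain x y where "w = x + y" "x \<in> K" "y \<in> cball 0 r" by (auto simp: K'_def)
    then have "w \<in> cball x r" by (simp add: dist_norm)
    then show "w \<in> U" using r(2) \<open>x \<in> K\<close> by blast
  qed
  have KK': "K \<subseteq> K'" using K'mem r(1) by force
  have K'ne: "K' \<noteq> {}" using False KK' by blast
  have Wc: "continuous_on K' W"
    using locally_lipschitz_on_continuous[OF lip] K'U continuous_on_subset by blast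
  obtain C \<rho> where C: "0 \<le> C" "0 < \<rho>"
    "\<And>z z'. z \<in> K' \<Longrightarrow> z' \<in> U \<Longrightarrow> dist z z' < \<rho> \<Longrightarrow> \<bar>W z - W z'\<bar> \<le> C * dist z z'"
    using locally_lipschitz_on_compact[OF lip K'c K'U] by blast
  have "bounded (W ` K')" by (intro compact_imp_bounded compact_continuous_image Wc K'c)
  then obtain M where M: "\<And>z. z \<in> K' \<Longrightarrow> \<bar>W z\<bar> \<le> M"
    unfolding bounded_iff by auto
  show ?thesis
  proof (rule that[of "2 * C"])
    show "0 \<le> 2 * C" using C by simp
    fix \<eta> :: real assume \<eta>: "0 < \<eta>"
    \<comment> \<open>\<open>\<sigma>\<close> will bound the distance to the minimizer:
      \<open>\<rho>\<close> is for the Lipschitz estimate, \<open>r / 2\<close> keeps the minimizer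
      interior, and the last two entries give the closeness of \<open>z'\<close> to \<open>z\<close>
      and of \<open>f z\<close> to \<open>W z\<close>.\<close>
    define \<sigma> where "\<sigma> = Min {\<rho>, r / 2, \<eta>, \<eta> / (C + 1)}"
    have "0 < \<sigma>" using C r \<eta> by (auto simp: \<sigma>_def)
    moreover have "\<sigma> \<le> \<rho>" "\<sigma> \<le> r / 2" "\<sigma> \<le> \<eta>" "\<sigma> \<le> \<eta> / (C + 1)"
      unfolding \<sigma>_def by (rule Min_le; simp)+
    ultimately have \<sigma>: "0 < \<sigma>" "\<sigma> \<le> \<rho>" "\<sigma> \<le> r / 2" "\<sigma> \<le> \<eta>" "\<sigma> \<le> \<eta> / (C + 1)"
      by blast+
    have "C * \<sigma> \<le> \<eta>"
    proof -
      have "(C + 1) * \<sigma> \<le> \<eta>" using \<sigma>(5) C(1) by (simp add: field_simps)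
      then show ?thesis using \<sigma>(1) by (simp add: algebra_simps)
    qed
    have "0 \<le> M" using M K'ne by force
    \<comment> \<open>With this \<open>k\<close>, a penalty at distance \<open>\<sigma>\<close>
      exceeds every difference of values of \<open>W\<close> on \<open>K'\<close>, so moving that
      far cannot pay.\<close>
    define k where "k = (M + 1) / \<sigma>\<^sup>2"
    have k: "0 < k" using \<open>0 \<le> M\<close> \<sigma> by (simp add: k_def)
    define g where "g = (\<lambda>y w. W w + k * (dist y w)\<^sup>2)"
    define f where "f = (\<lambda>y. INF w\<in>K'. g y w)"
    have g0: "0 \<le> g y w" if "w \<in> K'" for y w
      using that nonneg K'U k by (auto simp: g_def)
    have bdd: "bdd_below (g y ` K')" for y
      using g0 by (meson bdd_belowI2)
    have f0: "0 \<le> f y" for y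
      unfolding f_def using g0 K'ne by (intro cINF_greatest) auto
    have fle: "f y \<le> g y w" if "w \<in> K'" for y w
      unfolding f_def using that bdd by (intro cINF_lower) auto
    have main: "f z \<le> W z \<and> W z - \<eta> \<le> f z \<and>
        (\<exists>z'\<in>U. dist z' z \<le> \<eta> \<and> (\<exists>p\<in>subdiff W z'. norm p \<le> 2 * C \<and>
          (\<forall>y. f y \<le> f z + p \<bullet> (y - z) + k * (norm (y - z))\<^sup>2)))" if z: "z \<in> K" for z
    proof -
      have "continuous_on K' (g z)"
        unfolding g_def by (intro continuous_intros Wc)
      then obtain z' where z': "z' \<in> K'" "\<And>w. w \<in> K' \<Longrightarrow> g z z' \<le> g z w"
        using continuous_attains_inf[OF K'c K'ne] by metis
      have fz: "f z = g z z'"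
        unfolding f_def using z' bdd K'ne by (intro antisym cINF_lower cINF_greatest) auto
      have zK': "z \<in> K'" using z KK' by blast
      have 1: "f z \<le> W z" using fle[OF zK', of z] by (simp add: g_def)
      have kd: "k * (dist z z')\<^sup>2 \<le> W z - W z'" using 1 by (simp add: fz g_def)
      also have "\<dots> < k * \<sigma>\<^sup>2"
        using M[OF zK'] nonneg[of z'] z'(1) K'U \<sigma>(1) by (auto simp: k_def)
      finally have "dist z z' < \<sigma>"
        using k \<sigma>(1) by (simp add: power2_less_imp_less)
      moreover from this have "C * dist z z' \<le> C * \<sigma>" using C(1) by (intro mult_left_mono) auto
      ultimately have d: "dist z z' < \<rho>" "dist z z' < r / 2" "dist z z' \<le> \<eta>" "C * dist z z' \<le> \<eta>"
        using \<sigma> \<open>C * \<sigma> \<le> \<eta>\<close> by auto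
      have Wl: "\<bar>W z - W z'\<bar> \<le> C * dist z z'"
        using C(3)[OF zK' _ d(1)] z'(1) K'U by blast
      have 2: "W z - \<eta> \<le> f z"
      proof -
        have "0 \<le> k * (dist z z')\<^sup>2" using k by simp
        then show ?thesis using Wl d(4) by (simp add: fz g_def)
      qed
      define p where "p = (2 * k) *\<^sub>R (z - z')"
      \<comment> \<open>Comparison of \<open>z'\<close> with the competitor \<open>z\<close> bounds
        \<open>k\<close> times the squared distance by \<open>W z - W z'\<close>, hence by
        \<open>C\<close> times the distance. The resulting bound on \<open>p\<close> depends neither
        on \<open>k\<close> nor on \<open>\<eta>\<close>.\<close>
      have "k * dist z z' \<le> C"
      proof (cases "dist z z' = 0")
        case False
        then have "0 < dist z z'" by simp
        moreover have "(k * dist z z') * dist z z' \<le> C * dist z z'"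
          using kd Wl by (simp add: power2_eq_square mult.assoc)
        ultimately show ?thesis by (simp add: mult_right_le_imp_le)
      qed (use C in simp)
      then have 3: "norm p \<le> 2 * C" using k by (simp add: p_def dist_norm)
      have "p \<in> subdiff W z'"
        unfolding subdiff_iff
      proof safe
        fix \<epsilon> :: real assume "\<epsilon> > 0"
        have "W z' + p \<bullet> (w - z') - \<epsilon> * norm (w - z') \<le> W w" if w: "dist w z' < min (r / 2) (\<epsilon> / k)" for w
        proof -
          have "dist w z \<le> dist w z' + dist z z'" by (metis dist_commute dist_triangle)
          then have "dist w z \<le> r" using w d(2) by simp
          then have "g z z' \<le> g z w" using z'(2) K'mem[OF z] by blast
          moreover have eq: "(dist z z')\<^sup>2 - (dist z w)\<^sup>2 = 2 * ((z - z') \<bullet> (w - z')) - (norm (w - z'))\<^sup>2"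
            by (simp add: dist_norm power2_norm_eq_inner inner_simps inner_commute)
          have "k * (dist z z')\<^sup>2 - k * (dist z w)\<^sup>2 = p \<bullet> (w - z') - k * (norm (w - z'))\<^sup>2"
            unfolding right_diff_distrib[symmetric] eq by (simp add: p_def right_diff_distrib)
          ultimately have "W z' + p \<bullet> (w - z') - k * (norm (w - z'))\<^sup>2 \<le> W w"
            by (simp add: g_def)
          moreover have "k * (norm (w - z'))\<^sup>2 \<le> \<epsilon> * norm (w - z')"
          proof -
            have "k * norm (w - z') \<le> \<epsilon>" using w k by (simp add: dist_norm field_simps)
            then show ?thesis
              by (simp add: power2_eq_square mult_right_mono flip: mult.assoc)
          qed
          ultimately show ?thesis by simp
        qed
        moreover have "min (r / 2) (\<epsilon> / k) > 0" using r k \<open>\<epsilon> > 0\<close> by simp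
        ultimately show "\<exists>\<delta>>0. \<forall>w. dist w z' < \<delta> \<longrightarrow> W z' + p \<bullet> (w - z') - \<epsilon> * norm (w - z') \<le> W w"
          by blast
      qed
      \<comment> \<open>Keeping the minimizer \<open>z'\<close> of the base point \<open>z\<close>
        as a competitor for \<open>y\<close> gives a paraboloid above \<open>f\<close> that touches
        it at \<open>z\<close>.\<close>
      moreover have "f y \<le> f z + p \<bullet> (y - z) + k * (norm (y - z))\<^sup>2" for y
      proof -
        have eq: "(dist y z')\<^sup>2 - (dist z z')\<^sup>2 = 2 * ((z - z') \<bullet> (y - z)) + (norm (y - z))\<^sup>2"
          by (simp add: dist_norm power2_norm_eq_inner inner_simps inner_commute)
        have "k * (dist y z')\<^sup>2 - k * (dist z z')\<^sup>2 = p \<bullet> (y - z) + k * (norm (y - z))\<^sup>2"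
          unfolding right_diff_distrib[symmetric] eq by (simp add: p_def distrib_left)
        then show ?thesis using fle[OF z'(1), of y] by (simp add: fz g_def)
      qed
      ultimately show ?thesis using 1 2 3 d(3) z'(1) K'U by (auto simp: dist_commute)
    qed
    show "\<exists>k f. 0 \<le> k \<and> (\<forall>y. 0 \<le> f y) \<and>
      (\<forall>z\<in>K. f z \<le> W z \<and> W z - \<eta> \<le> f z \<and>
        (\<exists>z'\<in>U. dist z' z \<le> \<eta> \<and> (\<exists>p\<in>subdiff W z'. norm p \<le> 2 * C \<and>
          (\<forall>y. f y \<le> f z + p \<bullet> (y - z) + k * (norm (y - z))\<^sup>2))))"
      using main f0 k by (intro exI[of _ k] exI[of _ f]) auto
  qed
qed

section \<open>The initial condition without filters\<close>

lemma eventually_at_right_times_nhds: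
  fixes x :: "'a::metric_space"
  shows "(\<forall>\<^sub>F (h, y) in at_right (0::real) \<times>\<^sub>F nhds x. P h y) \<longleftrightarrow>
    (\<exists>\<delta>>0. \<forall>h y. 0 < h \<and> h < \<delta> \<and> dist y x < \<delta> \<longrightarrow> P h y)" (is "?l \<longleftrightarrow> ?r")
proof
  assume ?l
  then obtain P1 P2 where 1: "eventually P1 (at_right (0::real))" and 2: "eventually P2 (nhds x)"
    and P: "\<And>h y. P1 h \<Longrightarrow> P2 y \<Longrightarrow> P h y"
    unfolding eventually_prod_filter by auto
  obtain b where "b > 0" "\<And>h. 0 < h \<Longrightarrow> h < b \<Longrightarrow> P1 h"
    using 1 unfolding eventually_at_right_field by blast
  moreover obtain d where "d > 0" "\<And>y. dist y x < d \<Longrightarrow> P2 y"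
    using 2 unfolding eventually_nhds_metric by blast
  ultimately show ?r using P by (intro exI[of _ "min b d"]) auto
next
  assume ?r
  then obtain \<delta> where \<delta>: "\<delta> > 0" "\<And>h y. 0 < h \<Longrightarrow> h < \<delta> \<Longrightarrow> dist y x < \<delta> \<Longrightarrow> P h y" by blast
  have "eventually (\<lambda>h. 0 < h \<and> h < \<delta>) (at_right (0::real))"
    unfolding eventually_at_right_field using \<delta>(1) by blast
  moreover have "eventually (\<lambda>y. dist y x < \<delta>) (nhds x)"
    unfolding eventually_nhds_metric using \<delta>(1) by blast
  ultimately show ?l
    unfolding eventually_prod_filter using \<delta>(2) by auto
qed

lemma Liminf_eq_iff:
  fixes X :: "'b \<Rightarrow> 'c::{complete_linorder, dense_linorder}"
  shows "Liminf F X = l \<longleftrightarrow> (\<forall>a<l. \<forall>\<^sub>F x in F. a < X x) \<and> (\<forall>b>l. \<exists>\<^sub>F x in F. X x < b)"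
proof safe
  fix a assume "a < Liminf F X"
  then show "\<forall>\<^sub>F x in F. a < X x" by (rule less_LiminfD)
next
  fix b assume b: "b > Liminf F X"
  show "\<exists>\<^sub>F x in F. X x < b"
  proof (rule ccontr)
    assume "\<not> (\<exists>\<^sub>F x in F. X x < b)"
    then have "\<forall>\<^sub>F x in F. b \<le> X x" by (simp add: not_frequently not_less)
    then have "b \<le> Liminf F X" by (rule Liminf_bounded)
    then show False using b by simp
  qed
next
  assume a: "\<forall>a<l. \<forall>\<^sub>F x in F. a < X x" and b: "\<forall>b>l. \<exists>\<^sub>F x in F. X x < b"
  have "l \<le> Liminf F X" using a by (simp add: le_Liminf_iff)
  moreover have "\<not> l < Liminf F X"
  proof
    assume "l < Liminf F X"
    then obtain c where c: "l < c" "c < Liminf F X" using dense by blast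
    then have "\<forall>\<^sub>F x in F. c < X x" by (intro less_LiminfD)
    then have "\<forall>\<^sub>F x in F. \<not> X x < c" by (rule eventually_mono) auto
    moreover have "\<exists>\<^sub>F x in F. X x < c" using b c by blast
    ultimately show False by (simp add: frequently_def)
  qed
  ultimately show "Liminf F X = l" by simp
qed

text \<open>The two halves are of different strength: the lower bound holds throughout a
  neighbourhood, whereas small values are only known to occur somewhere near \<open>(0, x)\<close>.
  A comparison must therefore travel to such a point.\<close>

lemma initial_condition_iff:
  "initial_condition \<phi> W \<longleftrightarrow>
    (\<forall>x. (\<forall>a<\<phi> x. \<exists>\<delta>>0. \<forall>h y. 0 < h \<and> h < \<delta> \<and> dist y x < \<delta> \<longrightarrow> a < ennreal (W (h, y))) \<and>
      (\<forall>b>\<phi> x. \<forall>\<delta>>0. \<exists>h y. 0 < h \<and> h < \<delta> \<and> dist y x < \<delta> \<and> ennreal (W (h, y)) < b))"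
proof -
  have f: "(\<exists>\<^sub>F z in at_right 0 \<times>\<^sub>F nhds x. (case z of (h, y) \<Rightarrow> ennreal (W (h, y))) < b) \<longleftrightarrow>
    (\<forall>\<delta>>0. \<exists>h y. 0 < h \<and> h < \<delta> \<and> dist y x < \<delta> \<and> ennreal (W (h, y)) < b)" for b x
    using eventually_at_right_times_nhds[of "\<lambda>h y. \<not> ennreal (W (h, y)) < b" x]
    unfolding frequently_def by (simp add: case_prod_beta')
  have e: "(\<forall>\<^sub>F z in at_right 0 \<times>\<^sub>F nhds x. a < (case z of (h, y) \<Rightarrow> ennreal (W (h, y)))) \<longleftrightarrow>
    (\<exists>\<delta>>0. \<forall>h y. 0 < h \<and> h < \<delta> \<and> dist y x < \<delta> \<longrightarrow> a < ennreal (W (h, y)))" for a x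
    using eventually_at_right_times_nhds[of "\<lambda>h y. a < ennreal (W (h, y))" x]
    by (simp add: case_prod_beta')
  show ?thesis
    unfolding initial_condition_def Liminf_eq_iff f e by blast
qed

section \<open>The comparison principle\<close>

text \<open>Over \<open>Suc n\<close> equal subintervals the quadratic errors add up to
  \<open>B * d\<^sup>2 / real (Suc n)\<close>, which tends to 0. This replaces differentiation of
  the semiconcave function \<open>a\<close>.\<close>

lemma increment_le_of_quadratic_error:
  fixes a :: "real \<Rightarrow> real"
  assumes d: "0 \<le> d"
    and le: "\<And>s s'. 0 \<le> s \<Longrightarrow> s \<le> s' \<Longrightarrow> s' \<le> d \<Longrightarrow> a s' - a s \<le> A * (s' - s) + B * (s' - s)\<^sup>2"
  shows "a d - a 0 \<le> A * d"
proof -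
  have step: "a d - a 0 \<le> A * d + B * d\<^sup>2 / real (Suc n)" for n
  proof -
    define N where "N = real (Suc n)"
    have N: "N > 0" by (simp add: N_def)
    define h where "h = d / N"
    have h: "0 \<le> h" "N * h = d" using d N by (auto simp: h_def)
    have "a (real i * h) - a 0 \<le> real i * (A * h + B * h\<^sup>2)" if "i \<le> Suc n" for i
      using that
    proof (induction i)
      case (Suc i)
      have "real (Suc i) * h \<le> d"
        using mult_right_mono[of "real (Suc i)" N h] Suc.prems h by (simp add: N_def)
      then have "a (real (Suc i) * h) - a (real i * h) \<le> A * (real (Suc i) * h - real i * h) + B * (real (Suc i) * h - real i * h)\<^sup>2"
        using h(1) by (intro le) (auto simp: mult_right_mono)
      also have "real (Suc i) * h - real i * h = h" by (simp add: algebra_simps)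
      finally show ?case using Suc by (simp add: algebra_simps)
    qed simp
    from this[of "Suc n"] have "a d - a 0 \<le> N * (A * h + B * h\<^sup>2)"
      using h(2) by (simp add: N_def)
    also have "\<dots> = A * d + B * d\<^sup>2 / N"
      using N by (simp add: h_def field_simps power2_eq_square)
    finally show ?thesis by (simp add: N_def)
  qed
  have "(\<lambda>n. A * d + B * d\<^sup>2 / real (Suc n)) \<longlonglongrightarrow> A * d + 0"
    by (intro tendsto_add tendsto_const LIMSEQ_Suc lim_const_over_n)
  then show ?thesis using step by (intro LIMSEQ_le_const) auto
qed

lemma open_pos_times: "open (pos_times :: (real \<times> 'a::euclidean_space) set)"
  by (intro open_Times) auto

context lagrangian
begin

text \<open>Here and in \<open>supersolution\<close> the supremum in the Hamiltonian is unfolded, so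
  that the comparison is carried out in real numbers. The \<open>\<epsilon>\<close> in the second
  definition avoids exhibiting a maximizer.\<close>

definition subsolution :: "(real \<times> 'a \<Rightarrow> real) \<Rightarrow> bool"
  where "subsolution W \<longleftrightarrow>
    (\<forall>t>0. \<forall>x. \<forall>(p\<^sub>t, p\<^sub>x)\<in>subdiff W (t, x). \<forall>u. p\<^sub>t - p\<^sub>x \<bullet> u \<le> L x u)"

definition supersolution :: "(real \<times> 'a \<Rightarrow> real) \<Rightarrow> bool"
  where "supersolution W \<longleftrightarrow>
    (\<forall>t>0. \<forall>x. \<forall>(p\<^sub>t, p\<^sub>x)\<in>subdiff W (t, x). \<forall>\<epsilon>>0. \<exists>u. L x u < p\<^sub>t - p\<^sub>x \<bullet> u + \<epsilon>)"

lemma uniformly_continuous_L: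
  assumes "compact S" "0 < \<epsilon>"
  obtains \<delta> where "0 < \<delta>"
    "\<And>x x' u. x \<in> S \<Longrightarrow> x' \<in> S \<Longrightarrow> norm u \<le> R \<Longrightarrow> norm (x' - x) < \<delta> \<Longrightarrow> \<bar>L x' u - L x u\<bar> < \<epsilon>"
proof -
  have "uniformly_continuous_on (S \<times> cball 0 R) (\<lambda>(x, u). L x u)"
    by (intro compact_uniformly_continuous compact_Times assms continuous_on_subset[OF cont]) auto
  then obtain \<delta> where "\<delta> > 0" and \<delta>: "\<And>z z'. z \<in> S \<times> cball 0 R \<Longrightarrow> z' \<in> S \<times> cball 0 R \<Longrightarrow> dist z' z < \<delta> \<Longrightarrow>
      dist (case z' of (x, u) \<Rightarrow> L x u) (case z of (x, u) \<Rightarrow> L x u) < \<epsilon>"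
    unfolding uniformly_continuous_on_def using assms(2) by metis
  have "\<bar>L x' u - L x u\<bar> < \<epsilon>" if "x \<in> S" "x' \<in> S" "norm u \<le> R" "norm (x' - x) < \<delta>" for x x' u
    using \<delta>[of "(x, u)" "(x', u)"] that by (auto simp: dist_norm)
  then show ?thesis using that \<open>\<delta> > 0\<close> by blast
qed

text \<open>Along the segment traversed backwards, the inf-convolution has the supergradients
  \<open>(p\<^sub>t, p\<^sub>x)\<close>, whose component in the direction \<open>(1, - u)\<close> is bounded by the equation.\<close>

lemma subsolution_segment:
  assumes sub: "subsolution W" and lip: "locally_lipschitz_on pos_times W"
    and nonneg: "\<And>z. z \<in> pos_times \<Longrightarrow> 0 \<le> W z"
    and t: "0 < t" and d: "0 \<le> d" and m: "\<And>s. s \<in> {0..d} \<Longrightarrow> L (x + s *\<^sub>R u) u \<le> m"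
  shows "W (t + d, x) \<le> d * m + W (t, x + d *\<^sub>R u)"
proof -
  \<comment> \<open>The first coordinate is the time left, which grows as the point retreats along
    the segment: \<open>\<zeta> 0\<close> is its far end and \<open>\<zeta> d\<close> is
    \<open>(t + d, x)\<close>.\<close>
  define \<zeta> where "\<zeta> = (\<lambda>\<tau>. (t + \<tau>, x + (d - \<tau>) *\<^sub>R u))"
  define K where "K = \<zeta> ` {0..d}"
  have K: "compact K"
    unfolding K_def \<zeta>_def by (intro compact_continuous_image continuous_intros) auto
  have Kpos: "K \<subseteq> pos_times" using t by (auto simp: K_def \<zeta>_def)
  obtain C where "0 \<le> C" and C: "\<And>\<eta>. 0 < \<eta> \<Longrightarrow> \<exists>k f. 0 \<le> k \<and> (\<forall>y. 0 \<le> f y) \<and>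
      (\<forall>z\<in>K. f z \<le> W z \<and> W z - \<eta> \<le> f z \<and>
        (\<exists>z'\<in>pos_times. dist z' z \<le> \<eta> \<and> (\<exists>p\<in>subdiff W z'. norm p \<le> C \<and>
          (\<forall>y. f y \<le> f z + p \<bullet> (y - z) + k * (norm (y - z))\<^sup>2))))"
    using inf_convolution[OF open_pos_times K Kpos lip nonneg] by blast
  have "W (t + d, x) \<le> d * m + W (t, x + d *\<^sub>R u) + \<epsilon>" if "\<epsilon> > 0" for \<epsilon>
  proof -
    define e where "e = \<epsilon> / (d + 1)"
    have e: "0 < e" using that d by (simp add: e_def)
    have de: "d * e + e = \<epsilon>"
    proof -
      have "e * (d + 1) = \<epsilon>" using d by (simp add: e_def)
      then show ?thesis by (simp add: algebra_simps)
    qed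
    \<comment> \<open>The added 1 leaves room for the base point \<open>x'\<close> of the
      subgradient, which may lie off the segment by at most \<open>\<eta> \<le> 1\<close>.\<close>
    define R where "R = norm x + d * norm u + 1"
    obtain \<delta> where \<delta>: "0 < \<delta>"
      "\<And>y y' w. y \<in> cball 0 R \<Longrightarrow> y' \<in> cball 0 R \<Longrightarrow> norm w \<le> norm u \<Longrightarrow> norm (y' - y) < \<delta> \<Longrightarrow> \<bar>L y' w - L y w\<bar> < e"
      using uniformly_continuous_L[OF compact_cball e, of 0 R "norm u"] by blast
    define \<eta> where "\<eta> = min (\<delta> / 2) (min 1 e)"
    have \<eta>: "0 < \<eta>" "\<eta> < \<delta>" "\<eta> \<le> 1" "\<eta> \<le> e" using \<delta>(1) e by (auto simp: \<eta>_def)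
    obtain k f where kf: "0 \<le> k" and f: "\<And>z. z \<in> K \<Longrightarrow> f z \<le> W z \<and> W z - \<eta> \<le> f z \<and>
        (\<exists>z'\<in>pos_times. dist z' z \<le> \<eta> \<and> (\<exists>p\<in>subdiff W z'. norm p \<le> C \<and>
          (\<forall>y. f y \<le> f z + p \<bullet> (y - z) + k * (norm (y - z))\<^sup>2)))"
      using C[OF \<eta>(1)] by blast
    have "f (\<zeta> s') - f (\<zeta> s) \<le> (m + e) * (s' - s) + k * (norm (1::real, - u))\<^sup>2 * (s' - s)\<^sup>2"
      if s: "0 \<le> s" "s \<le> s'" "s' \<le> d" for s s'
    proof -
      have "\<zeta> s \<in> K" using s by (auto simp: K_def)
      then obtain t' x' p\<^sub>t p\<^sub>x where z': "0 < t'" "dist (t', x') (\<zeta> s) \<le> \<eta>"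
        and p: "(p\<^sub>t, p\<^sub>x) \<in> subdiff W (t', x')"
          "f (\<zeta> s') \<le> f (\<zeta> s) + (p\<^sub>t, p\<^sub>x) \<bullet> (\<zeta> s' - \<zeta> s) + k * (norm (\<zeta> s' - \<zeta> s))\<^sup>2"
        using f[of "\<zeta> s"] by fast
      have \<zeta>d: "\<zeta> s' - \<zeta> s = (s' - s) *\<^sub>R (1, - u)"
        by (simp add: \<zeta>_def algebra_simps)
      define y where "y = x + (d - s) *\<^sub>R u"
      have "dist x' y \<le> \<eta>"
        using z'(2) order_trans[OF dist_snd_le] by (force simp: \<zeta>_def y_def)
      then have x'y: "norm (x' - y) < \<delta>" "norm (x' - y) \<le> 1" using \<eta> by (auto simp: dist_norm)
      have "norm y \<le> norm x + norm ((d - s) *\<^sub>R u)" unfolding y_def by (rule norm_triangle_ineq)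
      also have "norm ((d - s) *\<^sub>R u) \<le> d * norm u" using s by (auto intro!: mult_right_mono)
      finally have yR: "norm y \<le> R - 1" by (simp add: R_def)
      then have "norm x' \<le> R" using x'y(2) norm_triangle_sub[of x' y] by simp
      then have "\<bar>L x' u - L y u\<bar> < e"
        using \<delta>(2)[of y x' u] yR x'y by simp
      moreover have "L y u \<le> m" unfolding y_def using s by (intro m) auto
      moreover have "p\<^sub>t - p\<^sub>x \<bullet> u \<le> L x' u"
        using sub z'(1) p(1) unfolding subsolution_def by blast
      ultimately have "p\<^sub>t - p\<^sub>x \<bullet> u \<le> m + e" by simp
      then have "(s' - s) * (p\<^sub>t - p\<^sub>x \<bullet> u) \<le> (s' - s) * (m + e)" using s by (intro mult_left_mono) auto
      then have "(p\<^sub>t, p\<^sub>x) \<bullet> (\<zeta> s' - \<zeta> s) \<le> (m + e) * (s' - s)"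
        unfolding \<zeta>d by (simp add: inner_Pair mult.commute algebra_simps)
      moreover have "k * (norm (\<zeta> s' - \<zeta> s))\<^sup>2 = k * (norm (1::real, - u))\<^sup>2 * (s' - s)\<^sup>2"
        unfolding \<zeta>d norm_scaleR by (simp only: power_mult_distrib power2_abs mult_ac)
      ultimately show ?thesis using p(2) by linarith
    qed
    then have "f (\<zeta> d) - f (\<zeta> 0) \<le> (m + e) * d"
      by (rule increment_le_of_quadratic_error[OF d])
    moreover have "\<zeta> d \<in> K" "\<zeta> 0 \<in> K" using d by (auto simp: K_def)
    then have "W (\<zeta> d) - \<eta> \<le> f (\<zeta> d)" "f (\<zeta> 0) \<le> W (\<zeta> 0)" using f by blast+
    ultimately have "W (\<zeta> d) \<le> W (\<zeta> 0) + d * m + (d * e + \<eta>)" by (simp add: algebra_simps)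
    then show ?thesis using de \<eta>(4) by (simp add: \<zeta>_def)
  qed
  then show ?thesis by (rule field_le_epsilon)
qed

text \<open>The cost is an upper Riemann sum, which spares integrals along the segments.\<close>

inductive polygon :: "'a \<Rightarrow> real \<Rightarrow> real \<Rightarrow> 'a \<Rightarrow> bool" for x
  where
    start: "polygon x 0 0 x"
  | step: "polygon x (T + d) (c + d * m) (y + d *\<^sub>R u)"
    if "polygon x T c y" "0 \<le> d" "\<forall>s\<in>{0..d}. L (y + s *\<^sub>R u) u \<le> m"

lemma polygon_nonneg: "polygon x T c y \<Longrightarrow> 0 \<le> T"
  by (induction rule: polygon.induct) auto

text \<open>\<open>t\<close> varies in the induction: for the polygon without its last edge, the
  duration of that edge is added to the time left at the end.\<close>

lemma subsolution_polygon:
  assumes "polygon x T c y" and sub: "subsolution W" and lip: "locally_lipschitz_on pos_times W"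
    and nonneg: "\<And>z. z \<in> pos_times \<Longrightarrow> 0 \<le> W z" and "0 < t"
  shows "W (t + T, x) \<le> c + W (t, y)"
  using assms(1,5)
proof (induction arbitrary: t rule: polygon.induct)
  case (step T c y d u m)
  have "W ((t + d) + T, x) \<le> c + W (t + d, y)" using step by (intro step.IH) simp
  moreover have "W (t + d, y) \<le> d * m + W (t, y + d *\<^sub>R u)"
    using step by (intro subsolution_segment[OF sub lip nonneg]) auto
  ultimately show ?case by (simp add: add_ac)
qed simp

text \<open>Coercivity at the start of an edge bounds its speed by \<open>m + C\<close>. Since the
  left side is nonnegative, the same estimate bounds the cost \<open>c\<close> from below.\<close>

lemma polygon_norm_le:
  assumes "polygon x T c y" "\<And>x u. norm u - C \<le> L x u"
  shows "norm (y - x) \<le> c + C * T"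
  using assms(1)
proof (induction rule: polygon.induct)
  case (step T c y d u m)
  have "norm u - C \<le> L (y + 0 *\<^sub>R u) u" using assms(2) by simp
  also have "\<dots> \<le> m" using step by (simp del: scale_zero_left)
  finally have "d * norm u \<le> d * (m + C)" using step by (intro mult_left_mono) auto
  moreover have "norm (y + d *\<^sub>R u - x) \<le> norm (y - x) + d * norm u"
    using norm_triangle_ineq[of "y - x" "d *\<^sub>R u"] step by (simp add: algebra_simps)
  ultimately show ?case using step by (simp add: algebra_simps)
qed simp

text \<open>Proximal aiming: from the current point move with a velocity \<open>u\<close> that almost attains the
  Hamiltonian at the subgradient found at the minimizer of the inf-convolution.\<close>

lemma supersolution_polygon:
  assumes super: "supersolution W" and lip: "locally_lipschitz_on pos_times W"
    and nonneg: "\<And>z. z \<in> pos_times \<Longrightarrow> 0 \<le> W z"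
    and h: "0 < h" "h < t" and \<epsilon>: "0 < \<epsilon>"
  obtains y c where "polygon x (t - h) c y" "c + W (h, y) \<le> W (t, x) + \<epsilon>"
proof -
  obtain C1 where C1: "0 \<le> C1" "\<And>x u. norm u - C1 \<le> L x u"
    using superlinear[of 1] by auto
  \<comment> \<open>Per unit of time \<open>e\<close> is lost three times: in the choice of the
    velocity, in moving \<open>L\<close> from \<open>x'\<close> to the edge, and in the quadratic
    term. A last \<open>e\<close> pays for \<open>\<eta>\<close> at the end. The minimum with 1
    keeps the accumulated loss below 1, which \<open>R\<close> relies on.\<close>
  define e where "e = min \<epsilon> 1 / (4 * (t + 1))"
  have e: "0 < e" using \<epsilon> h by (simp add: e_def)
  have "e * (4 * (t + 1)) = min \<epsilon> 1" unfolding e_def using h by (intro nonzero_eq_divide_eq[THEN iffD1]) auto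
  then have et: "4 * e * (t + 1) = min \<epsilon> 1" by (simp only: mult_ac)
  have et': "3 * e * t + e \<le> \<epsilon>" "3 * e * t \<le> 1" "e \<le> 1"
  proof -
    have "0 \<le> e * t" using e h by simp
    then show "3 * e * t + e \<le> \<epsilon>" "3 * e * t \<le> 1" "e \<le> 1"
      using et e by (auto simp: algebra_simps)
  qed
  define R where "R = W (t, x) + 1 + C1 * t"
  define K where "K = {h..t} \<times> cball x R"
  have K: "compact K" by (simp add: K_def compact_Times)
  have Kpos: "K \<subseteq> pos_times" using h by (auto simp: K_def)
  obtain C where "0 \<le> C" and C: "\<And>\<eta>. 0 < \<eta> \<Longrightarrow> \<exists>k f. 0 \<le> k \<and> (\<forall>y. 0 \<le> f y) \<and>
      (\<forall>z\<in>K. f z \<le> W z \<and> W z - \<eta> \<le> f z \<and>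
        (\<exists>z'\<in>pos_times. dist z' z \<le> \<eta> \<and> (\<exists>p\<in>subdiff W z'. norm p \<le> C \<and>
          (\<forall>y. f y \<le> f z + p \<bullet> (y - z) + k * (norm (y - z))\<^sup>2))))"
    using inf_convolution[OF open_pos_times K Kpos lip nonneg] by blast
  obtain C2 where C2: "0 \<le> C2" "\<And>x u. (C + 1) * norm u - C2 \<le> L x u"
    using superlinear[of "C + 1"] by auto
  \<comment> \<open>An almost maximizing velocity satisfies
    \<open>(C + 1) * norm u - C2 < C + C * norm u + 1\<close>, which is exactly this bound.\<close>
  define Ru where "Ru = C + 1 + C2"
  have Ru: "0 \<le> Ru" using \<open>0 \<le> C\<close> C2 by (simp add: Ru_def)
  obtain \<delta> where \<delta>: "0 < \<delta>" "\<And>y y' w. y \<in> cball x (R + Ru * t + 1) \<Longrightarrow> y' \<in> cball x (R + Ru * t + 1) \<Longrightarrow>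
      norm w \<le> Ru \<Longrightarrow> norm (y' - y) < \<delta> \<Longrightarrow> \<bar>L y' w - L y w\<bar> < e"
    using uniformly_continuous_L[OF compact_cball e, of x "R + Ru * t + 1" Ru] by blast
  define \<eta> where "\<eta> = min (\<delta> / 2) (min 1 e)"
  have \<eta>: "0 < \<eta>" "\<eta> \<le> \<delta> / 2" "\<eta> \<le> 1" "\<eta> \<le> e" using \<delta>(1) e by (auto simp: \<eta>_def)
  obtain k f where kf: "0 \<le> k" "\<And>y. 0 \<le> f y" and f: "\<And>z. z \<in> K \<Longrightarrow> f z \<le> W z \<and> W z - \<eta> \<le> f z \<and>
      (\<exists>z'\<in>pos_times. dist z' z \<le> \<eta> \<and> (\<exists>p\<in>subdiff W z'. norm p \<le> C \<and>
        (\<forall>y. f y \<le> f z + p \<bullet> (y - z) + k * (norm (y - z))\<^sup>2)))"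
    using C[OF \<eta>(1)] by blast
  \<comment> \<open>The first summand makes an edge shorter than \<open>\<delta> / 2\<close>, the
    second makes the quadratic term of a step at most \<open>d * e\<close>.\<close>
  obtain N where N: "(t - h) * (2 * Ru / \<delta> + k * (1 + Ru\<^sup>2) / e + 1) < real N"
    using reals_Archimedean2 by blast
  define d where "d = (t - h) / real N"
  have Npos: "0 < real N"
  proof -
    have "0 \<le> (t - h) * (2 * Ru / \<delta> + k * (1 + Ru\<^sup>2) / e + 1)"
      using h Ru \<delta>(1) e kf(1) by (intro mult_nonneg_nonneg add_nonneg_nonneg divide_nonneg_pos) auto
    then show ?thesis using N by simp
  qed
  have d: "0 < d" "real N * d = t - h" using Npos h by (auto simp: d_def)
  have dsmall: "d * (2 * Ru / \<delta> + k * (1 + Ru\<^sup>2) / e + 1) < 1"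
    using N Npos by (simp add: d_def field_simps)
  have d\<delta>: "d * Ru < \<delta> / 2" and dk: "d * (k * (1 + Ru\<^sup>2)) \<le> e"
  proof -
    have "0 \<le> d * (2 * Ru / \<delta>)" "0 \<le> d * (k * (1 + Ru\<^sup>2) / e)"
      using d Ru \<delta>(1) e kf(1) by auto
    then have "d * (2 * Ru / \<delta>) < 1" "d * (k * (1 + Ru\<^sup>2) / e) < 1"
      using dsmall d(1) by (auto simp: distrib_left)
    then show "d * Ru < \<delta> / 2" "d * (k * (1 + Ru\<^sup>2)) \<le> e"
      using \<delta>(1) e by (auto simp: field_simps)
  qed
  have x0: "(t, x) \<in> K"
  proof -
    have "0 \<le> W (t, x)" using nonneg h by auto
    then have "0 \<le> R" using C1 h by (simp add: R_def)
    then show ?thesis using h by (simp add: K_def)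
  qed
  \<comment> \<open>The induction invariant alone confines the polygon: as \<open>f\<close> is
    nonnegative, it bounds the cost by \<open>W (t, x) + 1\<close>, and a bounded cost bounds the
    displacement.\<close>
  have inK: "(t - T, y) \<in> K" if "polygon x T c y" "c + f (t - T, y) \<le> W (t, x) + 3 * e * T" "T \<le> t - h" for T c y
  proof -
    have "0 \<le> T" using polygon_nonneg[OF that(1)] .
    then have "3 * e * T \<le> 3 * e * t" using that(3) h e by (intro mult_left_mono) auto
    then have "c \<le> W (t, x) + 1" using that(2) kf(2)[of "(t - T, y)"] et' by linarith
    moreover have "norm (y - x) \<le> c + C1 * T" by (rule polygon_norm_le[OF that(1) C1(2)])
    moreover have "C1 * T \<le> C1 * t" using that(3) h C1 by (intro mult_left_mono) auto
    ultimately have "norm (y - x) \<le> R" by (simp add: R_def)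
    then show ?thesis using that(3) \<open>0 \<le> T\<close> by (auto simp: K_def dist_norm norm_minus_commute)
  qed
  \<comment> \<open>The invariant is stated for \<open>f\<close>, which has the upper expansion
    needed for a step; \<open>W\<close> reappears only at the two ends.\<close>
  have "\<exists>y c. polygon x (real i * d) c y \<and> c + f (t - real i * d, y) \<le> W (t, x) + 3 * e * (real i * d)"
    if "i \<le> N" for i
    using that
  proof (induction i)
    case 0
    show ?case using polygon.start[of x] f[OF x0] by (intro exI[of _ x] exI[of _ 0]) auto
  next
    case (Suc i)
    then obtain y c where y: "polygon x (real i * d) c y"
      "c + f (t - real i * d, y) \<le> W (t, x) + 3 * e * (real i * d)" by auto
    define T where "T = real i * d"
    note y = y[folded T_def]
    have Td: "T + d \<le> t - h"
    proof -
      have "real (Suc i) * d \<le> real N * d" using Suc.prems d by (intro mult_right_mono) auto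
      then show ?thesis using d(2) by (simp add: T_def algebra_simps)
    qed
    then have "T \<le> t - h" using d(1) by simp
    from inK[OF y this] have tyK: "(t - T, y) \<in> K" .
    from f[OF tyK] obtain t' x' p\<^sub>t p\<^sub>x where z': "0 < t'" "dist (t', x') (t - T, y) \<le> \<eta>"
      and p: "(p\<^sub>t, p\<^sub>x) \<in> subdiff W (t', x')" "norm (p\<^sub>t, p\<^sub>x) \<le> C"
        "\<And>w. f w \<le> f (t - T, y) + (p\<^sub>t, p\<^sub>x) \<bullet> (w - (t - T, y)) + k * (norm (w - (t - T, y)))\<^sup>2"
      by fast
    have pn: "\<bar>p\<^sub>t\<bar> \<le> C" "norm p\<^sub>x \<le> C"
      using p(2) norm_fst_le[of p\<^sub>t p\<^sub>x] norm_snd_le[of p\<^sub>x p\<^sub>t] by auto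
    obtain u where u: "L x' u < p\<^sub>t - p\<^sub>x \<bullet> u + e"
      using super z'(1) p(1) e unfolding supersolution_def by blast
    have "- (p\<^sub>x \<bullet> u) \<le> C * norm u"
      using norm_cauchy_schwarz[of "- p\<^sub>x" u] pn(2) by (simp add: mult_right_mono order_trans)
    then have "(C + 1) * norm u - C2 < C + C * norm u + 1"
      using C2(2)[of u x'] u pn(1) et'(3) by linarith
    then have uR: "norm u \<le> Ru" by (simp add: Ru_def algebra_simps)
    have x'y: "norm (x' - y) \<le> \<eta>"
      using order_trans[OF dist_snd_le z'(2)] by (simp add: dist_norm)
    have yR: "norm (y - x) \<le> R" using tyK by (simp add: K_def dist_norm norm_minus_commute)
    have "L (y + s *\<^sub>R u) u \<le> L x' u + e" if s: "s \<in> {0..d}" for s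
    proof -
      have su: "norm (s *\<^sub>R u) \<le> d * Ru" using s uR d Ru by (auto intro!: mult_mono)
      have "d \<le> t" using Td h polygon_nonneg[OF y(1)] by simp
      then have "d * Ru \<le> Ru * t" using Ru by (simp add: mult.commute mult_left_mono)
      have "norm (y + s *\<^sub>R u - x) \<le> norm (y - x) + norm (s *\<^sub>R u)"
        using norm_triangle_ineq[of "y - x" "s *\<^sub>R u"] by (simp add: algebra_simps)
      then have 1: "norm (y + s *\<^sub>R u - x) \<le> R + Ru * t + 1" using su yR \<open>d * Ru \<le> Ru * t\<close> by linarith
      have "norm (x' - x) \<le> norm (x' - y) + norm (y - x)" using norm_triangle_ineq[of "x' - y" "y - x"] by simp
      then have 2: "norm (x' - x) \<le> R + Ru * t + 1"
        using x'y \<eta>(3) yR \<open>d * Ru \<le> Ru * t\<close> d(1) Ru mult_nonneg_nonneg[of d Ru] by linarith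
      have "norm (y + s *\<^sub>R u - x') \<le> norm (x' - y) + norm (s *\<^sub>R u)"
        using norm_triangle_ineq[of "y - x'" "s *\<^sub>R u"] by (simp add: algebra_simps norm_minus_commute)
      then have "norm (y + s *\<^sub>R u - x') < \<delta>" using x'y su d\<delta> \<eta>(2) by linarith
      then have "\<bar>L (y + s *\<^sub>R u) u - L x' u\<bar> < e"
        using 1 2 uR by (intro \<delta>(2)) (auto simp: dist_norm norm_minus_commute)
      then show ?thesis by simp
    qed
    then have "polygon x (T + d) (c + d * (L x' u + e)) (y + d *\<^sub>R u)"
      using d(1) by (intro polygon.step y) auto
    moreover have "c + d * (L x' u + e) + f (t - (T + d), y + d *\<^sub>R u) \<le> W (t, x) + 3 * e * (T + d)"
    proof -
      have w: "(t - (T + d), y + d *\<^sub>R u) - (t - T, y) = d *\<^sub>R (- 1, u)" by simp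
      have "(norm (- 1::real, u))\<^sup>2 \<le> 1 + Ru\<^sup>2"
        using uR by (simp add: norm_Pair power_mono)
      then have "k * d\<^sup>2 * (norm (- 1::real, u))\<^sup>2 \<le> k * d\<^sup>2 * (1 + Ru\<^sup>2)"
        using kf(1) by (intro mult_left_mono) auto
      also have "\<dots> = d * (d * (k * (1 + Ru\<^sup>2)))" by (simp add: power2_eq_square mult_ac)
      also have "\<dots> \<le> d * e" using dk d by (intro mult_left_mono) auto
      finally have q: "k * (norm (d *\<^sub>R (- 1::real, u)))\<^sup>2 \<le> d * e"
        by (simp only: norm_scaleR power_mult_distrib power2_abs mult.assoc)
      have "d * (L x' u) \<le> d * (p\<^sub>t - p\<^sub>x \<bullet> u + e)" using u d by (intro mult_left_mono) auto
      moreover have "(p\<^sub>t, p\<^sub>x) \<bullet> (d *\<^sub>R (- 1, u)) = - (d * (p\<^sub>t - p\<^sub>x \<bullet> u))"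
        by (simp add: inner_Pair algebra_simps)
      ultimately have "f (t - (T + d), y + d *\<^sub>R u) + d * L x' u \<le> f (t - T, y) + d * e + d * e"
        using p(3)[of "(t - (T + d), y + d *\<^sub>R u)"] q unfolding w by (simp add: algebra_simps)
      then show ?thesis using y(2) by (simp add: algebra_simps)
    qed
    moreover have "T + d = real (Suc i) * d" by (simp add: T_def algebra_simps)
    ultimately show ?case by metis
  qed
  from this[of N] obtain y c where y: "polygon x (t - h) c y"
    "c + f (t - (t - h), y) \<le> W (t, x) + 3 * e * (t - h)" by (auto simp: d(2))
  have "(t - (t - h), y) \<in> K" by (rule inK[OF y order_refl])
  then have "W (h, y) - \<eta> \<le> f (h, y)" using f by simp
  moreover have "3 * e * (t - h) \<le> 3 * e * t" using e h by (intro mult_left_mono) auto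
  ultimately have "c + W (h, y) \<le> W (t, x) + \<epsilon>" using y(2) et'(1) \<eta>(4) by simp
  then show ?thesis using that y(1) by blast
qed

text \<open>A polygon that is almost optimal for \<open>W1\<close> is followed until the remaining time \<open>H\<close> is small; it
  ends at a point \<open>Y\<close> close to some \<open>\<xi>\<close>. A segment of unit speed leads from \<open>Y\<close> to a point \<open>y'\<close>
  where \<open>W2\<close> is almost \<open>\<phi> \<xi>\<close>; as \<open>L\<close> does not depend on time, the delay only shifts the initial
  time.\<close>

lemma comparison:
  assumes super: "supersolution W1" and lip1: "locally_lipschitz_on pos_times W1"
    and nonneg1: "\<And>z. z \<in> pos_times \<Longrightarrow> 0 \<le> W1 z" and ini1: "initial_condition \<phi> W1"
    and sub: "subsolution W2" and lip2: "locally_lipschitz_on pos_times W2"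
    and nonneg2: "\<And>z. z \<in> pos_times \<Longrightarrow> 0 \<le> W2 z" and ini2: "initial_condition \<phi> W2"
    and z: "z \<in> pos_times"
  shows "W2 z \<le> W1 z"
proof -
  obtain t x where tx: "z = (t, x)" and t: "0 < t" using z by (cases z) auto
  have "W2 (t, x) \<le> W1 (t, x) + \<epsilon>" if \<epsilon>: "0 < \<epsilon>" for \<epsilon>
  proof -
    \<comment> \<open>Five losses: the polygon, the initial values of \<open>W1\<close> and of
      \<open>W2\<close>, the connecting segment, and the time shift of \<open>W2\<close>.\<close>
    define e where "e = \<epsilon> / 5"
    have e: "0 < e" using \<epsilon> by (simp add: e_def)
    obtain C1 where C1: "0 \<le> C1" "\<And>x u. norm u - C1 \<le> L x u"
      using superlinear[of 1] by auto
    define h where "h = (\<lambda>n. t / real (n + 2))"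
    have h: "0 < h n" "h n < t" for n
    proof -
      show "0 < h n" using t by (simp add: h_def)
      have "t * 1 < t * real (n + 2)" using t by (intro mult_strict_left_mono) auto
      then show "h n < t" unfolding h_def by (subst pos_divide_less_eq) auto
    qed
    have "\<exists>y c. polygon x (t - h n) c y \<and> c + W1 (h n, y) \<le> W1 (t, x) + e" for n
      using supersolution_polygon[OF super lip1 nonneg1 h e] by metis
    then obtain y c where yc: "\<And>n. polygon x (t - h n) (c n) (y n)"
      "\<And>n. c n + W1 (h n, y n) \<le> W1 (t, x) + e" by metis
    define R where "R = W1 (t, x) + e + C1 * t"
    have "y n \<in> cball x R" for n
    proof -
      have "norm (y n - x) \<le> c n + C1 * (t - h n)" by (rule polygon_norm_le[OF yc(1) C1(2)])
      moreover have "C1 * (t - h n) \<le> C1 * t" using C1 h[of n] by (intro mult_left_mono) auto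
      moreover have "0 \<le> W1 (h n, y n)" using h by (intro nonneg1) auto
      ultimately have "norm (y n - x) \<le> R" using yc(2)[of n] by (simp add: R_def)
      then show ?thesis by (simp add: dist_norm norm_minus_commute)
    qed
    then obtain \<xi> r where \<xi>: "strict_mono (r::nat \<Rightarrow> nat)" "(y \<circ> r) \<longlonglongrightarrow> \<xi>"
      using compact_cball[of x R] unfolding compact_def by blast
    have hr: "(\<lambda>n. h (r n)) \<longlonglongrightarrow> 0"
    proof -
      have "(\<lambda>n. t / real (n + 2)) \<longlonglongrightarrow> 0" by (intro LIMSEQ_ignore_initial_segment lim_const_over_n)
      from LIMSEQ_subseq_LIMSEQ[OF this \<xi>(1)] show ?thesis by (simp add: h_def o_def)
    qed
    have near: "\<forall>\<^sub>F n in sequentially. h (r n) < \<delta> \<and> dist (y (r n)) \<xi> < \<delta>" if "0 < \<delta>" for \<delta>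
      using order_tendstoD(2)[OF hr that] tendstoD[OF \<xi>(2) that] by eventually_elim simp
    have ini1': "\<exists>\<delta>>0. \<forall>h y. 0 < h \<and> h < \<delta> \<and> dist y \<xi> < \<delta> \<longrightarrow> a < ennreal (W1 (h, y))" if "a < \<phi> \<xi>" for a
      using ini1 that unfolding initial_condition_iff by blast
    \<comment> \<open>Otherwise \<open>W1\<close> would exceed \<open>R + 1\<close> near
      \<open>(0, \<xi>)\<close>. But the cost of each polygon is at least \<open>- C1 * t\<close>,
      so \<open>W1\<close> is at most \<open>R\<close> at its end point.\<close>
    have fin: "\<phi> \<xi> \<noteq> \<infinity>"
    proof
      assume "\<phi> \<xi> = \<infinity>"
      then obtain \<delta> where \<delta>: "\<delta> > 0" "\<And>h y. 0 < h \<Longrightarrow> h < \<delta> \<Longrightarrow> dist y \<xi> < \<delta> \<Longrightarrow> ennreal (R + 1) < ennreal (W1 (h, y))"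
        using ini1'[of "ennreal (R + 1)"] by auto
      obtain n where "h (r n) < \<delta>" "dist (y (r n)) \<xi> < \<delta>"
        using near[OF \<delta>(1)] eventually_happens by (metis (mono_tags, lifting) sequentially_bot)
      then have "ennreal (R + 1) < ennreal (W1 (h (r n), y (r n)))" using \<delta>(2) h by blast
      then have "R + 1 < W1 (h (r n), y (r n))" by (meson ennreal_leI not_less)
      moreover have "norm (y (r n) - x) \<le> c (r n) + C1 * (t - h (r n))" by (rule polygon_norm_le[OF yc(1) C1(2)])
      moreover have "C1 * (t - h (r n)) \<le> C1 * t" using C1 h[of "r n"] by (intro mult_left_mono) auto
      ultimately show False using yc(2)[of "r n"] norm_ge_zero[of "y (r n) - x"] by (simp add: R_def)
    qed
    then obtain \<phi>\<xi> where \<phi>\<xi>: "\<phi> \<xi> = ennreal \<phi>\<xi>" "0 \<le> \<phi>\<xi>" by (cases "\<phi> \<xi>") auto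
    \<comment> \<open>\<open>ennreal\<close> sends negative numbers to 0, so for
      \<open>\<phi>\<xi> < e\<close> the bound comes from nonnegativity of \<open>W1\<close> and not
      from the initial condition.\<close>
    obtain \<delta>1 where \<delta>1: "0 < \<delta>1" "\<And>h y. 0 < h \<Longrightarrow> h < \<delta>1 \<Longrightarrow> dist y \<xi> < \<delta>1 \<Longrightarrow> \<phi>\<xi> - e < W1 (h, y)"
    proof (cases "\<phi>\<xi> - e < 0")
      case True
      have "\<phi>\<xi> - e < W1 (h, y)" if "0 < h" for h y using nonneg1[of "(h, y)"] that True by simp
      then show ?thesis using that[of 1] by simp
    next
      case False
      then have "ennreal (\<phi>\<xi> - e) < \<phi> \<xi>" using e by (simp add: \<phi>\<xi> ennreal_lessI)
      then obtain \<delta> where "\<delta> > 0" "\<And>h y. 0 < h \<Longrightarrow> h < \<delta> \<Longrightarrow> dist y \<xi> < \<delta> \<Longrightarrow> ennreal (\<phi>\<xi> - e) < ennreal (W1 (h, y))"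
        using ini1' by blast
      then show ?thesis using that[of \<delta>] False by (meson ennreal_leI not_less)
    qed
    have "compact ((\<lambda>(x, u). L x u) ` (cball \<xi> 1 \<times> cball 0 1))"
      by (intro compact_continuous_image compact_Times compact_cball continuous_on_subset[OF cont]) auto
    then obtain B where B': "\<And>v. v \<in> (\<lambda>(x, u). L x u) ` (cball \<xi> 1 \<times> cball 0 1) \<Longrightarrow> norm v \<le> B"
      using compact_imp_bounded bounded_iff by metis
    have B: "L w u \<le> B" if "dist \<xi> w \<le> 1" "norm u \<le> 1" for w u
    proof -
      have "(w, u) \<in> cball \<xi> 1 \<times> cball 0 1" using that by simp
      from B'[OF imageI[OF this]] show ?thesis by simp
    qed
    have "0 \<le> B" using B[of \<xi> 0] nonneg[of \<xi> 0] by simp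
    obtain \<delta>2 where \<delta>2: "0 < \<delta>2" "\<And>s. \<bar>s - t\<bar> < \<delta>2 \<Longrightarrow> 0 < s \<Longrightarrow> \<bar>W2 (s, x) - W2 (t, x)\<bar> < e"
    proof -
      have "continuous_on pos_times W2" by (rule locally_lipschitz_on_continuous[OF lip2])
      then obtain \<delta> where \<delta>: "\<delta> > 0" "\<And>z. z \<in> pos_times \<Longrightarrow> dist z (t, x) < \<delta> \<Longrightarrow> dist (W2 z) (W2 (t, x)) < e"
        unfolding continuous_on_iff using t e by (metis UNIV_I greaterThan_iff mem_Sigma_iff)
      have "\<bar>W2 (s, x) - W2 (t, x)\<bar> < e" if "\<bar>s - t\<bar> < \<delta>" "0 < s" for s
        using \<delta>(2)[of "(s, x)"] that by (simp add: dist_Pair_Pair dist_real_def)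
      then show ?thesis using that \<delta>(1) by blast
    qed
    \<comment> \<open>Since \<open>\<rho> \<le> 2 * \<delta>\<close>, the time shift
      \<open>h' + \<rho> - H\<close> stays below \<open>4 * \<delta>\<close> in absolute value and
      the connecting segment costs at most \<open>e\<close>; \<open>1 / 2\<close> keeps that segment
      in the ball where \<open>B\<close> is valid.\<close>
    define \<delta> where "\<delta> = Min {\<delta>1, \<delta>2 / 4, 1 / 2, e / (2 * (B + 1))}"
    have "0 < \<delta>" using \<delta>1(1) \<delta>2(1) e \<open>0 \<le> B\<close> by (simp add: \<delta>_def)
    moreover have "\<delta> \<le> \<delta>1" "\<delta> \<le> \<delta>2 / 4" "\<delta> \<le> 1 / 2" "\<delta> \<le> e / (2 * (B + 1))"
      unfolding \<delta>_def by (rule Min_le; simp)+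
    ultimately have \<delta>: "0 < \<delta>" "\<delta> \<le> \<delta>1" "\<delta> \<le> \<delta>2 / 4" "\<delta> \<le> 1 / 2" "\<delta> \<le> e / (2 * (B + 1))" by blast+
    obtain n where n: "h (r n) < \<delta>" "dist (y (r n)) \<xi> < \<delta>"
      using near[OF \<delta>(1)] eventually_happens by (metis (mono_tags, lifting) sequentially_bot)
    define H Y c' where "H = h (r n)" and "Y = y (r n)" and "c' = c (r n)"
    have H: "0 < H" "H < t" "H < \<delta>" "dist Y \<xi> < \<delta>" using n h by (auto simp: H_def Y_def)
    have P: "polygon x (t - H) c' Y" "c' + W1 (H, Y) \<le> W1 (t, x) + e"
      using yc[of "r n"] by (auto simp: H_def Y_def c'_def)
    have "\<phi> \<xi> < ennreal (\<phi>\<xi> + e)" using \<phi>\<xi> e by (simp add: ennreal_lessI)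
    then obtain h' y' where h': "0 < h'" "h' < \<delta>" "dist y' \<xi> < \<delta>" "ennreal (W2 (h', y')) < ennreal (\<phi>\<xi> + e)"
      using ini2 \<delta>(1) unfolding initial_condition_iff by blast
    have W2': "W2 (h', y') < \<phi>\<xi> + e" using h'(4) \<phi>\<xi>(2) e by (meson ennreal_leI not_less)
    define \<rho> where "\<rho> = norm (y' - Y)"
    have \<rho>: "0 \<le> \<rho>" "\<rho> \<le> 2 * \<delta>"
      using H(4) h'(3) dist_triangle2[of y' Y \<xi>] by (auto simp: \<rho>_def dist_norm)
    have seg: "W2 (h' + \<rho>, Y) \<le> \<rho> * B + W2 (h', y')"
    proof -
      \<comment> \<open>For \<open>\<rho> = 0\<close> this is the zero vector, as division by 0
        gives 0; hence only \<open>norm u \<le> 1\<close> is claimed.\<close>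
      define u where "u = (1 / \<rho>) *\<^sub>R (y' - Y)"
      have nu: "norm u \<le> 1" by (simp add: u_def \<rho>_def)
      have ru: "Y + \<rho> *\<^sub>R u = y'" by (cases "\<rho> = 0") (auto simp: u_def \<rho>_def)
      have "W2 (h' + \<rho>, Y) \<le> \<rho> * B + W2 (h', Y + \<rho> *\<^sub>R u)"
      proof (rule subsolution_segment[OF sub lip2 nonneg2 h'(1) \<rho>(1)])
        fix s assume s: "s \<in> {0..\<rho>}"
        have "convex (ball \<xi> \<delta>)" "Y \<in> ball \<xi> \<delta>" "y' \<in> ball \<xi> \<delta>" using H h' by (auto simp: dist_commute)
        have "Y + s *\<^sub>R u \<in> closed_segment Y y'"
        proof (cases "\<rho> = 0")
          case False
          then have "Y + s *\<^sub>R u = (1 - s / \<rho>) *\<^sub>R Y + (s / \<rho>) *\<^sub>R y'"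
            by (simp add: u_def algebra_simps)
          moreover have "0 \<le> s / \<rho>" "s / \<rho> \<le> 1" using s \<rho>(1) False by auto
          ultimately show ?thesis unfolding in_segment by blast
        qed (use s in \<open>auto simp: u_def\<close>)
        then have "Y + s *\<^sub>R u \<in> ball \<xi> \<delta>"
          using closed_segment_subset[OF \<open>Y \<in> ball \<xi> \<delta>\<close> \<open>y' \<in> ball \<xi> \<delta>\<close> \<open>convex (ball \<xi> \<delta>)\<close>] by blast
        then show "L (Y + s *\<^sub>R u) u \<le> B" using nu \<delta>(4) by (intro B) auto
      qed
      then show ?thesis by (simp add: ru)
    qed
    have "\<rho> * B \<le> e"
    proof -
      have "2 * \<delta> * (B + 1) \<le> e" using \<delta>(5) \<open>0 \<le> B\<close> by (simp add: field_simps)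
      moreover have "\<rho> * B \<le> 2 * \<delta> * (B + 1)" using \<rho> \<open>0 \<le> B\<close> by (intro mult_mono) auto
      ultimately show ?thesis by simp
    qed
    moreover have "W2 (h' + \<rho> + (t - H), x) \<le> c' + W2 (h' + \<rho>, Y)"
      using h'(1) \<rho>(1) by (intro subsolution_polygon[OF P(1) sub lip2 nonneg2]) auto
    moreover have "\<bar>W2 (h' + \<rho> + (t - H), x) - W2 (t, x)\<bar> < e"
      using h' \<rho> H \<delta>(1,3) by (intro \<delta>2(2)) auto
    moreover have "\<phi>\<xi> - e < W1 (H, Y)" using H \<delta>(2) by (intro \<delta>1(2)) auto
    moreover have "\<epsilon> = 5 * e" by (simp add: e_def)
    ultimately show ?thesis using seg W2' P(2) by linarith
  qed
  then show ?thesis unfolding tx by (rule field_le_epsilon)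
qed

end

section \<open>The value function\<close>

lemma ennreal_le_realD: "ennreal a \<le> ennreal b \<Longrightarrow> 0 \<le> b \<Longrightarrow> a \<le> b"
  by (simp add: ennreal_le_iff)

section \<open>Dynamic programming, cheap arcs and the Hamiltonian near a point\<close>

context lagrangian
begin

lemma L_bounded:
  obtains B where "0 \<le> B" "\<And>w u. norm w \<le> R \<Longrightarrow> norm u \<le> S \<Longrightarrow> L w u \<le> B"
proof -
  have "compact ((\<lambda>(x, u). L x u) ` (cball 0 R \<times> cball 0 S))"
    by (intro compact_continuous_image compact_Times compact_cball continuous_on_subset[OF cont]) auto
  then obtain B where B: "\<And>v. v \<in> (\<lambda>(x, u). L x u) ` (cball 0 R \<times> cball 0 S) \<Longrightarrow> norm v \<le> B"
    using compact_imp_bounded bounded_iff by metis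
  have "L w u \<le> max B 0" if "norm w \<le> R" "norm u \<le> S" for w u
  proof -
    have "(w, u) \<in> cball 0 R \<times> cball 0 S" using that by simp
    from B[OF imageI[OF this]] show ?thesis by simp
  qed
  then show ?thesis using that[of "max B 0"] by simp
qed

lemma value_fun_le: "traj t c x z \<Longrightarrow> value_fun L \<phi> t x \<le> c + \<phi> z"
  unfolding value_fun_eq_traj by (rule INF_lower2[of "(c, z)"]) auto

lemma value_fun_less_iff: "value_fun L \<phi> t x < b \<longleftrightarrow> (\<exists>c z. traj t c x z \<and> c + \<phi> z < b)"
  unfolding value_fun_eq_traj INF_less_iff by auto

text \<open>One half of the dynamic programming principle. Arguing by contradiction supplies a
  strict inequality, which forces \<open>c\<close> to be finite and so allows it to be moved across
  in \<open>ennreal\<close>.\<close>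

lemma value_fun_concat:
  assumes "traj a c x y" "0 \<le> a" "0 \<le> b"
  shows "value_fun L \<phi> (a + b) x \<le> c + value_fun L \<phi> b y"
proof (rule ccontr)
  assume "\<not> ?thesis"
  then have less: "c + value_fun L \<phi> b y < value_fun L \<phi> (a + b) x" by simp
  then have "c \<noteq> \<infinity>" by (auto simp: top_unique)
  then obtain r where r: "c = ennreal r" "0 \<le> r" by (cases c) auto
  have "value_fun L \<phi> b y < value_fun L \<phi> (a + b) x - c"
    using less by (simp add: less_diff_eq_ennreal r(1) add.commute)
  then obtain c' z where z: "traj b c' y z" "c' + \<phi> z < value_fun L \<phi> (a + b) x - c"
    unfolding value_fun_less_iff by blast
  then have "c + c' + \<phi> z < value_fun L \<phi> (a + b) x"
    by (simp add: less_diff_eq_ennreal r(1) add_ac)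
  moreover have "value_fun L \<phi> (a + b) x \<le> c + c' + \<phi> z"
    by (intro value_fun_le traj_concat[OF assms(1) z(1) assms(2,3)])
  ultimately show False by simp
qed

text \<open>Pigeonhole by induction: if the first piece costs more than \<open>m\<close>, dropping
  it leaves a cost below \<open>m\<close> times the number of remaining pieces.\<close>

lemma traj_cheap_arc:
  assumes "traj (real N * \<eta>) c x z" "c < ennreal (real N * m)" "0 \<le> \<eta>" "0 \<le> m"
  shows "\<exists>a b c1 c2 c3 y1 y2. 0 \<le> a \<and> 0 \<le> b \<and> a + \<eta> + b = real N * \<eta> \<and>
    traj a c1 x y1 \<and> traj \<eta> c2 y1 y2 \<and> traj b c3 y2 z \<and> c = c1 + c2 + c3 \<and> c2 \<le> ennreal m"
  using assms(1,2)
proof (induction N arbitrary: c x)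
  case 0
  then show ?case by simp
next
  case (Suc N)
  have "traj (\<eta> + real N * \<eta>) c x z" using Suc.prems(1) by (simp add: algebra_simps)
  then obtain y c0 c' where y: "traj \<eta> c0 x y" "traj (real N * \<eta>) c' y z" and c: "c = c0 + c'"
    by (rule traj_split) (use assms in auto)
  show ?case
  proof (cases "c0 \<le> ennreal m")
    case True
    \<comment> \<open>Splitting at time 0 provides the empty arc in front; its cost
      \<open>d0\<close> is simply carried along.\<close>
    obtain w d0 d1 where w: "traj 0 d0 x w" "traj \<eta> d1 w y" "c0 = d0 + d1"
      using y(1) by (rule traj_split[where a = 0 and b = \<eta>, simplified]) (use assms in auto)
    have "d1 \<le> ennreal m" using True w(3) by (metis add.commute le_iff_add order_trans)
    moreover have "c = d0 + d1 + c'" using c w(3) by simp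
    moreover have "0 + \<eta> + real N * \<eta> = real (Suc N) * \<eta>" "0 \<le> real N * \<eta>"
      using assms(3) by (auto simp: algebra_simps)
    ultimately show ?thesis using w(1,2) y(2) order_refl[of "0::real"] by blast
  next
    case False
    have "ennreal m + c' \<le> c0 + c'" using False by (intro add_right_mono) simp
    also have "\<dots> < ennreal (m + real N * m)" using Suc.prems(2) c by (simp add: algebra_simps)
    also have "\<dots> = ennreal m + ennreal (real N * m)" using assms(4) by (intro ennreal_plus) auto
    finally have "c' < ennreal (real N * m)" by simp
    from Suc.IH[OF y(2) this] obtain a b c1 c2 c3 y1 y2 where IH: "0 \<le> a" "0 \<le> b" "a + \<eta> + b = real N * \<eta>"
      "traj a c1 y y1" "traj \<eta> c2 y1 y2" "traj b c3 y2 z" "c' = c1 + c2 + c3" "c2 \<le> ennreal m" by blast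
    have "traj (\<eta> + a) (c0 + c1) x y1" by (rule traj_concat[OF y(1) IH(4) assms(3) IH(1)])
    moreover have "c = (c0 + c1) + c2 + c3" unfolding c IH(7) by (simp only: add.assoc)
    moreover have "0 \<le> \<eta> + a" "\<eta> + a + \<eta> + b = real (Suc N) * \<eta>"
      using IH(1,3) assms(3) by (auto simp: algebra_simps)
    ultimately show ?thesis using IH(2,5,6,8) by blast
  qed
qed

text \<open>The hypothesis says that the Hamiltonian at \<open>(x, q)\<close> is at most
  \<open>m\<close>, so this is its upper semicontinuity in \<open>x\<close>. Velocities up to
  \<open>R\<close> are handled by uniform continuity; beyond \<open>R\<close>, coercivity with slope
  \<open>norm q + 1\<close> wins uniformly in \<open>x'\<close>.\<close>

lemma Hamiltonian_minorant_near:
  assumes min: "\<And>u. q \<bullet> u - m \<le> L x u" and \<epsilon>: "0 < \<epsilon>"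
  obtains \<rho> where "0 < \<rho>" "\<And>x' u. norm (x' - x) < \<rho> \<Longrightarrow> q \<bullet> u - (m + \<epsilon>) \<le> L x' u"
proof -
  obtain C where C: "0 \<le> C" "\<And>x u. (norm q + 1) * norm u - C \<le> L x u"
    using superlinear[of "norm q + 1"] by auto
  define R where "R = C + \<bar>m\<bar> + 1"
  obtain \<delta> where \<delta>: "0 < \<delta>" "\<And>y y' w. y \<in> cball x 1 \<Longrightarrow> y' \<in> cball x 1 \<Longrightarrow>
      norm w \<le> R \<Longrightarrow> norm (y' - y) < \<delta> \<Longrightarrow> \<bar>L y' w - L y w\<bar> < \<epsilon>"
    using uniformly_continuous_L[OF compact_cball \<epsilon>, of x 1 R] by blast
  have "q \<bullet> u - (m + \<epsilon>) \<le> L x' u" if x': "norm (x' - x) < min \<delta> 1" for x' u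
  proof (cases "norm u \<le> R")
    case True
    have "\<bar>L x' u - L x u\<bar> < \<epsilon>" using x' True by (intro \<delta>(2)) (auto simp: dist_norm norm_minus_commute)
    then show ?thesis using min[of u] by linarith
  next
    case False
    have "q \<bullet> u \<le> norm q * norm u" by (rule norm_cauchy_schwarz)
    moreover have "norm q * norm u + norm u - C \<le> L x' u" using C(2)[of u x'] by (simp add: algebra_simps)
    ultimately show ?thesis using False \<epsilon> by (simp add: R_def)
  qed
  then show ?thesis using that[of "min \<delta> 1"] \<delta>(1) by simp
qed

end

section \<open>Finiteness and local Lipschitz continuity of the value function\<close>

locale bolza = lagrangian L for L :: "'a::euclidean_space \<Rightarrow> 'a \<Rightarrow> real" +
  fixes \<phi> :: "'a \<Rightarrow> ennreal"
  assumes phi_lsc: "lower_semicont \<phi>" and phi_proper: "\<exists>x. \<phi> x \<noteq> \<infinity>"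
begin

abbreviation V :: "real \<times> 'a \<Rightarrow> real"
  where "V \<equiv> value_real L \<phi>"

lemma V_nonneg: "0 \<le> V z"
  by (simp add: value_real_def case_prod_beta)

text \<open>Go straight, at constant velocity, to a point where \<open>\<phi>\<close> is finite;
  durations bounded away from 0 keep the speed bounded.\<close>

lemma value_fun_bounded:
  assumes "0 < t1"
  obtains M where "\<And>t x. t1 \<le> t \<Longrightarrow> t \<le> t2 \<Longrightarrow> norm x \<le> R \<Longrightarrow> value_fun L \<phi> t x \<le> ennreal M"
proof -
  obtain x0 where "\<phi> x0 \<noteq> \<infinity>" using phi_proper by blast
  then obtain p where p: "\<phi> x0 = ennreal p" "0 \<le> p" by (cases "\<phi> x0") auto
  obtain B where B: "0 \<le> B" "\<And>w u. norm w \<le> max R (norm x0) \<Longrightarrow> norm u \<le> (norm x0 + R) / t1 \<Longrightarrow> L w u \<le> B"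
    using L_bounded by blast
  have "value_fun L \<phi> t x \<le> ennreal (t2 * B + p)" if t: "t1 \<le> t" "t \<le> t2" and x: "norm x \<le> R" for t x
  proof -
    define u where "u = (1 / t) *\<^sub>R (x0 - x)"
    have tpos: "0 < t" using assms t by simp
    have x0: "x + t *\<^sub>R u = x0" using tpos by (simp add: u_def)
    have "norm (x0 - x) \<le> norm x0 + R" using norm_triangle_ineq4[of x0 x] x by simp
    moreover from order_trans[OF norm_ge_zero this] have "0 \<le> norm x0 + R" .
    ultimately have "norm (x0 - x) / t \<le> (norm x0 + R) / t1"
      using assms t by (intro frac_le) auto
    then have u: "norm u \<le> (norm x0 + R) / t1" using tpos by (simp add: u_def)
    have Lb: "L (x + s *\<^sub>R u) u \<le> B" if s: "s \<in> {0..t}" for s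
    proof (rule B(2)[OF _ u])
      have "x + s *\<^sub>R u = (1 - s / t) *\<^sub>R x + (s / t) *\<^sub>R x0" by (simp add: u_def algebra_simps)
      then have "x + s *\<^sub>R u \<in> closed_segment x x0"
        unfolding in_segment using s tpos by (intro exI[of _ "s / t"]) auto
      moreover have "closed_segment x x0 \<subseteq> cball 0 (max R (norm x0))"
        by (rule closed_segment_subset) (use x in auto)
      ultimately show "norm (x + s *\<^sub>R u) \<le> max R (norm x0)" by auto
    qed
    obtain c where c: "traj t c x (x + t *\<^sub>R u)" "c \<le> ennreal (t * B)"
      using tpos Lb by (metis traj_line less_imp_le)
    have "value_fun L \<phi> t x \<le> c + \<phi> x0" using value_fun_le[OF c(1)] x0 by simp
    also have "\<dots> \<le> ennreal (t * B) + ennreal p" using c(2) p by (intro add_mono) auto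
    also have "\<dots> = ennreal (t * B + p)" using tpos B(1) p by simp
    also have "\<dots> \<le> ennreal (t2 * B + p)" using t B(1) by (intro ennreal_leI add_right_mono mult_right_mono) auto
    finally show ?thesis .
  qed
  then show ?thesis using that by blast
qed

lemma value_fun_finite: "0 < t \<Longrightarrow> value_fun L \<phi> t x < \<infinity>"
  using value_fun_bounded[of t t "norm x"] by (metis ennreal_less_top infinity_ennreal_def order_le_less_trans order_refl)

lemma ennreal_V: "0 < t \<Longrightarrow> ennreal (V (t, x)) = value_fun L \<phi> t x"
  using value_fun_finite[of t x] by (simp add: value_real_def ennreal_enn2real)

lemma V_le_traj:
  assumes "traj t c x z" "0 < t" "c + \<phi> z \<le> ennreal r" "0 \<le> r"
  shows "V (t, x) \<le> r"
  using value_fun_le[OF assms(1), of \<phi>] assms ennreal_V[OF assms(2), of x]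
  by (metis ennreal_le_iff order_trans)

text \<open>Dynamic programming along a segment in real numbers; both the spatial Lipschitz estimate
  and the subsolution property of \<open>V\<close> come from it.\<close>

lemma V_segment:
  assumes "0 < t" "0 \<le> d" "\<And>s. s \<in> {0..d} \<Longrightarrow> L (x + s *\<^sub>R u) u \<le> m"
  shows "V (t + d, x) \<le> d * m + V (t, x + d *\<^sub>R u)"
proof -
  have m: "0 \<le> m" using assms(3)[of 0] assms(2) nonneg[of x u] by simp
  obtain c where c: "traj d c x (x + d *\<^sub>R u)" "c \<le> ennreal (d * m)"
    using traj_line[OF assms(2,3)] by blast
  have "ennreal (V (t + d, x)) \<le> c + ennreal (V (t, x + d *\<^sub>R u))"
    using value_fun_concat[OF c(1) assms(2), of t \<phi>] assms by (simp add: ennreal_V add.commute)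
  also have "\<dots> \<le> ennreal (d * m) + ennreal (V (t, x + d *\<^sub>R u))"
    using c(2) by (rule add_right_mono)
  also have "\<dots> = ennreal (d * m + V (t, x + d *\<^sub>R u))"
    using m assms(2) V_nonneg by simp
  finally show ?thesis by (rule ennreal_le_realD) (use m assms(2) V_nonneg in simp)
qed

lemma V_near_optimal:
  assumes "0 < t" "0 < \<epsilon>"
  obtains c z where "traj t c x z" "c + \<phi> z < ennreal (V (t, x) + \<epsilon>)"
proof -
  have "value_fun L \<phi> t x < ennreal (V (t, x) + \<epsilon>)"
    using assms V_nonneg[of "(t, x)"] by (simp add: ennreal_V[symmetric] ennreal_lessI)
  then show ?thesis using that unfolding value_fun_less_iff by blast
qed

text \<open>The other half of dynamic programming, with an \<open>\<epsilon>\<close> because a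
  near-optimal curve takes the place of a minimizer.\<close>

lemma V_split:
  assumes h: "0 < h" "h < t" and \<epsilon>: "0 < \<epsilon>"
  obtains c y where "0 \<le> c" "traj h (ennreal c) x y" "c + V (t - h, y) \<le> V (t, x) + \<epsilon>"
proof -
  obtain c z where c: "traj t c x z" "c + \<phi> z < ennreal (V (t, x) + \<epsilon>)"
    using V_near_optimal[of t \<epsilon> x] h \<epsilon> by auto
  have "traj (h + (t - h)) c x z" using c(1) by simp
  then obtain y c1 c2 where y: "traj h c1 x y" "traj (t - h) c2 y z" "c = c1 + c2"
    by (rule traj_split) (use h in auto)
  have "c1 + value_fun L \<phi> (t - h) y \<le> c1 + (c2 + \<phi> z)"
    by (intro add_left_mono value_fun_le y)
  also have "\<dots> < ennreal (V (t, x) + \<epsilon>)" using c(2) y(3) by (simp add: add.assoc)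
  finally have less: "c1 + ennreal (V (t - h, y)) < ennreal (V (t, x) + \<epsilon>)"
    using h by (simp add: ennreal_V)
  then have "c1 \<noteq> \<infinity>" by (auto simp: top_unique)
  then obtain r where r: "c1 = ennreal r" "0 \<le> r" by (cases c1) auto
  have "r + V (t - h, y) \<le> V (t, x) + \<epsilon>"
    using less r V_nonneg \<epsilon> by (simp add: V_nonneg flip: ennreal_plus) (metis add_nonneg_nonneg V_nonneg ennreal_less_iff less_imp_le)
  then show ?thesis using that r y(1) by blast
qed

text \<open>No reparametrization of the near-optimal curve is needed: by the pigeonhole principle it has a
  cheap subarc of duration comparable with \<open>\<bar>t' - t\<bar>\<close>, which is replaced by a straight segment.\<close>

lemma V_time_lipschitz:
  assumes t: "0 < t" and \<Delta>: "\<bar>t' - t\<bar> \<le> t / 4" and M: "V (t, x) < M"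
    and C1: "0 \<le> C1" "\<And>x u. norm u - C1 \<le> L x u"
    and B: "\<And>w u. norm w \<le> R \<Longrightarrow> norm u \<le> S \<Longrightarrow> L w u \<le> B"
    and R: "norm x + M + C1 * t \<le> R" and S: "2 * (M / t + C1) \<le> S"
  shows "V (t', x) \<le> V (t, x) + 6 * B * \<bar>t' - t\<bar>"
proof (cases "t' = t")
  case False
  define \<Delta> where "\<Delta> = \<bar>t' - t\<bar>"
  have t'0: "0 < t'" using \<Delta> t by linarith
  have D: "0 < \<Delta>" "\<Delta> \<le> t / 4" using False \<Delta> by (auto simp: \<Delta>_def)
  have M0: "0 < M" using M V_nonneg[of "(t, x)"] by linarith
  \<comment> \<open>About as many pieces as have length \<open>2 * \<Delta>\<close>. Rounding leaves
    their length \<open>\<eta>\<close> between \<open>2 * \<Delta>\<close> and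
    \<open>4 * \<Delta>\<close>, so a change of duration by \<open>\<Delta>\<close> keeps at least
    half of a piece.\<close>
  define N where "N = nat \<lfloor>t / (2 * \<Delta>)\<rfloor>"
  have q: "2 \<le> t / (2 * \<Delta>)" using D by (simp add: field_simps)
  then have "real N = of_int \<lfloor>t / (2 * \<Delta>)\<rfloor>" by (simp add: N_def)
  then have N: "real N \<le> t / (2 * \<Delta>)" "t / (2 * \<Delta>) < real N + 1" by linarith+
  then have N1: "1 < real N" "t / (4 * \<Delta>) \<le> real N" using q by (auto simp: field_simps)
  define \<eta> where "\<eta> = t / real N"
  have N\<eta>: "real N * \<eta> = t" using N1 by (simp add: \<eta>_def)
  have \<eta>: "2 * \<Delta> \<le> \<eta>" "\<eta> \<le> 4 * \<Delta>" "0 < \<eta>"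
    using N N1 D t by (auto simp: \<eta>_def field_simps)
  define m where "m = M / real N"
  have m: "real N * m = M" "0 \<le> m" "m / \<eta> = M / t" using N1 M0 t by (auto simp: m_def \<eta>_def)
  have B0: "0 \<le> B"
  proof -
    have "norm x \<le> R" using R M0 C1(1) t mult_nonneg_nonneg[of C1 t] by linarith
    moreover have "0 \<le> S" using S M0 t C1(1) by (smt (verit) divide_nonneg_pos)
    ultimately show ?thesis using B[of x 0] nonneg[of x 0] by simp
  qed
  have "V (t', x) \<le> V (t, x) + 6 * B * \<Delta> + \<epsilon>" if "0 < \<epsilon>" for \<epsilon>
  proof -
    define e where "e = min \<epsilon> (M - V (t, x))"
    have e: "0 < e" "e \<le> \<epsilon>" "V (t, x) + e \<le> M" using that M by (auto simp: e_def)
    obtain c z where c: "traj t c x z" "c + \<phi> z < ennreal (V (t, x) + e)"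
      using V_near_optimal[OF t e(1)] by blast
    have "c \<le> c + \<phi> z" by simp
    also note c(2)
    also have "ennreal (V (t, x) + e) \<le> ennreal M" using e(3) by (rule ennreal_leI)
    finally have cM: "c < ennreal M" .
    obtain a b c1 c2 c3 y1 y2 where arc: "0 \<le> a" "0 \<le> b" "a + \<eta> + b = t"
      "traj a c1 x y1" "traj \<eta> c2 y1 y2" "traj b c3 y2 z" "c = c1 + c2 + c3" "c2 \<le> ennreal m"
      using traj_cheap_arc[of N \<eta> c x z m] c(1) cM \<eta>(3) m(2) unfolding N\<eta> m(1) by auto
    have pos: "norm (y - x) \<le> M + C1 * t" if "traj T d x y" "0 \<le> T" "T \<le> t" "d \<le> c" for T d y
    proof -
      have "ennreal (1 * norm (y - x) - C1 * T) \<le> d"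
        by (rule traj_ge_norm[OF that(1,2)]) (use C1 in auto)
      also have "d \<le> ennreal M" using that(4) cM by simp
      finally have "norm (y - x) - C1 * T \<le> M" using M0 by (simp add: ennreal_le_iff)
      moreover have "C1 * T \<le> C1 * t" using that C1(1) by (intro mult_left_mono) auto
      ultimately show ?thesis by simp
    qed
    have y1: "norm (y1 - x) \<le> M + C1 * t"
      using arc \<eta>(3) by (intro pos[OF arc(4)]) (auto simp: add_ac)
    have y2: "norm (y2 - x) \<le> M + C1 * t"
      using arc \<eta>(3) by (intro pos[OF traj_concat[OF arc(4,5)]]) auto
    have "ennreal (1 * norm (y2 - y1) - C1 * \<eta>) \<le> c2"
      by (rule traj_ge_norm[OF arc(5)]) (use C1 \<eta> in auto)
    also note arc(8)
    finally have y12: "norm (y2 - y1) \<le> m + C1 * \<eta>" using m(2) by (simp add: ennreal_le_iff)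
    define \<eta>' where "\<eta>' = \<eta> + (t' - t)"
    have \<eta>': "\<eta> / 2 \<le> \<eta>'" "\<eta>' \<le> 6 * \<Delta>" "0 < \<eta>'"
      using \<eta> unfolding \<eta>'_def \<Delta>_def by (auto simp: abs_if split: if_splits)
    define w where "w = (1 / \<eta>') *\<^sub>R (y2 - y1)"
    have yw: "y1 + \<eta>' *\<^sub>R w = y2" using \<eta>'(3) by (simp add: w_def)
    \<comment> \<open>The replaced arc has at most the average cost \<open>m\<close>, hence moves at
      most \<open>m + C1 * \<eta>\<close>. Its mean speed is thus bounded independently of
      \<open>\<Delta>\<close>, which is what the hypothesis on \<open>S\<close> encodes.\<close>
    have "norm (y2 - y1) / \<eta>' \<le> (m + C1 * \<eta>) / (\<eta> / 2)"
      using y12 \<eta>' \<eta> m(2) C1(1) by (intro frac_le) auto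
    also have "\<dots> = 2 * (m / \<eta> + C1)" using \<eta>(3) by (simp add: field_simps)
    finally have nw: "norm w \<le> S" using \<eta>'(3) S m(3) by (simp add: w_def)
    have "L (y1 + s *\<^sub>R w) w \<le> B" if s: "s \<in> {0..\<eta>'}" for s
    proof (rule B[OF _ nw])
      have "y1 + s *\<^sub>R w = (1 - s / \<eta>') *\<^sub>R y1 + (s / \<eta>') *\<^sub>R y2" by (simp add: w_def algebra_simps)
      then have "y1 + s *\<^sub>R w \<in> closed_segment y1 y2"
        unfolding in_segment using s \<eta>'(3) by (intro exI[of _ "s / \<eta>'"]) auto
      moreover have "closed_segment y1 y2 \<subseteq> cball x (M + C1 * t)"
        by (rule closed_segment_subset) (use y1 y2 in \<open>auto simp: dist_norm norm_minus_commute\<close>)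
      ultimately have "norm (y1 + s *\<^sub>R w - x) \<le> M + C1 * t" by (auto simp: dist_norm norm_minus_commute)
      then show "norm (y1 + s *\<^sub>R w) \<le> R" using R norm_triangle_sub[of "y1 + s *\<^sub>R w" x] by linarith
    qed
    then obtain c' where c': "traj \<eta>' c' y1 y2" "c' \<le> ennreal (\<eta>' * B)"
      using traj_line[of \<eta>' y1 w B] \<eta>'(3) yw by (metis less_imp_le)
    have "traj (a + \<eta>' + b) (c1 + c' + c3) x z"
      using arc \<eta>'(3) by (intro traj_concat[OF traj_concat[OF arc(4) c'(1)] arc(6)]) auto
    moreover have "a + \<eta>' + b = t'" using arc(3) by (simp add: \<eta>'_def)
    ultimately have tr: "traj t' (c1 + c' + c3) x z" by simp
    \<comment> \<open>The cost \<open>c2\<close> of the removed arc is not credited; only the new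
      segment, of duration at most \<open>6 * \<Delta>\<close>, adds to the bound.\<close>
    have "c1 + c' + c3 + \<phi> z \<le> c' + (c + \<phi> z)"
      unfolding arc(7) by (simp add: add_ac add_left_mono)
    also have "\<dots> \<le> ennreal (6 * \<Delta> * B) + ennreal (V (t, x) + e)"
    proof (intro add_mono)
      have "\<eta>' * B \<le> 6 * \<Delta> * B" using \<eta>'(2) B0 by (rule mult_right_mono)
      then show "c' \<le> ennreal (6 * \<Delta> * B)" using c'(2) ennreal_leI order_trans by blast
    qed (use c(2) in simp)
    also have "\<dots> = ennreal (6 * \<Delta> * B + (V (t, x) + e))"
      using D B0 V_nonneg[of "(t, x)"] e by (intro ennreal_plus[symmetric]) auto
    finally have "V (t', x) \<le> 6 * \<Delta> * B + (V (t, x) + e)"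
      by (rule V_le_traj[OF tr t'0]) (use D B0 V_nonneg[of "(t, x)"] e in auto)
    then show ?thesis using e(2) by (simp add: mult_ac)
  qed
  then show ?thesis unfolding \<Delta>_def by (rule field_le_epsilon)
qed simp

text \<open>A segment of unit speed changes the position at the price of a time \<open>r\<close>,
  and \<open>V_time_lipschitz\<close> then corrects the time.\<close>

lemma V_locally_lipschitz: "locally_lipschitz_on pos_times V"
  unfolding locally_lipschitz_on_def
proof
  fix z0 :: "real \<times> 'a" assume "z0 \<in> pos_times"
  then obtain t0 x0 where z0: "z0 = (t0, x0)" and t0: "0 < t0" by (cases z0) auto
  \<comment> \<open>Two times in the ball differ by less than \<open>2 * e\<close> and the segment
    takes less than \<open>2 * e\<close>; the total stays below \<open>t / 4\<close> and
    \<open>t' - r\<close> stays positive.\<close>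
  define e where "e = t0 / 32"
  have e: "0 < e" "32 * e = t0" using t0 by (auto simp: e_def)
  obtain M where M: "\<And>t x. t0 / 2 \<le> t \<Longrightarrow> t \<le> 2 * t0 \<Longrightarrow> norm x \<le> norm x0 + e \<Longrightarrow> value_fun L \<phi> t x \<le> ennreal M"
    using value_fun_bounded[of "t0 / 2"] t0 by (metis half_gt_zero)
  define M' where "M' = max M 0 + 1"
  have VM: "V (t, x) < M'" if "t0 / 2 \<le> t" "t \<le> 2 * t0" "norm x \<le> norm x0 + e" for t x
  proof -
    have "ennreal (V (t, x)) \<le> ennreal (max M 0)"
      using M[OF that] ennreal_V[of t x] that t0 by (simp add: ennreal_leI max_def order_trans)
    then have "V (t, x) \<le> max M 0" by (rule ennreal_le_realD) simp
    then show ?thesis by (simp add: M'_def)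
  qed
  have M'0: "0 < M'" by (simp add: M'_def)
  obtain C1 where C1: "0 \<le> C1" "\<And>x u. norm u - C1 \<le> L x u"
    using superlinear[of 1] by auto
  define R where "R = norm x0 + e + M' + C1 * (2 * t0)"
  \<comment> \<open>The speed bound demanded by \<open>V_time_lipschitz\<close> for times above
    \<open>t0 / 2\<close>; the added 1 makes \<open>B\<close> valid for segments of unit speed
    too.\<close>
  define S where "S = 2 * (M' / (t0 / 2) + C1) + 1"
  obtain B where B: "0 \<le> B" "\<And>w u. norm w \<le> R \<Longrightarrow> norm u \<le> S \<Longrightarrow> L w u \<le> B"
    using L_bounded by blast
  have S1: "1 \<le> S" using M'0 C1(1) t0 by (simp add: S_def)
  have le: "V (t', x') \<le> V (t, x) + 13 * B * dist (t', x') (t, x)"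
    if z: "(t, x) \<in> ball z0 e" and z': "(t', x') \<in> ball z0 e" for t x t' x'
  proof -
    have "dist t0 t < e" "dist x0 x < e" "dist t0 t' < e" "dist x0 x' < e"
      using z z' order_le_less_trans[OF dist_fst_le] order_le_less_trans[OF dist_snd_le]
      unfolding z0 mem_ball by (metis fst_conv snd_conv)+
    then have d: "\<bar>t - t0\<bar> < e" "\<bar>t' - t0\<bar> < e" "norm (x - x0) < e" "norm (x' - x0) < e"
      by (auto simp: dist_norm norm_minus_commute abs_minus_commute)
    have nx: "norm x \<le> norm x0 + e" "norm x' \<le> norm x0 + e"
      using d norm_triangle_sub[of x x0] norm_triangle_sub[of x' x0] by linarith+
    define r where "r = norm (x - x')"
    have r: "0 \<le> r" "r < 2 * e"
      using d(3,4) norm_triangle_ineq4[of "x - x0" "x' - x0"] by (auto simp: r_def)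
    have M'R: "M' \<le> R" "norm x0 + e \<le> R" using e M'0 C1 t0 by (auto simp: R_def)
    define u where "u = (1 / r) *\<^sub>R (x - x')"
    have u: "norm u \<le> 1" "x' + r *\<^sub>R u = x" by (cases "r = 0"; simp add: u_def r_def)+
    have "V ((t' - r) + r, x') \<le> r * B + V (t' - r, x' + r *\<^sub>R u)"
    proof (rule V_segment)
      show "0 < t' - r" using d e r by linarith
      fix s assume s: "s \<in> {0..r}"
      have "x' + s *\<^sub>R u \<in> closed_segment x' x"
      proof (cases "r = 0")
        case False
        then have "x' + s *\<^sub>R u = (1 - s / r) *\<^sub>R x' + (s / r) *\<^sub>R x" by (simp add: u_def algebra_simps)
        moreover have "0 \<le> s / r" "s / r \<le> 1" using s r(1) False by auto
        ultimately show ?thesis unfolding in_segment by blast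
      qed (use s in \<open>auto simp: u_def\<close>)
      moreover have "closed_segment x' x \<subseteq> cball 0 R"
        by (rule closed_segment_subset) (use nx M'R in auto)
      ultimately show "L (x' + s *\<^sub>R u) u \<le> B" using u(1) S1 by (intro B(2)) auto
    qed (use r in simp)
    moreover have "V (t' - r, x) \<le> V (t, x) + 6 * B * \<bar>t' - r - t\<bar>"
    proof (rule V_time_lipschitz[OF _ _ _ C1 B(2)])
      show "0 < t" "\<bar>t' - r - t\<bar> \<le> t / 4" using d e r by linarith+
      show "V (t, x) < M'" using d e nx by (intro VM) linarith+
      have "C1 * t \<le> C1 * (2 * t0)" using d e C1(1) by (intro mult_left_mono) linarith+
      then show "norm x + M' + C1 * t \<le> R" using nx by (simp add: R_def)
      have "M' / t \<le> M' / (t0 / 2)" using d e t0 M'0 by (intro divide_left_mono) auto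
      then show "2 * (M' / t + C1) \<le> S" by (simp add: S_def)
    qed
    moreover have "6 * B * \<bar>t' - r - t\<bar> \<le> 6 * B * (\<bar>t' - t\<bar> + r)" using B(1) r by (intro mult_left_mono) auto
    ultimately have "V (t', x') \<le> V (t, x) + r * B + 6 * B * (\<bar>t' - t\<bar> + r)" by (simp add: u(2))
    also have "\<dots> = V (t, x) + B * (7 * r + 6 * \<bar>t' - t\<bar>)" by (simp add: algebra_simps)
    also have "\<dots> \<le> V (t, x) + B * (13 * dist (t', x') (t, x))"
    proof -
      have "r \<le> dist (t', x') (t, x)" "\<bar>t' - t\<bar> \<le> dist (t', x') (t, x)"
        using dist_snd_le[of "(t', x')" "(t, x)"] dist_fst_le[of "(t', x')" "(t, x)"]
        by (auto simp: r_def dist_norm norm_minus_commute)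
      then show ?thesis using B(1) by (intro add_left_mono mult_left_mono) auto
    qed
    finally show ?thesis by (simp add: mult_ac)
  qed
  have "(13 * B)-lipschitz_on (ball z0 e \<inter> pos_times) V"
  proof (rule lipschitz_onI)
    fix z z' assume "z \<in> ball z0 e \<inter> pos_times" "z' \<in> ball z0 e \<inter> pos_times"
    then show "dist (V z) (V z') \<le> 13 * B * dist z z'"
      using le[of "fst z" "snd z" "fst z'" "snd z'"] le[of "fst z'" "snd z'" "fst z" "snd z"]
      by (auto simp: dist_real_def abs_le_iff dist_commute)
  qed (use B in simp)
  then show "\<exists>e>0. \<exists>C. C-lipschitz_on (ball z0 e \<inter> pos_times) V" using e(1) by blast
qed

section \<open>The equation and the initial condition for the value function\<close>

text \<open>Test the subgradient at \<open>(t + h, x - h *\<^sub>R u)\<close>: a segment of velocity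
  \<open>u\<close> leads from there to \<open>x\<close> with time \<open>t\<close> left, so
  \<open>V_segment\<close> bounds \<open>V\<close> from above where the subgradient bounds it from
  below. Division by \<open>h\<close> gives the claim.\<close>

lemma V_subsolution: "subsolution V"
  unfolding subsolution_def
proof safe
  fix t x p\<^sub>t p\<^sub>x and u :: 'a
  assume t: "(0::real) < t" and p: "(p\<^sub>t, p\<^sub>x) \<in> subdiff V (t, x)"
  have "p\<^sub>t - p\<^sub>x \<bullet> u \<le> L x u + \<epsilon>" if "0 < \<epsilon>" for \<epsilon>
  proof -
    define n where "n = norm (1::real, - u)"
    define e where "e = \<epsilon> / (n + 1)"
    have n: "0 \<le> n" by (simp add: n_def)
    have e: "0 < e" using that n by (simp add: e_def)
    have "e * (n + 1) = \<epsilon>" unfolding e_def using n by (intro nonzero_eq_divide_eq[THEN iffD1]) auto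
    then have en: "e + e * n = \<epsilon>" by (simp add: algebra_simps)
    obtain \<delta> where \<delta>: "0 < \<delta>" "\<And>z'. dist z' (t, x) < \<delta> \<Longrightarrow>
        V (t, x) + (p\<^sub>t, p\<^sub>x) \<bullet> (z' - (t, x)) - e * norm (z' - (t, x)) \<le> V z'"
      using p e unfolding subdiff_iff by blast
    obtain \<delta>' where \<delta>': "0 < \<delta>'" "\<And>y y' w. y \<in> cball x 1 \<Longrightarrow> y' \<in> cball x 1 \<Longrightarrow> norm w \<le> norm u \<Longrightarrow>
        norm (y' - y) < \<delta>' \<Longrightarrow> \<bar>L y' w - L y w\<bar> < e"
      using uniformly_continuous_L[OF compact_cball e, of x 1 "norm u"] by blast
    define h where "h = min \<delta> (min \<delta>' 1) / (2 * (n + norm u + 1))"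
    have nu: "0 < 2 * (n + norm u + 1)" using n by (simp add: add_nonneg_pos)
    have h: "0 < h" using \<delta>(1) \<delta>'(1) nu by (simp add: h_def)
    have "h * (2 * (n + norm u + 1)) = min \<delta> (min \<delta>' 1)"
      unfolding h_def using nu by (intro nonzero_eq_divide_eq[THEN iffD1]) auto
    then have "2 * (h * n) + 2 * (h * norm u) + 2 * h = min \<delta> (min \<delta>' 1)" by (simp add: algebra_simps)
    moreover have "0 \<le> h * n" "0 \<le> h * norm u" using h n by auto
    ultimately have hn: "h * n < \<delta>" "h * norm u < \<delta>'" "h * norm u < 1" using h by linarith+
    have "V (t + h, x - h *\<^sub>R u) \<le> h * (L x u + e) + V (t, x - h *\<^sub>R u + h *\<^sub>R u)"
    proof (rule V_segment[OF t])
      fix s assume s: "s \<in> {0..h}"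
      have "x - h *\<^sub>R u + s *\<^sub>R u - x = - ((h - s) *\<^sub>R u)" by (simp add: algebra_simps)
      then have "norm (x - h *\<^sub>R u + s *\<^sub>R u - x) = (h - s) * norm u" using s by simp
      also have "\<dots> \<le> h * norm u" using s by (intro mult_right_mono) auto
      finally have nn: "norm (x - h *\<^sub>R u + s *\<^sub>R u - x) \<le> h * norm u" .
      have "\<bar>L (x - h *\<^sub>R u + s *\<^sub>R u) u - L x u\<bar> < e"
      proof (rule \<delta>'(2))
        have "dist x (x - h *\<^sub>R u + s *\<^sub>R u) < 1"
          using nn hn(3) unfolding dist_norm by (subst norm_minus_commute) linarith
        then show "x - h *\<^sub>R u + s *\<^sub>R u \<in> cball x 1" by simp
        show "norm (x - h *\<^sub>R u + s *\<^sub>R u - x) < \<delta>'" using nn hn(2) by linarith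
      qed auto
      then show "L (x - h *\<^sub>R u + s *\<^sub>R u) u \<le> L x u + e" by simp
    qed (use h in simp)
    then have up: "V (t + h, x - h *\<^sub>R u) \<le> h * (L x u + e) + V (t, x)" by simp
    have diff: "(t + h, x - h *\<^sub>R u) - (t, x) = h *\<^sub>R (1, - u)" by simp
    have nd: "norm (h *\<^sub>R (1::real, - u)) = h * n" using h unfolding n_def by (subst norm_scaleR) simp
    have "V (t, x) + (p\<^sub>t, p\<^sub>x) \<bullet> (h *\<^sub>R (1, - u)) - e * (h * n) \<le> V (t + h, x - h *\<^sub>R u)"
      using \<delta>(2)[of "(t + h, x - h *\<^sub>R u)"] hn(1) unfolding dist_norm diff nd by simp
    then have "h * (p\<^sub>t - p\<^sub>x \<bullet> u) \<le> h * (L x u + e + e * n)"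
      using up by (simp add: inner_Pair algebra_simps)
    then show ?thesis using h en by (simp add: add.assoc)
  qed
  then show "p\<^sub>t - p\<^sub>x \<bullet> u \<le> L x u" by (rule field_le_epsilon)
qed

text \<open>If the claim failed, the Hamiltonian at \<open>(x, - p\<^sub>x)\<close> would be at most
  \<open>- p\<^sub>t - \<epsilon>\<close>, and nearby at most
  \<open>- p\<^sub>t - \<epsilon> / 2\<close>. Integrated along a near-optimal curve over a short
  time \<open>h\<close>, this makes the cost exceed what the subgradient inequality allows. The
  error there involves \<open>norm (y - x)\<close>, which must first be shown to be of order
  \<open>h\<close>.\<close>

lemma V_supersolution: "supersolution V"
  unfolding supersolution_def
proof safe
  fix t x p\<^sub>t p\<^sub>x and \<epsilon> :: real
  assume t: "0 < t" and p: "(p\<^sub>t, p\<^sub>x) \<in> subdiff V (t, x)" and \<epsilon>: "0 < \<epsilon>"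
  show "\<exists>u. L x u < p\<^sub>t - p\<^sub>x \<bullet> u + \<epsilon>"
  proof (rule ccontr)
    assume "\<nexists>u. L x u < p\<^sub>t - p\<^sub>x \<bullet> u + \<epsilon>"
    then have "- p\<^sub>x \<bullet> u - (- (p\<^sub>t + \<epsilon>)) \<le> L x u" for u by (simp add: not_less algebra_simps)
    then obtain \<rho> where \<rho>: "0 < \<rho>" "\<And>x' u. norm (x' - x) < \<rho> \<Longrightarrow> - p\<^sub>x \<bullet> u - (- (p\<^sub>t + \<epsilon>) + \<epsilon> / 2) \<le> L x' u"
      using Hamiltonian_minorant_near[of "- p\<^sub>x" "- (p\<^sub>t + \<epsilon>)" x "\<epsilon> / 2"] \<epsilon> by (metis half_gt_zero)
    \<comment> \<open>Of this slope, \<open>norm p\<^sub>x\<close> absorbs the linear term and one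
      unit the error term, as \<open>e \<le> 1\<close>; the last unit gives
      \<open>norm (y - x) \<le> h * A\<close>.\<close>
    define K where "K = norm p\<^sub>x + 2"
    obtain C where C: "0 \<le> C" "\<And>x u. K * norm u - C \<le> L x u" using superlinear[of K] by auto
    define A where "A = C + \<bar>p\<^sub>t\<bar> + 1 + \<epsilon> / 8"
    have A: "0 < A" using C \<epsilon> by (simp add: A_def)
    define e where "e = min 1 (\<epsilon> / (8 * (1 + A)))"
    have e: "0 < e" "e \<le> 1" using A \<epsilon> by (auto simp: e_def)
    have eA: "e * (1 + A) \<le> \<epsilon> / 8"
    proof -
      have "e \<le> \<epsilon> / 8 / (1 + A)" by (simp add: e_def)
      moreover have "0 < 1 + A" using A by simp
      ultimately show ?thesis using pos_le_divide_eq by blast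
    qed
    obtain \<delta> where \<delta>: "0 < \<delta>" "\<And>z'. dist z' (t, x) < \<delta> \<Longrightarrow>
        V (t, x) + (p\<^sub>t, p\<^sub>x) \<bullet> (z' - (t, x)) - e * norm (z' - (t, x)) \<le> V z'"
      using p e(1) unfolding subdiff_iff by blast
    define r where "r = min \<rho> (\<delta> / 2)"
    have r: "0 < r" "r \<le> \<rho>" "r \<le> \<delta> / 2" using \<rho> \<delta> by (auto simp: r_def)
    define M where "M = V (t, x) + \<epsilon>"
    have M: "0 \<le> M" using V_nonneg \<epsilon> by (simp add: M_def)
    \<comment> \<open>A second slope, large enough that a curve of cost at most \<open>M\<close> and
      duration \<open>h\<close> with \<open>C2 * h \<le> 1\<close> stays within \<open>r\<close> of
      \<open>x\<close>.\<close>
    define K2 where "K2 = (M + 2) / r"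
    have K2: "0 < K2" "K2 * r = M + 2" using M r by (auto simp: K2_def)
    obtain C2 where C2: "0 \<le> C2" "\<And>x u. K2 * norm u - C2 \<le> L x u" using superlinear[of K2] by auto
    define h where "h = min (1 / (C2 + 1)) (min (min (t / 2) (\<delta> / 2)) 1) / 2"
    have hpos: "0 < h" using C2 t \<delta> by (simp add: h_def)
    have h: "h < t" "h < \<delta> / 2" "h \<le> 1" using C2 t \<delta> by (auto simp: h_def min_less_iff_disj)
    have C2h: "C2 * h \<le> 1"
    proof -
      have "2 * h \<le> 1 / (C2 + 1)" by (simp add: h_def)
      then have "h \<le> 1 / (C2 + 1)" using hpos by linarith
      moreover have "0 < C2 + 1" using C2(1) by simp
      ultimately have "h * (C2 + 1) \<le> 1" using pos_le_divide_eq by blast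
      then show ?thesis using hpos by (simp add: algebra_simps)
    qed
    \<comment> \<open>The suboptimality must be proportional to \<open>h\<close> to survive the
      comparison of terms of order \<open>h\<close>.\<close>
    obtain c y where c: "0 \<le> c" "traj h (ennreal c) x y" "c + V (t - h, y) \<le> V (t, x) + h * (\<epsilon> / 8)"
      using V_split[OF hpos h(1), of "h * (\<epsilon> / 8)" x] hpos \<epsilon> by auto
    have cM: "c \<le> M"
    proof -
      have "h * (\<epsilon> / 8) \<le> 1 * (\<epsilon> / 8)" using h(3) \<epsilon> by (intro mult_right_mono) auto
      then show ?thesis using c(3) V_nonneg[of "(t - h, y)"] \<epsilon> unfolding M_def by linarith
    qed
    have "K2 * norm (y - x) - C2 * h \<le> c"
      using traj_ge_norm[OF c(2) _ _ C2(2)] K2 hpos c(1) by (simp add: ennreal_le_iff)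
    then have "K2 * norm (y - x) < K2 * r" using cM C2h K2(2) by linarith
    then have yx: "norm (y - x) < r" using K2(1) by (simp add: mult_less_cancel_left)
    have diff: "(t - h, y) - (t, x) = (- h, y - x)" by simp
    have nd: "norm (- h, y - x) \<le> h + norm (y - x)"
      using norm_Pair_le[of "- h" "y - x"] hpos by simp
    have "dist (t - h, y) (t, x) < \<delta>" unfolding dist_norm diff using nd h(2) yx r(3) by linarith
    from \<delta>(2)[OF this] have "V (t, x) + (p\<^sub>t, p\<^sub>x) \<bullet> (- h, y - x) - e * norm (- h, y - x) \<le> V (t - h, y)"
      unfolding diff .
    moreover have "e * norm (- h, y - x) \<le> e * (h + norm (y - x))" using e nd by (intro mult_left_mono) auto
    ultimately have low: "V (t, x) - h * p\<^sub>t + p\<^sub>x \<bullet> (y - x) - e * (h + norm (y - x)) \<le> V (t - h, y)"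
      by (simp add: inner_Pair mult.commute)
    have cup: "c \<le> h * p\<^sub>t - p\<^sub>x \<bullet> (y - x) + e * (h + norm (y - x)) + h * (\<epsilon> / 8)"
      using low c(3) by linarith
    have "K * norm (y - x) - C * h \<le> c"
      using traj_ge_norm[OF c(2) _ _ C(2)] hpos c(1) by (simp add: ennreal_le_iff K_def)
    moreover have "- (p\<^sub>x \<bullet> (y - x)) \<le> norm p\<^sub>x * norm (y - x)"
      using norm_cauchy_schwarz[of "- p\<^sub>x" "y - x"] by simp
    moreover have "h * p\<^sub>t \<le> h * \<bar>p\<^sub>t\<bar>" using hpos by (intro mult_left_mono) auto
    moreover have "e * (h + norm (y - x)) \<le> 1 * (h + norm (y - x))"
      using e(2) hpos by (intro mult_right_mono) auto
    ultimately have "norm (y - x) \<le> h * A"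
      using cup by (simp add: A_def K_def algebra_simps)
    then have "e * (h + norm (y - x)) \<le> e * (h + h * A)" using e by (intro mult_left_mono) auto
    also have "\<dots> = h * (e * (1 + A))" by (simp add: algebra_simps)
    also have "\<dots> \<le> h * (\<epsilon> / 8)" using eA hpos by (intro mult_left_mono) auto
    finally have small: "e * (h + norm (y - x)) \<le> h * (\<epsilon> / 8)" .
    have "ennreal (- p\<^sub>x \<bullet> (y - x) - (- (p\<^sub>t + \<epsilon>) + \<epsilon> / 2) * h) \<le> ennreal c"
    proof (rule traj_ge_linear[OF c(2) _ _ _ C2(2)])
      show "M + C2 * h < K2 * r" using C2h K2(2) by simp
      show "- p\<^sub>x \<bullet> w - (- (p\<^sub>t + \<epsilon>) + \<epsilon> / 2) \<le> L x' w" if "norm (x' - x) < r" for x' w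
        using that r(2) by (intro \<rho>(2)) simp
    qed (use hpos K2 M cM in \<open>auto intro: ennreal_leI\<close>)
    then have "- p\<^sub>x \<bullet> (y - x) - (- (p\<^sub>t + \<epsilon>) + \<epsilon> / 2) * h \<le> c" using c(1) by (rule ennreal_le_realD)
    \<comment> \<open>The gap between the two bounds on \<open>c\<close> is
      \<open>h * (\<epsilon> / 2)\<close>, the errors add up to half of it.\<close>
    then have "h * (\<epsilon> / 2) \<le> h * (\<epsilon> / 8) + h * (\<epsilon> / 8)"
      using cup small by (simp add: algebra_simps)
    then show False using hpos \<epsilon> by simp
  qed
qed

text \<open>Lower half: a curve of bounded cost moves little in a short time, so it ends where
  semicontinuity keeps \<open>\<phi>\<close> large. Upper half: waiting at \<open>x\<close> costs
  little in a short time.\<close>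

lemma V_initial_condition: "initial_condition \<phi> V"
  unfolding initial_condition_iff
proof (intro allI conjI impI)
  fix x :: 'a and a :: ennreal assume "a < \<phi> x"
  then obtain b where b: "a < b" "b < \<phi> x" using dense by blast
  then have "b \<noteq> \<infinity>" by (auto simp: top_unique)
  then obtain r where r: "b = ennreal r" "0 \<le> r" by (cases b) auto
  have "\<phi> x \<le> Liminf (at x) \<phi>" using phi_lsc by (simp add: lower_semicont_def)
  then have "\<forall>\<^sub>F z in at x. b < \<phi> z" using b(2) less_LiminfD less_le_trans by metis
  \<comment> \<open>The punctured filter says nothing about \<open>x\<close> itself, where
    \<open>b < \<phi> x\<close> is used.\<close>
  then obtain \<delta> where \<delta>: "0 < \<delta>" "\<And>z. dist z x < \<delta> \<Longrightarrow> b < \<phi> z"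
    unfolding eventually_at using b(2) by (metis UNIV_I)
  \<comment> \<open>With this slope, travelling a distance \<open>\<delta> / 2\<close> costs at
    least \<open>r + 2 - C * h\<close>, which exceeds \<open>r\<close> once
    \<open>C * h \<le> 1\<close>.\<close>
  define K where "K = (r + 2) / (\<delta> / 2)"
  have K: "0 < K" "K * (\<delta> / 2) = r + 2" using r \<delta> by (auto simp: K_def)
  obtain C where C: "0 \<le> C" "\<And>x u. K * norm u - C \<le> L x u" using superlinear[of K] by auto
  have "a < ennreal (V (h, y))" if h: "0 < h" "h < min (\<delta> / 2) (1 / (C + 1))" "dist y x < min (\<delta> / 2) (1 / (C + 1))" for h y
  proof -
    have "\<not> value_fun L \<phi> h y < b"
    proof
      assume "value_fun L \<phi> h y < b"
      then obtain c z where c: "traj h c y z" "c + \<phi> z < b" unfolding value_fun_less_iff by blast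
      have "ennreal (K * norm (z - y) - C * h) \<le> c"
        by (rule traj_ge_norm[OF c(1) _ _ C(2)]) (use h K in auto)
      also have "c \<le> c + \<phi> z" by simp
      also have "c + \<phi> z \<le> ennreal r" using c(2) r(1) by simp
      finally have "K * norm (z - y) - C * h \<le> r" using r(2) by (rule ennreal_le_realD)
      moreover have "C * h \<le> 1"
      proof -
        have "h \<le> 1 / (C + 1)" using h by simp
        then have "h * (C + 1) \<le> 1" using C by (simp add: pos_le_divide_eq)
        then show ?thesis using h by (simp add: algebra_simps)
      qed
      ultimately have "K * norm (z - y) < K * (\<delta> / 2)" using K(2) by linarith
      then have "dist z y < \<delta> / 2" using K(1) by (simp add: mult_less_cancel_left dist_norm)
      then have "dist z x < \<delta>" using h(3) dist_triangle[of z x y] by simp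
      then have "b < \<phi> z" by (rule \<delta>(2))
      also have "\<phi> z \<le> c + \<phi> z" by simp
      finally show False using c(2) by simp
    qed
    then show ?thesis using b(1) h(1) by (simp add: ennreal_V)
  qed
  moreover have "0 < min (\<delta> / 2) (1 / (C + 1))" using \<delta> C by simp
  ultimately show "\<exists>\<delta>>0. \<forall>h y. 0 < h \<and> h < \<delta> \<and> dist y x < \<delta> \<longrightarrow> a < ennreal (V (h, y))" by blast
next
  fix x :: 'a and b :: ennreal and \<delta> :: real assume b: "\<phi> x < b" and \<delta>: "0 < \<delta>"
  obtain b' where b': "\<phi> x < b'" "b' < b" using b dense by blast
  then obtain q where q: "b' = ennreal q" "0 \<le> q" by (cases b') auto
  obtain p where p: "\<phi> x = ennreal p" "0 \<le> p" using b'(1) q by (cases "\<phi> x") auto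
  have pq: "p < q" using b'(1) p q by (simp add: ennreal_less_iff)
  define h where "h = min (\<delta> / 2) ((q - p) / (L x 0 + 1))"
  have L0: "0 \<le> L x 0" by (rule nonneg)
  have h: "0 < h" "h < \<delta>" using \<delta> pq L0 by (auto simp: h_def)
  have hL: "h * L x 0 \<le> q - p"
  proof -
    have "h \<le> (q - p) / (L x 0 + 1)" by (simp add: h_def)
    then have "h * (L x 0 + 1) \<le> q - p" using L0 by (simp add: pos_le_divide_eq)
    then show ?thesis using h(1) by (simp add: algebra_simps)
  qed
  obtain c where c: "traj h c x (x + h *\<^sub>R 0)" "c \<le> ennreal (h * L x 0)"
    using traj_line[of h x 0 "L x 0"] h(1) by auto
  have "ennreal (V (h, x)) \<le> c + \<phi> x" using value_fun_le[OF c(1), of \<phi>] h(1) by (simp add: ennreal_V)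
  also have "\<dots> \<le> ennreal (h * L x 0) + ennreal p" using c(2) p(1) by (intro add_mono) auto
  also have "\<dots> = ennreal (h * L x 0 + p)" using h L0 p(2) by simp
  also have "\<dots> \<le> ennreal q" using hL by (intro ennreal_leI) simp
  also have "\<dots> < b" using b'(2) q(1) by simp
  finally show "\<exists>h y. 0 < h \<and> h < \<delta> \<and> dist y x < \<delta> \<and> ennreal (V (h, y)) < b"
    using h \<delta> by (intro exI[of _ h] exI[of _ x]) simp
qed

end

section \<open>Hamiltonian inequalities as sub- and supersolutions; conclusion\<close>

context lagrangian
begin

lemma Hamiltonian_le_iff: "ereal p + Hamiltonian L x (- q) \<le> 0 \<longleftrightarrow> (\<forall>u. p - q \<bullet> u \<le> L x u)"
proof -
  have "ereal p + Hamiltonian L x (- q) \<le> 0 \<longleftrightarrow> Hamiltonian L x (- q) \<le> ereal (- p)"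
    by (cases "Hamiltonian L x (- q)") auto
  also have "\<dots> \<longleftrightarrow> (\<forall>u. p - q \<bullet> u \<le> L x u)"
    unfolding Hamiltonian_def SUP_le_iff by (auto simp: algebra_simps)
  finally show ?thesis .
qed

lemma Hamiltonian_ge_iff:
  "0 \<le> ereal p + Hamiltonian L x (- q) \<longleftrightarrow> (\<forall>\<epsilon>>0. \<exists>u. L x u < p - q \<bullet> u + \<epsilon>)"
proof -
  have "0 \<le> ereal p + Hamiltonian L x (- q) \<longleftrightarrow> ereal (- p) \<le> Hamiltonian L x (- q)"
    by (cases "Hamiltonian L x (- q)") auto
  also have "\<dots> \<longleftrightarrow> (\<forall>\<epsilon>>0. ereal (- p - \<epsilon>) < Hamiltonian L x (- q))"
  proof safe
    fix \<epsilon> :: real assume le: "ereal (- p) \<le> Hamiltonian L x (- q)" and "0 < \<epsilon>"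
    then have "ereal (- p - \<epsilon>) < ereal (- p)" by simp
    then show "ereal (- p - \<epsilon>) < Hamiltonian L x (- q)" using le by (rule less_le_trans)
  next
    assume *: "\<forall>\<epsilon>>0. ereal (- p - \<epsilon>) < Hamiltonian L x (- q)"
    show "ereal (- p) \<le> Hamiltonian L x (- q)"
    proof (rule ccontr)
      assume "\<not> ?thesis"
      then obtain r where r: "Hamiltonian L x (- q) < ereal r" "ereal r < ereal (- p)"
        using ereal_dense2[of "Hamiltonian L x (- q)" "ereal (- p)"] by (auto simp: not_le)
      then have "0 < - p - r" by simp
      with * have "ereal (- p - (- p - r)) < Hamiltonian L x (- q)" by blast
      then show False using r(1) by simp
    qed
  qed
  also have "\<dots> \<longleftrightarrow> (\<forall>\<epsilon>>0. \<exists>u. L x u < p - q \<bullet> u + \<epsilon>)"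
    unfolding Hamiltonian_def less_SUP_iff by (auto simp: algebra_simps)
  finally show ?thesis .
qed

lemma subsolution_iff:
  "subsolution W \<longleftrightarrow> (\<forall>(t, x)\<in>pos_times. \<forall>(p\<^sub>t, p\<^sub>x)\<in>subdiff W (t, x). ereal p\<^sub>t + Hamiltonian L x (- p\<^sub>x) \<le> 0)"
  unfolding subsolution_def Hamiltonian_le_iff by (auto simp: Ball_def)

lemma supersolution_iff:
  "supersolution W \<longleftrightarrow> (\<forall>(t, x)\<in>pos_times. \<forall>(p\<^sub>t, p\<^sub>x)\<in>subdiff W (t, x). 0 \<le> ereal p\<^sub>t + Hamiltonian L x (- p\<^sub>x))"
  unfolding supersolution_def Hamiltonian_ge_iff by (auto simp: Ball_def)

lemma HJ_subdiff_equation_iff: "HJ_subdiff_equation L W \<longleftrightarrow> subsolution W \<and> supersolution W"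
proof -
  have eq: "ereal p + Hamiltonian L x q = 0 \<longleftrightarrow>
      ereal p + Hamiltonian L x q \<le> 0 \<and> 0 \<le> ereal p + Hamiltonian L x q" for p x q
    by (rule order_eq_iff)
  show ?thesis
    unfolding HJ_subdiff_equation_def subsolution_iff supersolution_iff eq case_prod_unfold ball_conj_distrib
    by (rule refl)
qed

end

text \<open>Outside a ball the quotient is at least \<open>K\<close>; inside it,
  \<open>K * norm u\<close> is at most \<open>\<bar>K\<bar> * r\<close>, which serves as
  \<open>C\<close>. The absolute value covers negative slopes.\<close>

lemma superlinear_affine_minorant:
  fixes \<Theta> :: "'a::euclidean_space \<Rightarrow> real"
  assumes nonneg: "\<And>u. 0 \<le> \<Theta> u" and sup: "filterlim (\<lambda>u. \<Theta> u / norm u) at_top at_infinity"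
  shows "\<exists>C\<ge>0. \<forall>u. K * norm u - C \<le> \<Theta> u"
proof -
  have "\<forall>\<^sub>F u in at_infinity. K \<le> \<Theta> u / norm u"
    using sup by (simp add: filterlim_at_top)
  then obtain b where b: "\<And>u. b \<le> norm u \<Longrightarrow> K \<le> \<Theta> u / norm u"
    unfolding eventually_at_infinity by blast
  define r where "r = max b 1"
  have "K * norm u - \<bar>K\<bar> * r \<le> \<Theta> u" for u
  proof (cases "r \<le> norm u")
    case True
    then have "0 < norm u" "K \<le> \<Theta> u / norm u" using b[of u] by (auto simp: r_def)
    then have "K * norm u \<le> \<Theta> u" by (simp add: pos_le_divide_eq)
    moreover have "0 \<le> \<bar>K\<bar> * r" by (simp add: r_def)
    ultimately show ?thesis by linarith
  next
    case False
    have "K * norm u \<le> \<bar>K\<bar> * r" using False by (intro mult_mono) auto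
    then show ?thesis using nonneg[of u] by linarith
  qed
  moreover have "0 \<le> \<bar>K\<bar> * r" by (simp add: r_def)
  ultimately show ?thesis by blast
qed

theorem theorem4p5:
  fixes L :: "real ^ 'n \<Rightarrow> real ^ 'n \<Rightarrow> real"
    and \<Theta> :: "real ^ 'n \<Rightarrow> real"
    and \<phi> :: "real ^ 'n \<Rightarrow> ennreal"
  assumes L_nonneg: "\<And>x u. 0 \<le> L x u"
    and L_lsc: "lower_semicont (\<lambda>(x, u). ereal (L x u))"
    and L_convex: "\<And>x. convex_on UNIV (L x)"
    and Theta_nonneg: "\<And>u. 0 \<le> \<Theta> u"
    and Theta_convex: "convex_on UNIV \<Theta>"
    and Theta_superlinear: "filterlim (\<lambda>u. \<Theta> u / norm u) at_top at_infinity"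
    and L_ge_Theta: "\<And>x u. \<Theta> u \<le> L x u"
    and phi_lsc: "lower_semicont \<phi>"
    and phi_proper: "\<exists>x. \<phi> x \<noteq> \<infinity>"
    and L_cont: "continuous_on UNIV (\<lambda>(x, u). L x u)"
  shows
    "((\<forall>(t, x)\<in>pos_times. value_fun L \<phi> t x < \<infinity>) \<and>
      locally_lipschitz_on pos_times (value_real L \<phi>) \<and>
      HJ_subdiff_equation L (value_real L \<phi>))
    \<and>
     (\<forall>W :: real \<times> (real ^ 'n) \<Rightarrow> real.
       (\<forall>z\<in>pos_times. 0 \<le> W z) \<and> locally_lipschitz_on pos_times W \<and> initial_condition \<phi> W \<longrightarrow>
         ((\<forall>(t, x)\<in>pos_times. \<forall>(p\<^sub>t, p\<^sub>x)\<in>subdiff W (t, x).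
             0 \<le> ereal p\<^sub>t + Hamiltonian L x (- p\<^sub>x)) \<longrightarrow>
           (\<forall>z\<in>pos_times. value_real L \<phi> z \<le> W z)) \<and>
         ((\<forall>(t, x)\<in>pos_times. \<forall>(p\<^sub>t, p\<^sub>x)\<in>subdiff W (t, x).
             ereal p\<^sub>t + Hamiltonian L x (- p\<^sub>x) \<le> 0) \<longrightarrow>
           (\<forall>z\<in>pos_times. W z \<le> value_real L \<phi> z)))
    \<and>
     (((\<forall>z\<in>pos_times. 0 \<le> value_real L \<phi> z) \<and>
       locally_lipschitz_on pos_times (value_real L \<phi>) \<and>
       initial_condition \<phi> (value_real L \<phi>) \<and>
       HJ_subdiff_equation L (value_real L \<phi>)) \<and>
      (\<forall>W :: real \<times> (real ^ 'n) \<Rightarrow> real.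
        (\<forall>z\<in>pos_times. 0 \<le> W z) \<and> locally_lipschitz_on pos_times W \<and>
        initial_condition \<phi> W \<and> HJ_subdiff_equation L W \<longrightarrow>
          (\<forall>z\<in>pos_times. W z = value_real L \<phi> z)))"
proof -
  interpret bolza L \<phi>
  proof
    fix K :: real
    show "\<exists>C\<ge>0. \<forall>x u. K * norm u - C \<le> L x u"
      using superlinear_affine_minorant[OF Theta_nonneg Theta_superlinear, of K] L_ge_Theta
      by (meson order_trans)
  qed (fact L_nonneg L_cont phi_lsc phi_proper)+
  have fin: "\<forall>(t, x)\<in>pos_times. value_fun L \<phi> t x < \<infinity>"
    using value_fun_finite by auto
  have HJ: "HJ_subdiff_equation L V"
    by (simp add: HJ_subdiff_equation_iff V_subsolution V_supersolution)
  have ge: "\<forall>z\<in>pos_times. V z \<le> W z"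
    if "\<forall>z\<in>pos_times. 0 \<le> W z" "locally_lipschitz_on pos_times W" "initial_condition \<phi> W" "supersolution W" for W
    using comparison[OF that(4,2) _ that(3) V_subsolution V_locally_lipschitz V_nonneg V_initial_condition] that(1) by blast
  have le: "\<forall>z\<in>pos_times. W z \<le> V z"
    if "\<forall>z\<in>pos_times. 0 \<le> W z" "locally_lipschitz_on pos_times W" "initial_condition \<phi> W" "subsolution W" for W
    using comparison[OF V_supersolution V_locally_lipschitz V_nonneg V_initial_condition that(4,2) _ that(3)] that(1) by blast
  have uniq: "\<forall>z\<in>pos_times. W z = V z"
    if "\<forall>z\<in>pos_times. 0 \<le> W z" "locally_lipschitz_on pos_times W" "initial_condition \<phi> W" "HJ_subdiff_equation L W" for W
    using le[OF that(1-3)] ge[OF that(1-3)] that(4) unfolding HJ_subdiff_equation_iff by (simp add: order_eq_iff)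
  show ?thesis
    unfolding subsolution_iff[symmetric] supersolution_iff[symmetric]
    using fin HJ ge le uniq V_locally_lipschitz V_nonneg V_initial_condition by blast
qed

end
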